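(* Let $H$ be a complex separable Hilbert space, let $E=H_{\mathbb{R}}\times H_{\mathbb{R}}$ be the associated symplectic Hilbert space with $J=\begin{pmatrix}0&-I_{H_{\mathbb{R}}}\\ I_{H_{\mathbb{R}}}&0\end{pmatrix}$, and let $\Lambda_0=H_{\mathbb{R}}\times\{0\}\in\Lambda(E)$. For any path $\mathcal{A}=\{\mathcal{A}_\lambda\}_{\lambda\in I}$, $I=[0,1]$, in $\mathcal{CF}^{\mathrm{sa}}(H)$ (continuous with respect to the gap-metric), $$\operatorname{sf}(\mathcal{A})=\mu_{Mas}\bigl(\{\operatorname{graph}(\mathcal{A}_\lambda)\}_{\lambda\in I},\Lambda_0\bigr).$$
   Context: $\mathcal{CF}^{\mathrm{sa}}(H)$ is the set of (generally unbounded) selfadjoint Fredholm operators on $H$ with the gap-metric $d_G(T,S)=\|P_T-P_S\|$, where $P_T,P_S$ are the orthogonal projections in $H\times H$ onto the graphs. $H_{\mathbb{R}}$ is the realification of $H$ with scalar product $\operatorname{Re}\langle\cdot,\cdot\rangle$. Spectral flow: let $\chi_{[a,b]}(T)$ be the spectral projection of $T$ for $[a,b]$. There are a partition $0=\lambda_0<\dots<\lambda_N=1$ and $a_i>0$ such that $\pm a_i\notin\sigma(\mathcal{A}_\lambda)$ and $[-a_i,a_i]\cap\sigma_{ess}(\mathcal{A}_\lambda)=\emptyset$ for $\lambda\in[\lambda_{i-1},\lambda_i]$, and $\lambda\mapsto\chi_{[-a_i,a_i]}(\mathcal{A}_\lambda)$ is norm-continuous there; then $$\operatorname{sf}(\mathcal{A})=\sum_{i=1}^N\left(\dim\operatorname{im}\chi_{[0,a_i]}(\mathcal{A}_{\lambda_i})-\dim\operatorname{im}\chi_{[0,a_i]}(\mathcal{A}_{\lambda_{i-1}})\right),$$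 independently of the choices. Symplectic Hilbert spaces: a real separable Hilbert space $E$ with a bounded operator $J$ such that $J^2=-I_E$, $J^\ast=-J$; $\omega_0(u,v)=\langle Ju,v\rangle_E$. A subspace $L\subset E$ is Lagrangian if $L^\perp=JL$. The set $\Lambda(E)$ of Lagrangian subspaces has the metric $d(L_1,L_2)=\|P_{L_1}-P_{L_2}\|$, where $P_L$ is the orthogonal projection onto $L$. Closed subspaces $L_1,L_2$ form a Fredholm pair if $\dim(L_1\cap L_2)<\infty$ and $\operatorname{codim}(L_1+L_2)<\infty$. For $L_0\in\Lambda(E)$, $\mathcal{FL}_{L_0}(E)=\{L\in\Lambda(E):(L,L_0)\text{ is a Fredholm pair}\}$. If $T\in\mathcal{CF}^{\mathrm{sa}}(H)$ then $\operatorname{graph}(T)\in\mathcal{FL}_{\Lambda_0}(E)$, and gap-continuous paths give continuous paths of graphs. Maslov index $\mu_{Mas}(\Lambda,L_0)\in\mathbb{Z}$ of a continuous path $\Lambda:I\to\mathcal{FL}_{L_0}(E)$ (Booss-Bavnbek--Furutani): it counts, with signs, the dimensions of $\Lambda(\lambda)\cap L_0$ as $\lambda$ travels along $I$. Explicitly, choose a partition $0=\lambda_0<\dots<\lambda_N=1$ and $\alpha_i\in(0,\frac{\pi}{2})$ such that for all $\lambda\in[\lambda_{i-1},\lambda_i]$ the pair $(e^{-\theta J}\Lambda(\lambda),L_0)$ is Fredholm for $|\theta|\leq\alpha_i$ and $e^{-\theta J}\Lambda(\lambda)\cap L_0=\{0\}$ for $\theta=\pm\alpha_i$. Then $$\mu_{Mas}(\Lambda,L_0)=\sum_{i=1}^N\bigl(k(\lambda_i,\alpha_i)-k(\lambda_{i-1},\alpha_i)\bigr),\qquad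 k(\lambda,\alpha)=\sum_{0\leq\theta\leq\alpha}\dim\bigl(e^{-\theta J}\Lambda(\lambda)\cap L_0\bigr),$$ independently of the choices. It vanishes if $\Lambda(\lambda)\cap L_0=\{0\}$ for all $\lambda$, is additive under concatenation, and is invariant under homotopies in $\mathcal{FL}_{L_0}(E)$ with fixed endpoints. Normalisation: if $\Lambda$ is differentiable, $\lambda_0$ is the only parameter with $\Lambda(\lambda_0)\cap L_0\neq\{0\}$, $\Lambda(\lambda)=\{u+\phi_\lambda(u):u\in\Lambda(\lambda_0)\}$ near $\lambda_0$ with $\phi_\lambda:\Lambda(\lambda_0)\to L$ bounded and differentiable in $\lambda$ for some Lagrangian $L$ with $L\cap\Lambda(\lambda_0)=\{0\}$, and $\mathcal{Q}[u]=\frac{d}{d\lambda}|_{\lambda=\lambda_0}\omega_0(u,\phi_\lambda(u))$ is positive definite on $\Lambda(\lambda_0)\cap L_0$, then $\mu_{Mas}(\Lambda|_{[0,\lambda_0]},L_0)=\dim(\Lambda(\lambda_0)\cap L_0)$ and $\mu_{Mas}(\Lambda|_{[\lambda_0,1]},L_0)=0$.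
   Formalization: All dimensions, including those of im χ in the spectral flow, are taken over the reals; with complex dimensions in sf the stated equality is off by a factor 2 (H = C, A_λ = λ − 1/2 gives sf = 1 but Maslov index 2). *)

theory Defs
  imports "HOL-Analysis.Analysis"
begin

section \<open>Complex Hilbert spaces\<close>

text \<open>
  The real structure inherited from \<^class>\<open>real_inner\<close> (scalar multiplication \<^const>\<open>scaleR\<close>, scalar
  product \<^const>\<open>inner\<close>) is the realification of the complex one: the axioms
  \<open>scaleR_scaleC\<close> and \<open>inner_cinner\<close> say so. Hence a type \<open>'h\<close> of this class also plays the role
  of \<open>H\<^sub>\<real>\<close>, and the product type \<open>'h \<times> 'h\<close>, with the scalar product of
  \<^theory>\<open>HOL-Analysis.Product_Vector\<close>, that of \<open>E = H\<^sub>\<real> \<times> H\<^sub>\<real>\<close>. The scalar product \<open>cinner\<close> is linear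
  in its first argument.
\<close>

class complex_hilbert_space = real_inner + complete_space +
  fixes scaleC :: "complex \<Rightarrow> 'a \<Rightarrow> 'a" (infixr "*\<^sub>C" 75)
    and cinner :: "'a \<Rightarrow> 'a \<Rightarrow> complex"
  assumes scaleC_add_right: "c *\<^sub>C (x + y) = c *\<^sub>C x + c *\<^sub>C y"
    and scaleC_add_left: "(c + d) *\<^sub>C x = c *\<^sub>C x + d *\<^sub>C x"
    and scaleC_scaleC: "c *\<^sub>C d *\<^sub>C x = (c * d) *\<^sub>C x"
    and scaleR_scaleC: "r *\<^sub>R x = complex_of_real r *\<^sub>C x"
    and cinner_commute: "cinner x y = cnj (cinner y x)"
    and cinner_add_left: "cinner (x + y) z = cinner x z + cinner y z"
    and cinner_scaleC_left: "cinner (c *\<^sub>C x) y = c * cinner x y"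
    and inner_cinner: "inner x y = Re (cinner x y)"

instantiation complex :: complex_hilbert_space
begin

definition scaleC_complex :: "complex \<Rightarrow> complex \<Rightarrow> complex"
  where "scaleC_complex c x = c * x"

definition cinner_complex :: "complex \<Rightarrow> complex \<Rightarrow> complex"
  where "cinner_complex x y = x * cnj y"

instance
  by standard
    (simp_all add: scaleC_complex_def cinner_complex_def inner_complex_def algebra_simps
      scaleR_conv_of_real)

end

text \<open>
  \<^const>\<open>span\<close> and \<^const>\<open>dim\<close> refer to the real vector space structure throughout. For complex
  subspaces, having finite (co)dimension over the reals and over the complex numbers is the same.
\<close>

definition finite_dimensional :: "'a::real_vector set \<Rightarrow> bool"
  where "finite_dimensional S \<longleftrightarrow> (\<exists>B. finite B \<and> span B = S)"

definition finite_codimensional :: "'a::real_vector set \<Rightarrow> bool"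
  where "finite_codimensional S \<longleftrightarrow> (\<exists>B. finite B \<and> span (S \<union> B) = UNIV)"

definition csubspace :: "'h::complex_hilbert_space set \<Rightarrow> bool"
  where "csubspace S \<longleftrightarrow>
    0 \<in> S \<and> (\<forall>x\<in>S. \<forall>y\<in>S. x + y \<in> S) \<and> (\<forall>c. \<forall>x\<in>S. c *\<^sub>C x \<in> S)"

definition bounded_clinear :: "('h::complex_hilbert_space \<Rightarrow> 'h) \<Rightarrow> bool"
  where "bounded_clinear P \<longleftrightarrow> bounded_linear P \<and> (\<forall>c x. P (c *\<^sub>C x) = c *\<^sub>C P x)"

text \<open>
  The orthogonal projection onto a closed subspace. On a complex subspace, orthogonality with
  respect to the real part of the scalar product is the same as complex orthogonality.
\<close>

definition orth_proj :: "'e::real_inner set \<Rightarrow> 'e \<Rightarrow> 'e"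
  where "orth_proj L x = (THE y. y \<in> L \<and> x - y \<in> L\<^sup>\<bottom>)"


section \<open>Unbounded selfadjoint Fredholm operators\<close>

text \<open>The values of \<open>op_fun T\<close> outside of \<open>op_dom T\<close> are irrelevant.\<close>

datatype 'h operator = Operator (op_dom: "'h set") (op_fun: "'h \<Rightarrow> 'h")

definition op_graph :: "'h operator \<Rightarrow> ('h \<times> 'h) set"
  where "op_graph T = {(x, op_fun T x) | x. x \<in> op_dom T}"

definition linear_operator :: "'h::complex_hilbert_space operator \<Rightarrow> bool"
  where "linear_operator T \<longleftrightarrow>
    csubspace (op_dom T) \<and>
    (\<forall>x\<in>op_dom T. \<forall>y\<in>op_dom T. op_fun T (x + y) = op_fun T x + op_fun T y) \<and>
    (\<forall>c. \<forall>x\<in>op_dom T. op_fun T (c *\<^sub>C x) = c *\<^sub>C op_fun T x)"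

definition adjoint_operator :: "'h::complex_hilbert_space operator \<Rightarrow> 'h operator"
  where "adjoint_operator T = Operator
    {y. \<exists>z. \<forall>x\<in>op_dom T. cinner (op_fun T x) y = cinner x z}
    (\<lambda>y. THE z. \<forall>x\<in>op_dom T. cinner (op_fun T x) y = cinner x z)"

definition selfadjoint :: "'h::complex_hilbert_space operator \<Rightarrow> bool"
  where "selfadjoint T \<longleftrightarrow>
    linear_operator T \<and> closure (op_dom T) = UNIV \<and>
    op_graph (adjoint_operator T) = op_graph T"

definition fredholm :: "'h::complex_hilbert_space operator \<Rightarrow> bool"
  where "fredholm T \<longleftrightarrow>
    linear_operator T \<and> closed (op_graph T) \<and>
    finite_dimensional {x \<in> op_dom T. op_fun T x = 0} \<and>
    closed (op_fun T ` op_dom T) \<and> finite_codimensional (op_fun T ` op_dom T)"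

definition CF_sa :: "'h::complex_hilbert_space operator set"
  where "CF_sa = {T. selfadjoint T \<and> fredholm T}"

definition gap_dist :: "'h::complex_hilbert_space operator \<Rightarrow> 'h operator \<Rightarrow> real"
  where "gap_dist T S = onorm (\<lambda>z. orth_proj (op_graph T) z - orth_proj (op_graph S) z)"

definition gap_continuous_on :: "real set \<Rightarrow> (real \<Rightarrow> 'h::complex_hilbert_space operator) \<Rightarrow> bool"
  where "gap_continuous_on I A \<longleftrightarrow>
    (\<forall>t\<in>I. ((\<lambda>s. gap_dist (A s) (A t)) \<longlongrightarrow> 0) (at t within I))"


section \<open>Spectrum and spectral projections\<close>

definition shift_operator :: "'h::complex_hilbert_space operator \<Rightarrow> complex \<Rightarrow> 'h operator"
  where "shift_operator T z = Operator (op_dom T) (\<lambda>x. op_fun T x - z *\<^sub>C x)"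

definition resolvent_set :: "'h::complex_hilbert_space operator \<Rightarrow> complex set"
  where "resolvent_set T =
    {z. bij_betw (op_fun (shift_operator T z)) (op_dom T) UNIV \<and>
        bounded_clinear (inv_into (op_dom T) (op_fun (shift_operator T z)))}"

definition spectrum :: "'h::complex_hilbert_space operator \<Rightarrow> complex set"
  where "spectrum T = - resolvent_set T"

definition ess_spectrum :: "'h::complex_hilbert_space operator \<Rightarrow> complex set"
  where "ess_spectrum T = {z. \<not> fredholm (shift_operator T z)}"

definition orthogonal_projection :: "('h::complex_hilbert_space \<Rightarrow> 'h) \<Rightarrow> bool"
  where "orthogonal_projection P \<longleftrightarrow>
    bounded_clinear P \<and> P \<circ> P = P \<and> (\<forall>x y. cinner (P x) y = cinner x (P y))"

text \<open>A resolution of the identity: \<open>F t\<close> is the spectral projection for \<open>{..t}\<close>.\<close>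

definition spectral_family :: "(real \<Rightarrow> 'h::complex_hilbert_space \<Rightarrow> 'h) \<Rightarrow> bool"
  where "spectral_family F \<longleftrightarrow>
    (\<forall>t. orthogonal_projection (F t)) \<and>
    (\<forall>s t. s \<le> t \<longrightarrow> range (F s) \<subseteq> range (F t)) \<and>
    (\<forall>x t. ((\<lambda>s. F s x) \<longlongrightarrow> F t x) (at_right t)) \<and>
    (\<forall>x. ((\<lambda>t. F t x) \<longlongrightarrow> 0) at_bot) \<and>
    (\<forall>x. ((\<lambda>t. F t x) \<longlongrightarrow> x) at_top)"

text \<open>The Lebesgue-Stieltjes measure \<open>d\<langle>F\<^sub>t x, x\<rangle> = d\<parallel>F\<^sub>t x\<parallel>\<^sup>2\<close>.\<close>

definition spectral_measure_at :: "(real \<Rightarrow> 'h::complex_hilbert_space \<Rightarrow> 'h) \<Rightarrow> 'h \<Rightarrow> real measure"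
  where "spectral_measure_at F x = interval_measure (\<lambda>t. (norm (F t x))\<^sup>2)"

text \<open>
  \<open>T = \<integral> t dF\<^sub>t\<close>; by polarisation the quadratic form determines the operator on its domain.
\<close>

definition is_spectral_family_of ::
    "'h::complex_hilbert_space operator \<Rightarrow> (real \<Rightarrow> 'h \<Rightarrow> 'h) \<Rightarrow> bool"
  where "is_spectral_family_of T F \<longleftrightarrow>
    spectral_family F \<and>
    op_dom T = {x. integrable (spectral_measure_at F x) (\<lambda>t. t\<^sup>2)} \<and>
    (\<forall>x\<in>op_dom T.
      cinner (op_fun T x) x = complex_of_real (\<integral>t. t \<partial>spectral_measure_at F x))"

text \<open>By the spectral theorem, a selfadjoint operator has exactly one spectral family.\<close>

definition spectral_family_of :: "'h::complex_hilbert_space operator \<Rightarrow> real \<Rightarrow> 'h \<Rightarrow> 'h"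
  where "spectral_family_of T = (SOME F. is_spectral_family_of T F)"

text \<open>
  \<open>\<chi>\<^sub>S(T) = \<integral> \<chi>\<^sub>S(t) dF\<^sub>t\<close> for a Borel set \<open>S\<close>, again expressed through quadratic forms; the
  integral of the indicator function is the measure of \<open>S\<close>.
\<close>

definition spectral_proj :: "real set \<Rightarrow> 'h::complex_hilbert_space operator \<Rightarrow> 'h \<Rightarrow> 'h"
  where "spectral_proj S T = (THE P. bounded_clinear P \<and>
    (\<forall>x. cinner (P x) x =
      complex_of_real (measure (spectral_measure_at (spectral_family_of T) x) S)))"


section \<open>Spectral flow\<close>

text \<open>
  All dimensions, here and in the Maslov index below, are dimensions over the reals, i.e. the images
  of the spectral projections are regarded as subspaces of \<open>H\<^sub>\<real>\<close>. The Maslov index of a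
  path of (real) Lagrangian subspaces only makes sense with real dimensions, and comparing it with
  the spectral flow requires the same convention on both sides: measured by complex dimensions,
  the spectral flow is half of the integer defined here.
\<close>

definition is_spectral_flow :: "(real \<Rightarrow> 'h::complex_hilbert_space operator) \<Rightarrow> int \<Rightarrow> bool"
  where "is_spectral_flow A m \<longleftrightarrow>
    (\<exists>(N::nat) (l::nat \<Rightarrow> real) (a::nat \<Rightarrow> real).
      l 0 = 0 \<and> l N = 1 \<and> (\<forall>i\<in>{1..N}. l (i - 1) < l i) \<and>
      (\<forall>i\<in>{1..N}. 0 < a i \<and>
        (\<forall>t\<in>{l (i - 1)..l i}.
          complex_of_real (a i) \<notin> spectrum (A t) \<and>
          complex_of_real (- a i) \<notin> spectrum (A t) \<and>
          complex_of_real ` {- a i..a i} \<inter> ess_spectrum (A t) = {} \<and>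
          ((\<lambda>s. onorm (\<lambda>x. spectral_proj {- a i..a i} (A s) x - spectral_proj {- a i..a i} (A t) x))
            \<longlongrightarrow> 0) (at t within {l (i - 1)..l i}))) \<and>
      m = (\<Sum>i=1..N. int (dim (range (spectral_proj {0..a i} (A (l i)))))
                   - int (dim (range (spectral_proj {0..a i} (A (l (i - 1))))))))"

definition spectral_flow :: "(real \<Rightarrow> 'h::complex_hilbert_space operator) \<Rightarrow> int"
  where "spectral_flow A = (THE m. is_spectral_flow A m)"


section \<open>Symplectic Hilbert spaces and the Maslov index\<close>

definition symplectic_structure :: "('e::{real_inner,complete_space} \<Rightarrow> 'e) \<Rightarrow> bool"
  where "symplectic_structure J \<longleftrightarrow>
    bounded_linear J \<and> (\<forall>u. J (J u) = - u) \<and> (\<forall>u v. inner (J u) v = inner u (- J v))"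

definition lagrangian ::
    "('e::{real_inner,complete_space} \<Rightarrow> 'e) \<Rightarrow> 'e set \<Rightarrow> bool"
  where "lagrangian J L \<longleftrightarrow> subspace L \<and> L\<^sup>\<bottom> = J ` L"

definition fredholm_pair :: "'e::{real_inner,complete_space} set \<Rightarrow> 'e set \<Rightarrow> bool"
  where "fredholm_pair L1 L2 \<longleftrightarrow>
    subspace L1 \<and> closed L1 \<and> subspace L2 \<and> closed L2 \<and>
    finite_dimensional (L1 \<inter> L2) \<and> finite_codimensional {u + v | u v. u \<in> L1 \<and> v \<in> L2}"

definition fredholm_lagrangians ::
    "('e::{real_inner,complete_space} \<Rightarrow> 'e) \<Rightarrow> 'e set \<Rightarrow> 'e set set"
  where "fredholm_lagrangians J L0 = {L. lagrangian J L \<and> fredholm_pair L L0}"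

definition lagrangian_dist :: "'e::{real_inner,complete_space} set \<Rightarrow> 'e set \<Rightarrow> real"
  where "lagrangian_dist L1 L2 = onorm (\<lambda>u. orth_proj L1 u - orth_proj L2 u)"

definition fredholm_lagrangian_path ::
    "('e::{real_inner,complete_space} \<Rightarrow> 'e) \<Rightarrow> (real \<Rightarrow> 'e set) \<Rightarrow> 'e set \<Rightarrow> bool"
  where "fredholm_lagrangian_path J \<Lambda> L0 \<longleftrightarrow>
    symplectic_structure J \<and> lagrangian J L0 \<and>
    (\<forall>t\<in>{0..1}. \<Lambda> t \<in> fredholm_lagrangians J L0) \<and>
    (\<forall>t\<in>{0..1}. ((\<lambda>s. lagrangian_dist (\<Lambda> s) (\<Lambda> t)) \<longlongrightarrow> 0) (at t within {0..1}))"

text \<open>The exponential series of a bounded operator, evaluated pointwise.\<close>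

definition op_exp :: "('e::{real_inner,complete_space} \<Rightarrow> 'e) \<Rightarrow> 'e \<Rightarrow> 'e"
  where "op_exp B u = (\<Sum>n. (B ^^ n) u /\<^sub>R fact n)"

definition rotate_subspace ::
    "('e::{real_inner,complete_space} \<Rightarrow> 'e) \<Rightarrow> real \<Rightarrow> 'e set \<Rightarrow> 'e set"
  where "rotate_subspace J \<theta> L = op_exp (\<lambda>u. - \<theta> *\<^sub>R J u) ` L"

text \<open>
  The sum over all \<open>\<theta> \<in> [0, \<alpha>]\<close> is restricted to the angles with a nonzero contribution; under the
  Fredholm assumption in \<open>is_maslov_index\<close> there are only finitely many of them.
\<close>

definition rotation_count ::
    "('e::{real_inner,complete_space} \<Rightarrow> 'e) \<Rightarrow> 'e set \<Rightarrow> 'e set \<Rightarrow> real \<Rightarrow> nat"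
  where "rotation_count J L0 L \<alpha> =
    (\<Sum>\<theta> | 0 \<le> \<theta> \<and> \<theta> \<le> \<alpha> \<and> rotate_subspace J \<theta> L \<inter> L0 \<noteq> {0}.
      dim (rotate_subspace J \<theta> L \<inter> L0))"

definition is_maslov_index ::
    "('e::{real_inner,complete_space} \<Rightarrow> 'e) \<Rightarrow> (real \<Rightarrow> 'e set) \<Rightarrow> 'e set \<Rightarrow> int \<Rightarrow> bool"
  where "is_maslov_index J \<Lambda> L0 m \<longleftrightarrow>
    fredholm_lagrangian_path J \<Lambda> L0 \<and>
    (\<exists>(N::nat) (l::nat \<Rightarrow> real) (\<alpha>::nat \<Rightarrow> real).
      l 0 = 0 \<and> l N = 1 \<and> (\<forall>i\<in>{1..N}. l (i - 1) < l i) \<and>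
      (\<forall>i\<in>{1..N}. 0 < \<alpha> i \<and> \<alpha> i < pi / 2 \<and>
        (\<forall>t\<in>{l (i - 1)..l i}.
          (\<forall>\<theta>. \<bar>\<theta>\<bar> \<le> \<alpha> i \<longrightarrow> fredholm_pair (rotate_subspace J \<theta> (\<Lambda> t)) L0) \<and>
          rotate_subspace J (\<alpha> i) (\<Lambda> t) \<inter> L0 = {0} \<and>
          rotate_subspace J (- \<alpha> i) (\<Lambda> t) \<inter> L0 = {0})) \<and>
      m = (\<Sum>i=1..N. int (rotation_count J L0 (\<Lambda> (l i)) (\<alpha> i))
                   - int (rotation_count J L0 (\<Lambda> (l (i - 1))) (\<alpha> i))))"

definition maslov_index ::
    "('e::{real_inner,complete_space} \<Rightarrow> 'e) \<Rightarrow> (real \<Rightarrow> 'e set) \<Rightarrow> 'e set \<Rightarrow> int"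
  where "maslov_index J \<Lambda> L0 = (THE m. is_maslov_index J \<Lambda> L0 m)"

definition standard_J :: "'h::complex_hilbert_space \<times> 'h \<Rightarrow> 'h \<times> 'h"
  where "standard_J = (\<lambda>(x, y). (- y, x))"

definition horizontal_lagrangian :: "('h::complex_hilbert_space \<times> 'h) set"
  where "horizontal_lagrangian = UNIV \<times> {0}"

end

theory Submission
  imports Defs "HOL-Probability.Distribution_Functions"
begin

text \<open>
  Since \<open>e\<^sup>-\<^sup>\<theta>\<^sup>J\<close> maps \<open>(x, T x)\<close> to \<open>(cos \<theta> x + sin \<theta> T x, cos \<theta> (T x - tan \<theta> x))\<close>, the rotated graph meets
  \<open>\<Lambda>\<^sub>0\<close> in a copy of \<open>ker (T - tan \<theta>)\<close>, and the two form a Fredholm pair iff \<open>T - tan \<theta>\<close> is Fredholm.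
  With \<open>a = tan \<alpha>\<close>, a partition is therefore admissible for the Maslov index iff it is admissible
  for the spectral flow, and the two sums agree term by term: if \<open>[- a, a]\<close> does not meet the
  essential spectrum, then the image of \<open>\<chi>\<^bsub>[0,a]\<^esub>(T)\<close> is the sum of the eigenspaces for
  eigenvalues in \<open>[0, a]\<close>.

  This requires the spectral theorem, obtained from the signs of the bounded operators
  \<open>(T - t) (1 + T\<^sup>2)\<^sup>-\<^sup>1\<close>, and the continuity of \<open>\<chi>\<^bsub>[- a,a]\<^esub>\<close> along gap-continuous paths when \<open>\<plusminus>a\<close> are
  not in the spectrum. For the latter, \<open>\<chi>\<^bsub>[- a,a]\<^esub>(T)\<close> is the positive spectral projection of
  \<open>(1 + a\<^sup>2) (1 + T\<^sup>2)\<^sup>-\<^sup>1 - 1 = (a\<^sup>2 - T\<^sup>2) (1 + T\<^sup>2)\<^sup>-\<^sup>1\<close>, which is invertible and depends continuously on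
  the projection onto the graph.
\<close>

section \<open>Projections and uniform boundedness\<close>

text \<open>Two mismatches between the definitions shape the work. A Fredholm pair asks only for
  finite codimension of the sum, while a Fredholm operator must also have closed range. Uniform
  boundedness bridges this: finite codimension forces a positive lower bound for T - t off its
  kernel. The same bound isolates the eigenvalues in the window, turns \<plusminus>a into resolvent
  points and makes the operator behind the continuity proof coercive. Secondly, spectral projections
  are defined by integrals against a family picked by \<open>SOME\<close>, so every family with
  these integrals has to be shown to obey order bounds: T \<le> t on the range of F t and T \<ge> t
  on its kernel. The factor (1 + T^2)^-1 serves twice: it makes the operators bounded, and it is a
  corner of the graph projection, the object that the gap metric controls. The analysis is real; the
  complex structure enters as one more bounded operator, multiplication by i, which commutes with T
  and hence with its spectral family. Both indices are definite descriptions, and they agree because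
  the describing predicates hold of the same integers.\<close>

lemma hilbert_projection_exists:
  fixes L :: "'a::{real_inner,complete_space} set"
  assumes sub: "subspace L" and cl: "closed L"
  shows "\<exists>y\<in>L. \<forall>z\<in>L. inner (x - y) z = 0"
proof -
  define \<delta> where "\<delta> = (INF y\<in>L. (norm (x - y))\<^sup>2)"
  have bdd: "bdd_below ((\<lambda>y. (norm (x - y))\<^sup>2) ` L)"
    by (rule bdd_belowI[of _ 0]) auto
  have le: "\<delta> \<le> (norm (x - y))\<^sup>2" if "y \<in> L" for y
    unfolding \<delta>_def by (rule cINF_lower[OF bdd that])
  have "\<exists>y\<in>L. (norm (x - y))\<^sup>2 < \<delta> + e" if "e > 0" for e
  proof -
    have "L \<noteq> {}" using subspace_0[OF sub] by auto
    then show ?thesis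
      using cINF_less_iff[OF _ bdd, of "\<delta> + e"] that unfolding \<delta>_def by auto
  qed
  then have "\<forall>n. \<exists>y\<in>L. (norm (x - y))\<^sup>2 < \<delta> + inverse (real (Suc n))" by simp
  then obtain y where yL: "\<And>n. y n \<in> L"
    and y: "\<And>n. (norm (x - y n))\<^sup>2 < \<delta> + inverse (real (Suc n))"
    by metis
  \<comment> \<open>Parallelogram law: the midpoint of \<open>y m\<close> and \<open>y n\<close>
    lies in \<open>L\<close>, hence at squared distance at least \<delta>, so two near-minimisers
    are close to each other.\<close>
  have para: "(norm (y m - y n))\<^sup>2 \<le> 2 * inverse (real (Suc m)) + 2 * inverse (real (Suc n))" for m n
  proof -
    have "(1/2) *\<^sub>R (y m + y n) \<in> L"
      using yL sub by (simp add: subspace_add subspace_scale)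
    from le[OF this] have "4 * \<delta> \<le> (norm ((x - y m) + (x - y n)))\<^sup>2"
    proof -
      have "(x - y m) + (x - y n) = 2 *\<^sub>R (x - (1/2) *\<^sub>R (y m + y n))"
        by (simp add: algebra_simps scaleR_2)
      then have "(norm ((x - y m) + (x - y n)))\<^sup>2 = 4 * (norm (x - (1/2) *\<^sub>R (y m + y n)))\<^sup>2"
        by (simp only: norm_scaleR power_mult_distrib) simp
      with \<open>\<delta> \<le> (norm (x - (1/2) *\<^sub>R (y m + y n)))\<^sup>2\<close> show ?thesis by simp
    qed
    moreover have "(norm (y m - y n))\<^sup>2 =
        2 * (norm (x - y m))\<^sup>2 + 2 * (norm (x - y n))\<^sup>2 - (norm ((x - y m) + (x - y n)))\<^sup>2"
      by (simp add: power2_norm_eq_inner algebra_simps inner_commute)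
    ultimately show ?thesis using y[of m] y[of n] by linarith
  qed
  have "Cauchy y"
  proof (rule metric_CauchyI)
    fix e :: real assume e: "e > 0"
    obtain N where N: "inverse (real (Suc N)) < e\<^sup>2 / 4"
      using reals_Archimedean[of "e\<^sup>2 / 4"] e by auto
    have "dist (y m) (y n) < e" if "m \<ge> N" "n \<ge> N" for m n
    proof -
      have "inverse (real (Suc m)) \<le> inverse (real (Suc N))"
        "inverse (real (Suc n)) \<le> inverse (real (Suc N))"
        using that by (auto intro!: le_imp_inverse_le)
      then have "(norm (y m - y n))\<^sup>2 < e\<^sup>2"
        using para[of m n] N by linarith
      then show ?thesis using e by (simp add: dist_norm power_less_imp_less_base)
    qed
    then show "\<exists>M. \<forall>m\<ge>M. \<forall>n\<ge>M. dist (y m) (y n) < e" by blast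
  qed
  then obtain p where p: "y \<longlonglongrightarrow> p"
    using Cauchy_convergent convergent_def by blast
  have pL: "p \<in> L" using closed_sequentially[OF cl] yL p by blast
  have "(norm (x - p))\<^sup>2 \<le> \<delta>"
  proof (rule LIMSEQ_le)
    show "(\<lambda>n. (norm (x - y n))\<^sup>2) \<longlonglongrightarrow> (norm (x - p))\<^sup>2"
      by (intro tendsto_intros p)
    show "(\<lambda>n. \<delta> + inverse (real (Suc n))) \<longlonglongrightarrow> \<delta>"
      using tendsto_add[OF tendsto_const LIMSEQ_inverse_real_of_nat] by force
    show "\<exists>N. \<forall>n\<ge>N. (norm (x - y n))\<^sup>2 \<le> \<delta> + inverse (real (Suc n))"
      using y less_imp_le by blast
  qed
  with le have min: "(norm (x - p))\<^sup>2 \<le> (norm (x - q))\<^sup>2" if "q \<in> L" for q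
    using that order_trans by blast
  have "inner (x - p) z = 0" if z: "z \<in> L" for z
  proof (rule ccontr)
    assume nz: "inner (x - p) z \<noteq> 0"
    then have z0: "inner z z > 0" by (metis inner_gt_zero_iff inner_zero_right)
    \<comment> \<open>Coefficient of x - p along z: moving p by r z would lower the squared distance
      by <x - p, z>^2 / <z, z>.\<close>
    define r where "r = inner (x - p) z / inner z z"
    have "p + r *\<^sub>R z \<in> L" using pL z sub by (simp add: subspace_add subspace_scale)
    from min[OF this] have "inner (x - p) (x - p) \<le>
        inner (x - p) (x - p) - 2 * r * inner (x - p) z + r * r * inner z z"
      unfolding power2_norm_eq_inner by (simp add: algebra_simps inner_commute)
    moreover have "r * inner z z = inner (x - p) z" using z0 unfolding r_def by simp
    ultimately have "r * inner (x - p) z \<le> 0" by (simp add: algebra_simps)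
    moreover have "r * inner (x - p) z = (inner (x - p) z)\<^sup>2 / inner z z"
      unfolding r_def by (simp add: power2_eq_square)
    ultimately show False using nz z0
      by (metis divide_pos_pos not_less zero_less_power2)
  qed
  with pL show ?thesis by blast
qed

lemma orth_proj_unique:
  fixes L :: "'a::real_inner set"
  assumes "subspace L" and "y \<in> L" and "x - y \<in> L\<^sup>\<bottom>"
  shows "orth_proj L x = y"
  unfolding orth_proj_def
proof (rule the_equality)
  fix y' assume y': "y' \<in> L \<and> x - y' \<in> L\<^sup>\<bottom>"
  have d: "y' - y \<in> L" using assms y' by (simp add: subspace_diff)
  have "(x - y) - (x - y') \<in> L\<^sup>\<bottom>"
    using assms(3) y' subspace_diff[OF subspace_orthogonal_comp] by blast
  with d have "inner (y' - y) (y' - y) = 0"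
    by (simp add: orthogonal_comp_def orthogonal_def)
  then show "y' = y" by simp
qed (use assms in blast)

context
  fixes L :: "'a::{real_inner,complete_space} set"
  assumes sub: "subspace L" and cl: "closed L"
begin

lemma orth_proj_in: "orth_proj L x \<in> L" and orth_proj_diff: "x - orth_proj L x \<in> L\<^sup>\<bottom>"
proof -
  obtain y where y: "y \<in> L" "\<forall>z\<in>L. inner (x - y) z = 0"
    using hilbert_projection_exists[OF sub cl] by blast
  then have "x - y \<in> L\<^sup>\<bottom>"
    by (simp add: orthogonal_comp_def orthogonal_def inner_commute)
  then show "orth_proj L x \<in> L" "x - orth_proj L x \<in> L\<^sup>\<bottom>"
    using orth_proj_unique[OF sub y(1)] y(1) by auto
qed

lemma inner_orth_proj_diff: "z \<in> L \<Longrightarrow> inner (x - orth_proj L x) z = 0"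
  using orth_proj_diff[of x] by (simp add: orthogonal_comp_def orthogonal_def inner_commute)

lemma orth_proj_ident: "x \<in> L \<Longrightarrow> orth_proj L x = x"
  using sub by (intro orth_proj_unique) (auto simp: subspace_0[OF subspace_orthogonal_comp])

lemma orth_proj_symmetric: "inner (orth_proj L x) y = inner x (orth_proj L y)"
  using inner_orth_proj_diff[OF orth_proj_in, of x y] inner_orth_proj_diff[OF orth_proj_in, of y x]
  by (simp add: inner_diff_left inner_commute[of y] inner_commute[of "orth_proj L y"])

lemma norm_orth_proj_le: "norm (orth_proj L x) \<le> norm x"
proof -
  have "(norm (orth_proj L x))\<^sup>2 = inner x (orth_proj L x)"
    using orth_proj_symmetric[of x "orth_proj L x"] orth_proj_ident[OF orth_proj_in]
    by (simp add: power2_norm_eq_inner)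
  also have "\<dots> \<le> norm x * norm (orth_proj L x)" by (rule norm_cauchy_schwarz)
  finally show ?thesis
    by (metis mult_right_le_imp_le norm_ge_zero norm_not_less_zero linorder_not_less power2_eq_square
        order_le_less)
qed

lemma bounded_linear_orth_proj: "bounded_linear (orth_proj L)"
proof (rule bounded_linear_intro[where K=1])
  note sc = subspace_orthogonal_comp[of L]
  show "orth_proj L (x + y) = orth_proj L x + orth_proj L y" for x y
    using subspace_add[OF sc orth_proj_diff[of x] orth_proj_diff[of y]]
    by (intro orth_proj_unique sub subspace_add[OF sub] orth_proj_in) (simp add: algebra_simps)
  show "orth_proj L (r *\<^sub>R x) = r *\<^sub>R orth_proj L x" for r x
    using subspace_scale[OF sc orth_proj_diff[of x], of r]
    by (intro orth_proj_unique sub subspace_scale[OF sub] orth_proj_in) (simp add: algebra_simps)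
  show "norm (orth_proj L x) \<le> norm x * 1" for x
    using norm_orth_proj_le by simp
qed

lemma orth_comp_eq_0_imp_UNIV: "(\<And>x. (\<And>y. y \<in> L \<Longrightarrow> inner x y = 0) \<Longrightarrow> x = 0) \<Longrightarrow> L = UNIV"
  using orth_proj_in inner_orth_proj_diff by (metis UNIV_eq_I eq_iff_diff_eq_0)

end

text \<open>Uniform boundedness principle, with the vectors \<open>z i\<close> acting as
  functionals. The closed sets \<open>T m\<close> cover the space, so by Baire one of them contains
  a ball; on it all the functionals are bounded by m.\<close>

lemma weakly_bounded_imp_bounded:
  fixes z :: "'i \<Rightarrow> 'a::{real_inner,complete_space}"
  assumes "\<And>y. \<exists>M. \<forall>i. \<bar>inner (z i) y\<bar> \<le> M"
  shows "\<exists>K. \<forall>i. norm (z i) \<le> K"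
proof -
  define T where "T = (\<lambda>m::nat. {y. \<forall>i. \<bar>inner (z i) y\<bar> \<le> real m})"
  have clT: "closed (T m)" for m
  proof -
    have "T m = (\<Inter>i. {y. \<bar>inner (z i) y\<bar> \<le> real m})" unfolding T_def by auto
    moreover have "closed {y. \<bar>inner (z i) y\<bar> \<le> real m}" for i
      by (intro closed_Collect_le continuous_intros)
    ultimately show ?thesis by auto
  qed
  have cover: "(\<Union>m. T m) = UNIV"
  proof -
    have "\<exists>m. y \<in> T m" for y
      using assms[of y] real_arch_simple unfolding T_def mem_Collect_eq by (meson order_trans)
    then show ?thesis by blast
  qed
  have "\<exists>m. interior (T m) \<noteq> {}"
  proof (rule ccontr)
    assume neg: "\<nexists>m. interior (T m) \<noteq> {}"
    have "Met_TC.mtopology interior_of \<Union>(range T) = {}"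
    proof (rule Met_TC.metric_Baire_category_alt)
      show "Met_TC.mcomplete TYPE('a)"
        by (metis complete_UNIV mcomplete_iff_complete)
    qed (use clT neg in \<open>auto simp: euclidean_interior_of\<close>)
    then show False using cover by (simp add: euclidean_interior_of)
  qed
  then obtain m x where "x \<in> interior (T m)" by blast
  then obtain e where e: "e > 0" "cball x e \<subseteq> T m"
    by (meson interior_subset mem_interior_cball subset_trans)
  have "norm (z i) \<le> 2 * real m / e" for i
  proof (cases "z i = 0")
    case False
    \<comment> \<open>\<open>z i\<close> rescaled to length e, so that x + y stays in the ball while
      the functional attains e times its norm at y.\<close>
    define y where "y = (e / norm (z i)) *\<^sub>R z i"
    have "norm y = e" using e False unfolding y_def by simp
    then have "x + y \<in> T m" "x \<in> T m" using e by (auto simp: dist_norm)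
    then have "\<bar>inner (z i) (x + y)\<bar> \<le> m" "\<bar>inner (z i) x\<bar> \<le> m" unfolding T_def by auto
    then have "\<bar>inner (z i) y\<bar> \<le> 2 * m" by (simp add: inner_add_right)
    moreover have "inner (z i) y = e * norm (z i)"
      unfolding y_def using False by (simp add: dot_square_norm power2_eq_square)
    ultimately show ?thesis using e by (simp add: field_simps)
  qed (use e in simp)
  then show ?thesis by blast
qed

text \<open>Polarisation: 4 <f x, y> = q (x + y) - q (x - y) for the quadratic form q of f, and the
  parallelogram law evaluates the resulting bound to 4 a at unit vectors. Linearity is asked for on
  \<open>V\<close> alone, so that f may be an unbounded operator restricted to a part of its
  domain.\<close>

lemma symmetric_form_bound:
  fixes f :: "'a::real_inner \<Rightarrow> 'a"
  assumes V: "subspace V" and uV: "u \<in> V" and vV: "v \<in> V"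
    and add: "\<And>x y. x \<in> V \<Longrightarrow> y \<in> V \<Longrightarrow> f (x + y) = f x + f y"
    and scale: "\<And>r x. x \<in> V \<Longrightarrow> f (r *\<^sub>R x) = r *\<^sub>R f x"
    and sym: "\<And>x y. x \<in> V \<Longrightarrow> y \<in> V \<Longrightarrow> inner (f x) y = inner x (f y)"
    and bound: "\<And>x. x \<in> V \<Longrightarrow> \<bar>inner (f x) x\<bar> \<le> a * (norm x)\<^sup>2"
  shows "\<bar>inner (f u) v\<bar> \<le> a * norm u * norm v"
proof -
  have unit: "inner (f x) y \<le> a" if x: "x \<in> V" "norm x = 1" and y: "y \<in> V" "norm y = 1" for x y
  proof -
    have m: "x + y \<in> V" "x - y \<in> V" using x y V by (auto simp: subspace_add subspace_diff)
    have my: "(-1) *\<^sub>R y \<in> V" by (rule subspace_scale[OF V y(1)])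
    have fm: "f (x - y) = f x - f y" using add[OF x(1) my] scale[OF y(1), of "-1"] by simp
    have "inner (f y) x = inner (f x) y" using sym[OF x(1) y(1)] by (simp add: inner_commute)
    then have "4 * inner (f x) y = inner (f (x + y)) (x + y) - inner (f (x - y)) (x - y)"
      unfolding add[OF x(1) y(1)] fm by (simp add: inner_simps)
    also have "\<dots> \<le> a * (norm (x + y))\<^sup>2 + a * (norm (x - y))\<^sup>2"
      using bound[OF m(1)] bound[OF m(2)] by linarith
    also have "\<dots> = a * (2 * (norm x)\<^sup>2 + 2 * (norm y)\<^sup>2)"
      by (simp add: power2_norm_eq_inner algebra_simps inner_commute)
    finally show ?thesis using x y by simp
  qed
  have gen: "inner (f x) y \<le> a * norm x * norm y" if x: "x \<in> V" and y: "y \<in> V" for x y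
  proof (cases "x = 0 \<or> y = 0")
    case True
    have "f 0 = 0" using scale[of 0 0] V by (simp add: subspace_0)
    with True show ?thesis by auto
  next
    case False
    then have "inner (f (x /\<^sub>R norm x)) (y /\<^sub>R norm y) \<le> a"
      by (intro unit) (auto simp: x y V subspace_scale)
    then show ?thesis using False scale[OF x] by (simp add: field_simps)
  qed
  have "(-1) *\<^sub>R v \<in> V" by (rule subspace_scale[OF V vV])
  from gen[OF uV vV] gen[OF uV this] show ?thesis by (simp add: abs_le_iff)
qed

definition symmetric_op :: "('a::real_inner \<Rightarrow> 'a) \<Rightarrow> bool"
  where "symmetric_op C \<longleftrightarrow> bounded_linear C \<and> (\<forall>x y. inner (C x) y = inner x (C y))"

definition positive_op :: "('a::real_inner \<Rightarrow> 'a) \<Rightarrow> bool"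
  where "positive_op C \<longleftrightarrow> symmetric_op C \<and> (\<forall>x. 0 \<le> inner (C x) x)"

lemma symmetric_opD:
  assumes "symmetric_op C"
  shows "bounded_linear C" "inner (C x) y = inner x (C y)"
    "C (x + y) = C x + C y" "C (x - y) = C x - C y" "C (r *\<^sub>R x) = r *\<^sub>R C x" "C 0 = 0" "C (- x) = - C x"
  using assms unfolding symmetric_op_def
  by (auto simp: linear_simps)

lemma symmetric_op_norm_le:
  assumes C: "symmetric_op C" and bound: "\<And>x. \<bar>inner (C x) x\<bar> \<le> a * (norm x)\<^sup>2"
  shows "norm (C x) \<le> a * norm x"
proof (cases "C x = 0")
  case False
  have "\<bar>inner (C x) (C x)\<bar> \<le> a * norm x * norm (C x)"
    by (rule symmetric_form_bound[of UNIV])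
      (simp_all add: symmetric_opD(3,5)[OF C] bound, rule symmetric_opD(2)[OF C])
  then show ?thesis using False by (simp add: dot_square_norm power2_eq_square)
next
  case True
  have "0 \<le> a * (norm x)\<^sup>2" using bound[of x] by (meson abs_ge_zero order_trans)
  then show ?thesis using True by (cases "x = 0") (auto simp: zero_le_mult_iff)
qed

section \<open>Bounded symmetric operators and their positive parts\<close>

lemma symmetric_op_inner_square:
  assumes "symmetric_op C" shows "inner (C (C x)) x = inner (C x) (C x)"
  by (rule symmetric_opD(2)[OF assms])

lemma symmetric_op_add:
  assumes "symmetric_op A" "symmetric_op B" shows "symmetric_op (\<lambda>x. A x + B x)"
  using assms unfolding symmetric_op_def by (auto intro: bounded_linear_add simp: inner_simps)

lemma symmetric_op_diff:
  assumes "symmetric_op A" "symmetric_op B" shows "symmetric_op (\<lambda>x. A x - B x)"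
  using assms unfolding symmetric_op_def by (auto intro: bounded_linear_sub simp: inner_simps)

lemma symmetric_op_scale:
  assumes "symmetric_op A" shows "symmetric_op (\<lambda>x. r *\<^sub>R A x)"
  using assms unfolding symmetric_op_def
  by (auto intro: bounded_linear_compose[OF bounded_linear_scaleR_right])

lemma symmetric_op_ident: "symmetric_op (\<lambda>x. x)"
  unfolding symmetric_op_def by auto

lemma symmetric_op_compose:
  assumes "symmetric_op A" "symmetric_op B" "\<And>x. A (B x) = B (A x)"
  shows "symmetric_op (\<lambda>x. A (B x))"
  unfolding symmetric_op_def
proof (intro conjI allI)
  show "bounded_linear (\<lambda>x. A (B x))"
    using assms(1,2) by (auto intro: bounded_linear_compose simp: symmetric_op_def)
  show "inner (A (B x)) y = inner x (A (B y))" for x y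
    by (metis assms symmetric_opD(2))
qed

section \<open>Products of commuting positive operators\<close>

context
  fixes A B :: "'a::real_inner \<Rightarrow> 'a"
  assumes A: "positive_op A" and A1: "\<And>x. inner (A x) x \<le> (norm x)\<^sup>2"
    and B: "positive_op B" and AB: "\<And>x. A (B x) = B (A x)"
begin

text \<open>
  \<open>A\<close> is the strong sum of the squares of these iterates, which reduces the positivity of \<open>B A\<close>
  to that of the terms \<open>\<langle>B A\<^sub>k x, A\<^sub>k x\<rangle>\<close>.
\<close>

primrec square_iter :: "nat \<Rightarrow> 'a \<Rightarrow> 'a" where
  "square_iter 0 = A"
| "square_iter (Suc n) = (\<lambda>x. square_iter n x - square_iter n (square_iter n x))"

text \<open>The invariant 0 \<le> A \<le> 1 passes to A - A^2 because A - A^2 = A (1 - A)^2 + (1 -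
  A) A^2 is a sum of two positive operators, and A - A^2 \<le> A.\<close>

lemma square_iter:
  "symmetric_op (square_iter n)" "square_iter n (B x) = B (square_iter n x)"
  "0 \<le> inner (square_iter n x) x" "inner (square_iter n x) x \<le> (norm x)\<^sup>2"
proof (induction n arbitrary: x)
  case 0
  {
    case 1 show ?case using A by (simp add: positive_op_def)
  next
    case 2 show ?case by (simp add: AB)
  next
    case 3 show ?case using A by (simp add: positive_op_def)
  next
    case 4 show ?case by (simp add: A1)
  }
next
  case (Suc n)
  note D = symmetric_opD[OF Suc.IH(1)]
  have e: "inner (square_iter n (square_iter n x)) x = inner (square_iter n x) (square_iter n x)" for x
    by (rule D(2))
  {
    case 1 show ?case
      using symmetric_op_diff[OF Suc.IH(1) symmetric_op_compose[OF Suc.IH(1) Suc.IH(1)]] by simp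
  next
    case 2 show ?case
      using Suc.IH(2) B by (simp add: positive_op_def symmetric_opD)
  next
    case (3 x)
    define b c where "b = square_iter n x" and "c = square_iter n b"
    have "0 \<le> (norm b)\<^sup>2 - inner c b" using Suc.IH(4)[of b] by (simp add: c_def)
    moreover have "0 \<le> inner (square_iter n (x - b)) (x - b)" by (rule Suc.IH(3))
    moreover have "inner c x = inner b b" using e[of x] by (simp add: b_def c_def)
    moreover have "inner (square_iter n (x - b)) (x - b) = inner b x - inner b b - inner c x + inner c b"
      by (simp add: D(4) b_def[symmetric] c_def[symmetric] inner_simps)
    ultimately show ?case
      by (simp add: b_def[symmetric] c_def[symmetric] inner_simps power2_norm_eq_inner)
  next
    case (4 x)
    show ?case using Suc.IH(4)[of x] e[of x]
      by (simp add: inner_simps) (metis inner_ge_zero order_trans diff_left_mono diff_zero)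
  }
qed

lemma square_iter_sum: "A x = (\<Sum>k<n. square_iter k (square_iter k x)) + square_iter n x"
  by (induction n) auto

text \<open>The telescoped identity bounds the sum of |A_k x|^2 by <A x, x> \<le> |x|^2, so the
  terms tend to 0. This is what makes A the strong sum of the squares.\<close>

lemma square_iter_tendsto_0: "(\<lambda>n. square_iter n x) \<longlonglongrightarrow> 0"
proof -
  have "(\<Sum>k<n. (norm (square_iter k x))\<^sup>2) \<le> (norm x)\<^sup>2" for n
  proof -
    have "inner (A x) x = (\<Sum>k<n. (norm (square_iter k x))\<^sup>2) + inner (square_iter n x) x"
      by (subst square_iter_sum[of x n])
        (simp add: inner_add_left inner_sum_left power2_norm_eq_inner symmetric_opD(2)[OF square_iter(1)])
    then show ?thesis using A1[of x] square_iter(3)[of n x] by linarith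
  qed
  then have "summable (\<lambda>k. (norm (square_iter k x))\<^sup>2)"
    by (intro summableI_nonneg_bounded) auto
  then have "(\<lambda>k. sqrt ((norm (square_iter k x))\<^sup>2)) \<longlonglongrightarrow> sqrt 0"
    by (intro tendsto_real_sqrt summable_LIMSEQ_zero)
  then show ?thesis by (simp add: tendsto_norm_zero_iff)
qed

lemma contraction_mult_nonneg: "0 \<le> inner (B (A x)) x"
proof -
  have B': "symmetric_op B" using B by (simp add: positive_op_def)
  have "inner (B (square_iter n x)) x \<le> inner (B (A x)) x" for n
  proof -
    have "inner (B (A x)) x = (\<Sum>k<n. inner (B (square_iter k x)) (square_iter k x)) + inner (B (square_iter n x)) x"
      by (subst square_iter_sum[of x n])
        (simp add: symmetric_opD[OF B'] linear_sum[OF bounded_linear.linear[OF symmetric_opD(1)[OF B']]]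
          inner_add_left inner_sum_left square_iter(2)[symmetric] symmetric_opD(2)[OF square_iter(1)])
    moreover have "0 \<le> (\<Sum>k<n. inner (B (square_iter k x)) (square_iter k x))"
      using B by (intro sum_nonneg) (simp add: positive_op_def)
    ultimately show ?thesis by linarith
  qed
  moreover have "(\<lambda>n. inner (B (square_iter n x)) x) \<longlonglongrightarrow> inner (B 0) x"
    by (intro tendsto_intros bounded_linear.tendsto[OF symmetric_opD(1)[OF B']] square_iter_tendsto_0)
  ultimately have "inner (B 0) x \<le> inner (B (A x)) x"
    by (intro LIMSEQ_le_const2) auto
  then show ?thesis by (simp add: symmetric_opD[OF B'])
qed

end

text \<open>Reduces to the contraction case by rescaling \<open>A\<close>. This drives the
  monotonicity of the sign iteration, all of whose increments are products of commuting positive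
  operators.\<close>

lemma positive_op_mult:
  assumes A: "positive_op A" and B: "positive_op B" and AB: "\<And>x. A (B x) = B (A x)"
  shows "positive_op (\<lambda>x. A (B x))"
proof -
  note A' = A[unfolded positive_op_def] and B' = B[unfolded positive_op_def]
  obtain K where K: "K > 0" "\<And>x. norm (A x) \<le> norm x * K"
    using bounded_linear.pos_bounded[of A] A' unfolding symmetric_op_def by blast
  define A1 where "A1 = (\<lambda>x. inverse K *\<^sub>R A x)"
  have pos: "positive_op A1"
    using A' K unfolding A1_def positive_op_def by (auto intro: symmetric_op_scale)
  have le: "inner (A1 x) x \<le> (norm x)\<^sup>2" for x
  proof -
    have "inner (A x) x \<le> norm (A x) * norm x" by (rule norm_cauchy_schwarz)
    also have "\<dots> \<le> (norm x * K) * norm x" by (intro mult_right_mono K) auto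
    finally show ?thesis unfolding A1_def using K(1) by (simp add: field_simps power2_eq_square)
  qed
  have c: "A1 (B x) = B (A1 x)" for x
    unfolding A1_def using B' by (simp add: AB symmetric_opD)
  have "0 \<le> inner (A (B x)) x" for x
    using contraction_mult_nonneg[OF pos le B c, of x] K(1) B' AB[of x]
    unfolding A1_def by (simp add: symmetric_opD zero_le_mult_iff)
  then show ?thesis
    using symmetric_op_compose[OF conjunct1[OF A'] conjunct1[OF B'] AB] unfolding positive_op_def by blast
qed

text \<open>This is B^2 \<le> M B. Positivity of B tested at M x - B x gives 2 M |B x|^2 \<le> M^2
  <B x, x> + <B (B x), B x>, and the last term is at most M |B x|^2.\<close>

lemma positive_op_norm_le:
  assumes B: "positive_op B" and M: "M > 0" "\<And>x. inner (B x) x \<le> M * (norm x)\<^sup>2"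
  shows "(norm (B x))\<^sup>2 \<le> M * inner (B x) x"
proof -
  have B': "symmetric_op B" and pos: "0 \<le> inner (B z) z" for z
    using B by (auto simp: positive_op_def)
  note D = symmetric_opD[OF B']
  define y where "y = B x"
  have "inner (B y) x = inner y y" using D(2)[of y x] by (simp add: y_def)
  then have "inner (B (M *\<^sub>R x - y)) (M *\<^sub>R x - y) = M * M * inner y x - 2 * M * inner y y + inner (B y) y"
    by (simp add: D(4,5) y_def[symmetric] inner_simps algebra_simps)
  then have "2 * M * inner y y \<le> M * M * inner y x + M * inner y y"
    using pos[of "M *\<^sub>R x - y"] M(2)[of y] by (simp add: power2_norm_eq_inner)
  then have "M * inner y y \<le> M * (M * inner y x)" by (simp add: algebra_simps)
  then show ?thesis using M(1) by (simp add: y_def power2_norm_eq_inner)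
qed

lemma positive_op_eq_0:
  assumes B: "positive_op B" and "inner (B x) x = 0"
  shows "B x = 0"
proof -
  obtain K where K: "K > 0" "\<And>x. norm (B x) \<le> norm x * K"
    using bounded_linear.pos_bounded[of B] B unfolding positive_op_def symmetric_op_def by blast
  have "inner (B z) z \<le> K * (norm z)\<^sup>2" for z
    using norm_cauchy_schwarz[of "B z" z] mult_right_mono[OF K(2)[of z] norm_ge_zero[of z]]
    by (simp add: power2_eq_square algebra_simps)
  from positive_op_norm_le[OF B K(1) this, of x] assms(2) show ?thesis by simp
qed

text \<open>Increments are controlled by differences of squared norms, so convergence of a real
  sequence is inherited. It serves the sign iterates, monotone families of projections, and the
  images under T of spectral truncations.\<close>

lemma norm_increment_convergent:
  fixes x :: "nat \<Rightarrow> 'a::{real_inner,complete_space}"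
  assumes le: "\<And>m n. m \<le> n \<Longrightarrow> (norm (x m - x n))\<^sup>2 \<le> \<bar>(norm (x m))\<^sup>2 - (norm (x n))\<^sup>2\<bar>"
    and conv: "convergent (\<lambda>n. (norm (x n))\<^sup>2)"
  shows "convergent x"
proof -
  have "Cauchy x"
  proof (rule CauchyI')
    fix e :: real assume e: "e > 0"
    obtain M where M: "\<And>m n. m \<ge> M \<Longrightarrow> n \<ge> M \<Longrightarrow> norm ((norm (x m))\<^sup>2 - (norm (x n))\<^sup>2) < e\<^sup>2"
      using CauchyD[OF convergent_Cauchy[OF conv], of "e\<^sup>2"] e by auto
    have "dist (x m) (x n) < e" if mn: "m \<ge> M" "m < n" for m n
    proof -
      have "(norm (x m - x n))\<^sup>2 < e\<^sup>2" using M[of m n] mn le[of m n] by simp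
      then show ?thesis using e by (simp add: dist_norm power_less_imp_less_base)
    qed
    then show "\<exists>M. \<forall>m\<ge>M. \<forall>n>m. dist (x m) (x n) < e" by blast
  qed
  then show ?thesis by (simp add: Cauchy_convergent_iff)
qed

text \<open>Newton's iteration \<open>s \<mapsto> s (3 - s\<^sup>2) / 2\<close> for the sign of \<open>C\<close>.\<close>

primrec sgn_iter :: "('a::real_inner \<Rightarrow> 'a) \<Rightarrow> nat \<Rightarrow> 'a \<Rightarrow> 'a" where
  "sgn_iter C 0 = C"
| "sgn_iter C (Suc k) =
    (\<lambda>x. (3/2) *\<^sub>R sgn_iter C k x - (1/2) *\<^sub>R sgn_iter C k (sgn_iter C k (sgn_iter C k x)))"

lemma sgn_iter_commute:
  assumes "bounded_linear U" "\<And>x. U (C x) = C (U x)"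
  shows "U (sgn_iter C k x) = sgn_iter C k (U x)"
  by (induction k arbitrary: x) (auto simp: assms linear_simps[OF assms(1)])

section \<open>Convergence of the sign iteration for a symmetric contraction\<close>

context
  fixes C :: "'a::{real_inner,complete_space} \<Rightarrow> 'a"
  assumes C: "symmetric_op C" and C1: "\<And>x. norm (C x) \<le> norm x"
begin

lemma sgn_iter:
  "symmetric_op (sgn_iter C k)" "norm (sgn_iter C k x) \<le> norm x"
proof (induction k arbitrary: x)
  case 0
  {
    case 1 show ?case using C by simp
  next
    case 2 show ?case using C1 by simp
  }
next
  case (Suc k)
  note D = symmetric_opD[OF Suc.IH(1)]
  {
    case 1 show ?case
      using symmetric_op_diff[OF symmetric_op_scale[OF Suc.IH(1)]
          symmetric_op_scale[OF symmetric_op_compose[OF Suc.IH(1) symmetric_op_compose[OF Suc.IH(1) Suc.IH(1)]]]]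
      by simp
  next
    case (2 x)
    define b c d where "b = sgn_iter C k x" and "c = sgn_iter C k b" and "d = sgn_iter C k c"
    have ac: "inner x c = inner b b" "inner c x = inner b b"
      using D(2)[of x b, folded b_def c_def] by (simp_all add: inner_commute)
    have bd: "inner b d = inner c c" "inner d b = inner c c"
      using D(2)[of b c, folded c_def d_def] by (simp_all add: inner_commute)
    have "norm (sgn_iter C k (x - c)) \<le> norm (x - c)" by (rule Suc.IH(2))
    moreover have "sgn_iter C k (x - c) = b - d" by (simp add: D(4) b_def d_def)
    ultimately have le: "inner (b - d) (b - d) \<le> inner (x - c) (x - c)"
      by (simp add: norm_le)
    \<comment> \<open>With s = S^2 for the current iterate S, the two sides differ by the form of (1
      - s)^2 (4 - s) / 4 = 3/4 (1 - s)^2 + 1/4 (1 - s)^3. The first summand contributes |x - c|^2,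
      the second is the inequality \<open>le\<close>.\<close>
    have "inner ((3/2) *\<^sub>R b - (1/2) *\<^sub>R d) ((3/2) *\<^sub>R b - (1/2) *\<^sub>R d) \<le> inner x x"
      using le inner_ge_zero[of "x - c"] by (simp add: inner_simps ac bd field_simps)
    then show ?case by (simp add: norm_le b_def c_def d_def)
  }
qed

lemma sgn_iter_comm: "sgn_iter C k (sgn_iter C l x) = sgn_iter C l (sgn_iter C k x)"
proof -
  have "C (sgn_iter C k x) = sgn_iter C k (C x)" for x
    by (rule sgn_iter_commute) (auto simp: symmetric_opD(1)[OF C])
  then show ?thesis
    by (intro sgn_iter_commute) (simp_all add: symmetric_opD(1)[OF sgn_iter(1)])
qed

text \<open>Holds because the iterates S are contractions, so S^2 \<le> 1. Two instances matter: (3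
  - S^2) / 2 leads from S to the next iterate, and (1 - S^2) / 2 leads from S to the
  increment.\<close>

lemma sgn_iter_affine_positive:
  assumes "0 \<le> s" "s \<le> r"
  shows "positive_op (\<lambda>x. r *\<^sub>R x - s *\<^sub>R sgn_iter C l (sgn_iter C l x))"
  unfolding positive_op_def
proof (intro conjI allI)
  show "symmetric_op (\<lambda>x. r *\<^sub>R x - s *\<^sub>R sgn_iter C l (sgn_iter C l x))"
    by (rule symmetric_op_diff[OF symmetric_op_scale[OF symmetric_op_ident]
          symmetric_op_scale[OF symmetric_op_compose[OF sgn_iter(1) sgn_iter(1) refl]]])
  fix x
  have "inner (sgn_iter C l x) (sgn_iter C l x) \<le> inner x x"
    using sgn_iter(2)[of l x] by (simp add: norm_le)
  then have "s * inner (sgn_iter C l x) (sgn_iter C l x) \<le> r * inner x x"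
    using assms by (intro mult_mono) auto
  then show "0 \<le> inner (r *\<^sub>R x - s *\<^sub>R sgn_iter C l (sgn_iter C l x)) x"
    by (simp add: inner_simps symmetric_op_inner_square[OF sgn_iter(1)])
qed

text \<open>All iterates have the same sign: each new one arises by multiplication with the positive
  operator (3 - S^2) / 2.\<close>

lemma sgn_iter_mult_positive: "positive_op (\<lambda>x. sgn_iter C k (sgn_iter C (k + m) x))"
proof (induction m)
  case 0
  have "symmetric_op (\<lambda>x. sgn_iter C k (sgn_iter C k x))"
    by (rule symmetric_op_compose[OF sgn_iter(1) sgn_iter(1) refl])
  then show ?case
    unfolding positive_op_def by (simp add: symmetric_op_inner_square[OF sgn_iter(1)])
next
  case (Suc m)
  note D = symmetric_opD[OF sgn_iter(1)]
  have "positive_op (\<lambda>x. (\<lambda>x. sgn_iter C k (sgn_iter C (k + m) x))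
      ((3/2) *\<^sub>R x - (1/2) *\<^sub>R sgn_iter C (k + m) (sgn_iter C (k + m) x)))"
    by (rule positive_op_mult[OF Suc.IH sgn_iter_affine_positive])
      (simp_all add: D(4,5) sgn_iter_comm[of k])
  then show ?case by (simp add: D(4,5))
qed

text \<open>The increment from S to the next iterate is S (1 - S^2) / 2, so its product with an
  earlier iterate is a product of commuting positive operators.\<close>

lemma sgn_iter_inner_mono: "(norm (sgn_iter C k x))\<^sup>2 \<le> inner (sgn_iter C k x) (sgn_iter C (k + m) x)"
proof (induction m)
  case 0 then show ?case by (simp add: power2_norm_eq_inner)
next
  case (Suc m)
  note D = symmetric_opD[OF sgn_iter(1)]
  let ?S = "sgn_iter C (k + m)"
  have "positive_op (\<lambda>x. (\<lambda>x. sgn_iter C k (?S x)) ((1/2) *\<^sub>R x - (1/2) *\<^sub>R ?S (?S x)))"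
    by (rule positive_op_mult[OF sgn_iter_mult_positive sgn_iter_affine_positive])
      (simp_all add: D(4,5) sgn_iter_comm[of k])
  then have "0 \<le> inner (sgn_iter C k (?S ((1/2) *\<^sub>R x - (1/2) *\<^sub>R ?S (?S x)))) x"
    unfolding positive_op_def by blast
  also have "\<dots> = inner (?S ((1/2) *\<^sub>R x - (1/2) *\<^sub>R ?S (?S x))) (sgn_iter C k x)"
    by (rule D(2))
  also have "?S ((1/2) *\<^sub>R x - (1/2) *\<^sub>R ?S (?S x)) = sgn_iter C (k + Suc m) x - ?S x"
    using scaleR_add_left[of 1 "1/2" "?S x"] by (simp add: D(4,5) algebra_simps)
  finally show ?case using Suc.IH by (simp add: inner_simps inner_commute)
qed

lemma sgn_iter_norm_mono: "norm (sgn_iter C k x) \<le> norm (sgn_iter C (k + m) x)"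
proof (cases "sgn_iter C k x = 0")
  case False
  have "(norm (sgn_iter C k x))\<^sup>2 \<le> norm (sgn_iter C k x) * norm (sgn_iter C (k + m) x)"
    using sgn_iter_inner_mono norm_cauchy_schwarz order_trans by blast
  with False show ?thesis by (simp add: power2_eq_square)
qed simp

lemma sgn_iter_convergent: "convergent (\<lambda>k. sgn_iter C k x)"
proof (rule norm_increment_convergent)
  have incr: "mono (\<lambda>k. (norm (sgn_iter C k x))\<^sup>2)"
    by (rule monoI) (metis le_Suc_ex norm_ge_zero power_mono sgn_iter_norm_mono)
  have "(norm (sgn_iter C k x))\<^sup>2 \<le> (norm x)\<^sup>2" for k
    by (simp add: sgn_iter(2) power_mono)
  then show "convergent (\<lambda>k. (norm (sgn_iter C k x))\<^sup>2)"
    using incseq_convergent[OF incr] convergentI by metis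
  fix m n :: nat assume "m \<le> n"
  then obtain j where n: "n = m + j" using le_Suc_ex by blast
  have "(norm (sgn_iter C m x - sgn_iter C n x))\<^sup>2 =
      (norm (sgn_iter C m x))\<^sup>2 + (norm (sgn_iter C n x))\<^sup>2 - 2 * inner (sgn_iter C m x) (sgn_iter C n x)"
    by (simp add: power2_norm_eq_inner inner_simps inner_commute)
  then show "(norm (sgn_iter C m x - sgn_iter C n x))\<^sup>2 \<le> \<bar>(norm (sgn_iter C m x))\<^sup>2 - (norm (sgn_iter C n x))\<^sup>2\<bar>"
    using sgn_iter_inner_mono[of m x j] unfolding n by linarith
qed

definition sgn_op :: "'a \<Rightarrow> 'a" where "sgn_op x = lim (\<lambda>k. sgn_iter C k x)"

lemma sgn_op: "(\<lambda>k. sgn_iter C k x) \<longlonglongrightarrow> sgn_op x"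
  unfolding sgn_op_def using sgn_iter_convergent convergent_LIMSEQ_iff by blast

lemma norm_sgn_op_le: "norm (sgn_op x) \<le> norm x"
  by (rule LIMSEQ_le_const2[OF tendsto_norm[OF sgn_op]]) (auto simp: sgn_iter(2))

lemma symmetric_sgn_op: "symmetric_op sgn_op"
  unfolding symmetric_op_def
proof (intro conjI allI)
  note D = symmetric_opD[OF sgn_iter(1)]
  show "bounded_linear sgn_op"
  proof (rule bounded_linear_intro[where K=1])
    show "sgn_op (x + y) = sgn_op x + sgn_op y" for x y
      using tendsto_add[OF sgn_op[of x] sgn_op[of y]] sgn_op[of "x + y"]
      by (auto simp: D(3) intro: LIMSEQ_unique)
    show "sgn_op (r *\<^sub>R x) = r *\<^sub>R sgn_op x" for r x
      using tendsto_scaleR[OF tendsto_const sgn_op[of x], of r] sgn_op[of "r *\<^sub>R x"]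
      by (auto simp: D(5) intro: LIMSEQ_unique)
  qed (simp add: norm_sgn_op_le)
  show "inner (sgn_op x) y = inner x (sgn_op y)" for x y
    using tendsto_inner[OF sgn_op[of x] tendsto_const[of y]] tendsto_inner[OF tendsto_const[of x] sgn_op[of y]]
    by (auto simp: D(2) intro: LIMSEQ_unique)
qed

lemma sgn_op_commute:
  assumes U: "bounded_linear U" "\<And>x. U (C x) = C (U x)"
  shows "U (sgn_op x) = sgn_op (U x)"
  using bounded_linear.tendsto[OF U(1) sgn_op[of x]] sgn_op[of "U x"]
  by (auto simp: sgn_iter_commute[of U C, OF U] intro: LIMSEQ_unique)

text \<open>Uniform contractivity extends the strong convergence to moving arguments, which is what
  passing to the limit in the cubic term requires.\<close>

lemma sgn_iter_tendsto:
  assumes "y \<longlonglongrightarrow> z" shows "(\<lambda>k. sgn_iter C k (y k)) \<longlonglongrightarrow> sgn_op z"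
proof -
  have "(\<lambda>k. sgn_iter C k (y k - z)) \<longlonglongrightarrow> 0"
  proof (rule Lim_null_comparison)
    show "(\<lambda>k. norm (y k - z)) \<longlonglongrightarrow> 0"
      using assms LIM_zero tendsto_norm_zero by blast
  qed (simp add: sgn_iter(2))
  from tendsto_add[OF this sgn_op[of z]] show ?thesis
    by (simp add: symmetric_opD(4)[OF sgn_iter(1)])
qed

text \<open>The limit W is a fixed point of the iteration, W = (3 W - W^3) / 2. It follows that (W^2
  + W) / 2 is a projection.\<close>

lemma sgn_op_cube: "sgn_op (sgn_op (sgn_op x)) = sgn_op x"
proof -
  have "(\<lambda>k. sgn_iter C (Suc k) x) \<longlonglongrightarrow> (3/2) *\<^sub>R sgn_op x - (1/2) *\<^sub>R sgn_op (sgn_op (sgn_op x))"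
    unfolding sgn_iter.simps by (intro tendsto_intros sgn_iter_tendsto sgn_op)
  with LIMSEQ_Suc[OF sgn_op[of x]]
  have "sgn_op x = (3/2) *\<^sub>R sgn_op x - (1/2) *\<^sub>R sgn_op (sgn_op (sgn_op x))"
    using LIMSEQ_unique by blast
  moreover have "(3/2) *\<^sub>R sgn_op x = sgn_op x + (1/2) *\<^sub>R sgn_op x"
    using scaleR_add_left[of 1 "1/2" "sgn_op x"] by simp
  ultimately have "(1/2) *\<^sub>R sgn_op x = (1/2) *\<^sub>R sgn_op (sgn_op (sgn_op x))"
    by simp
  then show ?thesis by (simp only: scaleR_cancel_left) simp
qed

lemma sgn_op_nonneg: "0 \<le> inner (C (sgn_op x)) x"
proof -
  have "0 \<le> inner (C (sgn_iter C k x)) x" for k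
    using sgn_iter_mult_positive[of 0 k] by (simp add: positive_op_def)
  moreover have "(\<lambda>k. inner (C (sgn_iter C k x)) x) \<longlonglongrightarrow> inner (C (sgn_op x)) x"
    by (intro tendsto_intros bounded_linear.tendsto[OF symmetric_opD(1)[OF C]] sgn_op)
  ultimately show ?thesis by (intro LIMSEQ_le_const) auto
qed

text \<open>Norms increase along the iteration, which starts at C, so |C x| is at most the norm of
  the limit. Conversely the iteration never leaves 0.\<close>

lemma sgn_op_eq_0: "sgn_op x = 0 \<longleftrightarrow> C x = 0"
proof
  assume "sgn_op x = 0"
  moreover have "norm (C x) \<le> norm (sgn_op x)"
    using sgn_iter_norm_mono[of 0 x]
    by (intro LIMSEQ_le_const[OF tendsto_norm[OF sgn_op[of x]]]) auto
  ultimately show "C x = 0" by simp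
next
  assume *: "C x = 0"
  have "sgn_iter C k x = 0" for k
    by (induction k) (auto simp: * symmetric_opD(6)[OF sgn_iter(1)])
  then show "sgn_op x = 0" using sgn_op[of x] by (simp add: LIMSEQ_const_iff)
qed

end

text \<open>E = (W^2 + W) / 2, with W the sign of C, is the spectral projection of C for the open
  half-line of positive numbers. The last clause, strict positivity on the range, excludes the
  kernel of C and will give right-continuity of the spectral family; the commutation clause will
  make projections for different parameters commute with each other and with i.\<close>

lemma positive_part_projection:
  fixes C :: "'a::{real_inner,complete_space} \<Rightarrow> 'a"
  assumes C: "symmetric_op C"
  shows "\<exists>E. symmetric_op E \<and> (\<forall>x. E (E x) = E x) \<and>
    (\<forall>U. bounded_linear U \<longrightarrow> (\<forall>x. U (C x) = C (U x)) \<longrightarrow> (\<forall>x. U (E x) = E (U x))) \<and>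
    (\<forall>x. E x = x \<longrightarrow> 0 \<le> inner (C x) x) \<and> (\<forall>x. E x = 0 \<longrightarrow> inner (C x) x \<le> 0) \<and>
    (\<forall>x. E x = x \<longrightarrow> inner (C x) x = 0 \<longrightarrow> x = 0)"
proof -
  obtain K where K: "K > 0" "\<And>x. norm (C x) \<le> norm x * K"
    using bounded_linear.pos_bounded[OF symmetric_opD(1)[OF C]] by blast
  define C1 where "C1 = (\<lambda>x. inverse K *\<^sub>R C x)"
  have C1: "symmetric_op C1" unfolding C1_def by (intro symmetric_op_scale C)
  have C1_le: "norm (C1 x) \<le> norm x" for x
    using K(2)[of x] K(1) unfolding C1_def by (simp add: field_simps)
  have C_C1: "inner (C x) x = K * inner (C1 x) x" for x
    using K(1) unfolding C1_def by simp
  define W where "W = sgn_op C1"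
  define E where "E = (\<lambda>x. (1/2) *\<^sub>R (W (W x) + W x))"
  note cube = sgn_op_cube[OF C1 C1_le, folded W_def]
  have W: "symmetric_op W" unfolding W_def by (rule symmetric_sgn_op[OF C1 C1_le])
  note WD = symmetric_opD[OF W] and CD = symmetric_opD[OF C1]
  have "symmetric_op E"
    unfolding E_def
    by (rule symmetric_op_scale[OF symmetric_op_add[OF symmetric_op_compose[OF W W refl] W]])
  moreover have "E (E x) = E x" for x
    unfolding E_def by (simp add: WD(3,5) cube algebra_simps flip: scaleR_add_left)
  moreover have "U (E x) = E (U x)" if U: "bounded_linear U" "\<And>x. U (C x) = C (U x)" for U x
  proof -
    have "U (C1 x) = C1 (U x)" for x unfolding C1_def by (simp add: linear_simps[OF U(1)] U(2))
    then have "U (W x) = W (U x)" for x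
      unfolding W_def by (intro sgn_op_commute[OF C1 C1_le U(1)])
    then show ?thesis unfolding E_def by (simp add: linear_simps[OF U(1)])
  qed
  moreover have WE: "W x = x" if "E x = x" for x
  proof -
    have "W (E x) = E x" unfolding E_def by (simp add: WD(3,5) cube add.commute)
    then show ?thesis using that by simp
  qed
  moreover have "0 \<le> inner (C x) x" if "E x = x" for x
    using sgn_op_nonneg[OF C1 C1_le, of x] WE[OF that] K(1) unfolding C_C1 W_def by simp
  moreover have "x = 0" if Ex: "E x = x" and "inner (C x) x = 0" for x
  proof -
    have "C1 (W z) = W (C1 z)" for z
      unfolding W_def by (rule sgn_op_commute[OF C1 C1_le symmetric_opD(1)[OF C1] refl])
    then have "positive_op (\<lambda>z. C1 (W z))"
      using symmetric_op_compose[OF C1 W] sgn_op_nonneg[OF C1 C1_le]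
      unfolding positive_op_def W_def by simp
    moreover have "inner (C1 (W x)) x = 0" using that K(1) WE[OF Ex] unfolding C_C1 by simp
    ultimately have "C1 (W x) = 0" by (rule positive_op_eq_0)
    then show ?thesis using WE[OF Ex] sgn_op_eq_0[OF C1 C1_le, of x] unfolding W_def by simp
  qed
  moreover have "inner (C x) x \<le> 0" if "E x = 0" for x
  proof -
    \<comment> \<open>E x = 0 says W^2 x = - W x, and W annihilates x - W^2 x. Since W and C have
      the same kernel, C x = C (W^2 x) = - C (W x), whose form is nonpositive.\<close>
    have WW: "W (W x) = - W x" using that unfolding E_def by (simp add: eq_neg_iff_add_eq_0)
    have "W (x - W (W x)) = 0" by (simp add: WD cube)
    then have "C1 (x - W (W x)) = 0" using sgn_op_eq_0[OF C1 C1_le] unfolding W_def by simp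
    then have "C1 x = - C1 (W x)" by (simp add: CD WW eq_neg_iff_add_eq_0)
    then show ?thesis
      using sgn_op_nonneg[OF C1 C1_le, of x] K(1) unfolding C_C1 W_def
      by (simp add: mult_le_0_iff)
  qed
  ultimately show ?thesis by blast
qed

section \<open>Spectral resolutions of selfadjoint operators\<close>

text \<open>The hypothesis is the identity <P_m x, P_n x> = |P_n x|^2 satisfied by decreasing
  orthogonal projections.\<close>

lemma decreasing_orthogonal_convergent:
  fixes x :: "nat \<Rightarrow> 'a::{real_inner,complete_space}"
  assumes dec: "\<And>m n. m \<le> n \<Longrightarrow> inner (x m) (x n) = (norm (x n))\<^sup>2"
  shows "convergent x"
proof (rule norm_increment_convergent)
  have diff: "(norm (x m - x n))\<^sup>2 = (norm (x m))\<^sup>2 - (norm (x n))\<^sup>2" if "m \<le> n" for m n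
    using dec[OF that] by (simp add: power2_norm_eq_inner inner_simps inner_commute)
  then show "(norm (x m - x n))\<^sup>2 \<le> \<bar>(norm (x m))\<^sup>2 - (norm (x n))\<^sup>2\<bar>" if "m \<le> n" for m n
    using that by simp
  have "decseq (\<lambda>n. (norm (x n))\<^sup>2)"
    by (rule decseq_SucI) (metis diff diff_ge_0_iff_ge le_Suc_eq order_refl zero_le_power2)
  then show "convergent (\<lambda>n. (norm (x n))\<^sup>2)"
    using decseq_convergent[of "\<lambda>n. (norm (x n))\<^sup>2" 0] by (metis convergentI zero_le_power2)
qed

lemma symmetric_idempotent_norm_le:
  assumes "symmetric_op P" "P (P x) = P x"
  shows "(norm (P x))\<^sup>2 = inner (P x) x" "norm (P x) \<le> norm x"
proof -
  show 1: "(norm (P x))\<^sup>2 = inner (P x) x"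
    using symmetric_opD(2)[OF assms(1), of "P x" x] assms(2) by (simp add: power2_norm_eq_inner)
  have "(norm (P x))\<^sup>2 \<le> norm (P x) * norm x" unfolding 1 by (rule norm_cauchy_schwarz)
  then show "norm (P x) \<le> norm x"
    by (cases "P x = 0") (auto simp: power2_eq_square)
qed

text \<open>
  The last axiom says that the adjoint does not extend \<open>T\<close>; applied to \<open>y = 0\<close> it also yields that
  \<open>D\<close> is dense.
\<close>

locale sa_operator =
  fixes D :: "'a::{real_inner,complete_space} set" and T :: "'a \<Rightarrow> 'a"
  assumes subD: "subspace D"
    and T_add: "x \<in> D \<Longrightarrow> y \<in> D \<Longrightarrow> T (x + y) = T x + T y"
    and T_scale: "x \<in> D \<Longrightarrow> T (r *\<^sub>R x) = r *\<^sub>R T x"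
    and T_sym: "x \<in> D \<Longrightarrow> y \<in> D \<Longrightarrow> inner (T x) y = inner x (T y)"
    and T_max: "(\<And>x. x \<in> D \<Longrightarrow> inner (T x) y = inner x z) \<Longrightarrow> y \<in> D \<and> T y = z"
begin

lemma T_0: "T 0 = 0" using T_scale[of 0 0] subD by (simp add: subspace_0)

lemma T_diff: "x \<in> D \<Longrightarrow> y \<in> D \<Longrightarrow> T (x - y) = T x - T y"
  using T_add[of x "(-1) *\<^sub>R y"] T_scale[of y "-1"] subspace_scale[OF subD, of y "-1"] by simp

lemma orthogonal_domain: "(\<And>x. x \<in> D \<Longrightarrow> inner x y = 0) \<Longrightarrow> y = 0"
  using T_max[of 0 y] T_0 by simp

lemma T_closed:
  assumes "\<And>n. x n \<in> D" "x \<longlonglongrightarrow> u" "(\<lambda>n. T (x n)) \<longlonglongrightarrow> v"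
  shows "u \<in> D \<and> T u = v"
proof (rule T_max)
  fix w assume w: "w \<in> D"
  have "(\<lambda>n. inner (T w) (x n)) \<longlonglongrightarrow> inner (T w) u" "(\<lambda>n. inner w (T (x n))) \<longlonglongrightarrow> inner w v"
    by (intro tendsto_intros assms)+
  then show "inner (T w) u = inner w v"
    using T_sym[OF w assms(1)] by (auto intro: LIMSEQ_unique)
qed

definition graph :: "('a \<times> 'a) set" where "graph = (\<lambda>x. (x, T x)) ` D"

lemma subspace_graph: "subspace graph"
  unfolding graph_def subspace_def
  using subD T_0 by (auto simp: zero_prod_def subspace_0 subspace_add subspace_scale T_add T_scale image_iff)

lemma closed_graph: "closed graph"
proof (rule closed_sequential_limits[THEN iffD2], intro allI impI, elim conjE)
  fix z l assume z: "\<forall>n. z n \<in> graph" and l: "z \<longlonglongrightarrow> l"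
  have fz: "fst (z n) \<in> D" "snd (z n) = T (fst (z n))" for n
    using z[rule_format, of n] unfolding graph_def by auto
  have "fst l \<in> D \<and> T (fst l) = snd l"
    by (rule T_closed[of "\<lambda>n. fst (z n)"])
      (use fz tendsto_fst[OF l] tendsto_snd[OF l] in auto)
  then show "l \<in> graph" unfolding graph_def by (force simp: image_iff prod_eq_iff)
qed

text \<open>
  \<open>R = (1 + T\<^sup>2)\<^sup>-\<^sup>1\<close> and \<open>S = T (1 + T\<^sup>2)\<^sup>-\<^sup>1\<close> form the first column of the projection onto the graph,
  hence depend continuously on \<open>T\<close> in the gap metric.
\<close>

definition R :: "'a \<Rightarrow> 'a" where "R x = fst (orth_proj graph (x, 0))"
definition S :: "'a \<Rightarrow> 'a" where "S x = snd (orth_proj graph (x, 0))"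

text \<open>Orthogonality of (x, 0) - (R x, S x) to the graph reads <T u, S x> = <u, x - R x> for
  all u in D. Maximality of T then puts S x into the domain and evaluates T there.\<close>

lemma RS: "R x \<in> D" "T (R x) = S x" "S x \<in> D" "T (S x) = x - R x"
proof -
  have "(R x, S x) \<in> graph"
    unfolding R_def S_def using orth_proj_in[OF subspace_graph closed_graph] by simp
  then show RD: "R x \<in> D" "T (R x) = S x" unfolding graph_def by auto
  have "inner (T u) (S x) = inner u (x - R x)" if "u \<in> D" for u
  proof -
    have "(u, T u) \<in> graph" using that by (simp add: graph_def)
    from inner_orth_proj_diff[OF subspace_graph closed_graph this, of "(x, 0)"]
    have "inner ((x, 0) - (R x, S x)) (u, T u) = 0" unfolding R_def S_def by simp
    then show ?thesis by (simp add: inner_simps inner_commute)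
  qed
  from T_max[OF this] show "S x \<in> D" "T (S x) = x - R x" by auto
qed

lemma RS_unique:
  assumes "z \<in> D" "T z \<in> D" "z + T (T z) = x"
  shows "R x = z" "S x = T z"
proof -
  have "orth_proj graph (x, 0) = (z, T z)"
  proof (rule orth_proj_unique[OF subspace_graph])
    show "(z, T z) \<in> graph" using assms by (simp add: graph_def)
    have "(x, 0) - (z, T z) = (T (T z), - T z)" using assms(3) by auto
    then show "(x, 0) - (z, T z) \<in> graph\<^sup>\<bottom>"
      using assms T_sym unfolding orthogonal_comp_def orthogonal_def graph_def by auto
  qed
  then show "R x = z" "S x = T z" by (simp_all add: R_def S_def)
qed

lemma symmetric_R: "symmetric_op R"
  unfolding symmetric_op_def
proof (intro conjI allI)
  have "bounded_linear (\<lambda>x. fst (orth_proj graph (x, 0)))"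
    by (intro bounded_linear_compose[OF bounded_linear_fst] bounded_linear_compose[OF bounded_linear_orth_proj]
        subspace_graph closed_graph bounded_linear_Pair bounded_linear_ident bounded_linear_zero)
  then show "bounded_linear R" unfolding R_def .
  show "inner (R x) y = inner x (R y)" for x y
    using orth_proj_symmetric[OF subspace_graph closed_graph, of "(x, 0)" "(y, 0)"]
    by (simp add: R_def inner_prod_def)
qed

lemma symmetric_S: "symmetric_op S"
  unfolding symmetric_op_def
proof (intro conjI allI)
  have "bounded_linear (\<lambda>x. snd (orth_proj graph (x, 0)))"
    by (intro bounded_linear_compose[OF bounded_linear_snd] bounded_linear_compose[OF bounded_linear_orth_proj]
        subspace_graph closed_graph bounded_linear_Pair bounded_linear_ident bounded_linear_zero)
  then show "bounded_linear S" unfolding S_def .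
  show "inner (S x) y = inner x (S y)" for x y
  proof -
    have "inner (S x) y = inner (S x) (R y) + inner (S x) (T (S y))"
      by (simp add: RS inner_simps)
    also have "\<dots> = inner (R x) (S y) + inner (T (S x)) (S y)"
      using T_sym[OF RS(1)[of x] RS(1)[of y]] T_sym[OF RS(3)[of x] RS(3)[of y]] by (simp add: RS(2))
    also have "\<dots> = inner x (S y)" by (simp add: RS inner_simps)
    finally show ?thesis .
  qed
qed

lemma RS_commute: "R (S x) = S (R x)"
proof -
  define w where "w = R (R x)"
  have w: "w \<in> D" "T w = S (R x)" "T w \<in> D" "T (T w) = R x - w"
    using RS unfolding w_def by metis+
  have "T (T (T w)) = S x - T w" unfolding w(4) using RS w by (simp add: T_diff)
  then have "R (S x) = T w"
    using w RS(1) by (intro RS_unique) (auto intro: subspace_diff[OF subD])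
  then show ?thesis using w by simp
qed

text \<open>As a form, R = R^2 + S^2. So R is strictly positive, and multiplication by it neither
  changes signs nor creates kernel vectors.\<close>

lemma inner_R: "inner (R x) x = (norm (R x))\<^sup>2 + (norm (S x))\<^sup>2"
proof -
  have "inner (R x) x = inner (R x) (R x) + inner (R x) (T (S x))" by (simp add: RS inner_simps)
  then show ?thesis using T_sym[OF RS(1)[of x] RS(3)[of x]] by (simp add: RS power2_norm_eq_inner)
qed

lemma inner_R_nonneg: "0 \<le> inner (R x) x" unfolding inner_R by simp

lemma inner_R_eq_0: "inner (R x) x = 0 \<Longrightarrow> x = 0"
proof -
  assume "inner (R x) x = 0"
  then have "R x = 0" "S x = 0" unfolding inner_R by (simp_all add: add_nonneg_eq_0_iff)
  then show "x = 0" using RS(4)[of x] T_0 by simp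
qed

text \<open>1 = R + S T on the domain, seen by testing against all v and moving R and S across. It
  expresses domain vectors through bounded operators, so whatever commutes with R and S preserves D
  and commutes with T.\<close>

lemma domain_decomp: assumes "z \<in> D" shows "R z + S (T z) = z"
proof -
  have "inner (R z + S (T z) - z) v = 0" for v
  proof -
    have "inner (R z + S (T z)) v = inner z (R v) + inner (T z) (S v)"
      by (simp add: inner_add_left symmetric_opD(2)[OF symmetric_R] symmetric_opD(2)[OF symmetric_S])
    also have "inner (T z) (S v) = inner z (v - R v)" using T_sym[OF assms RS(3)] RS(4) by simp
    finally show ?thesis by (simp add: inner_simps)
  qed
  then have "R z + S (T z) - z = 0" using inner_eq_zero_iff by blast
  then show ?thesis by simp
qed

lemma R_T: assumes "z \<in> D" shows "R (T z) = S z"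
proof -
  have "T (S (T z)) = T (z - R z)" using domain_decomp[OF assms] by (metis add_diff_cancel_left')
  then show ?thesis using assms by (simp add: RS T_diff)
qed

lemma commute_RS_reduces:
  assumes U: "bounded_linear U" and UR: "\<And>x. U (R x) = R (U x)" and US: "\<And>x. U (S x) = S (U x)"
    and z: "z \<in> D"
  shows "U z \<in> D" "T (U z) = U (T z)"
proof -
  note lin = linear_simps[OF U]
  have Uz: "U z = R (U z) + S (U (T z))"
    by (metis UR US domain_decomp[OF z] lin(1))
  show "U z \<in> D" by (subst Uz) (intro subspace_add[OF subD] RS)
  have "T (U z) = S (U z) + (U (T z) - R (U (T z)))"
    by (subst Uz) (simp add: T_add RS)
  also have "R (U (T z)) = S (U z)" by (metis R_T[OF z] UR US)
  finally show "T (U z) = U (T z)" by simp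
qed

lemma commute_T_commute_RS:
  assumes U: "bounded_linear U" and "\<And>z. z \<in> D \<Longrightarrow> U z \<in> D" "\<And>z. z \<in> D \<Longrightarrow> T (U z) = U (T z)"
  shows "U (R x) = R (U x)" "U (S x) = S (U x)"
proof -
  have "U (R x) \<in> D" "T (U (R x)) = U (S x)" "U (S x) \<in> D" "T (U (S x)) = U x - U (R x)"
    using assms RS by (auto simp: linear_simps[OF U])
  then show "U (R x) = R (U x)" "U (S x) = S (U x)"
    using RS_unique[of "U (R x)" "U x"] by auto
qed

end

text \<open>The single equation \<open>F_F\<close> contains idempotence (s = t) as well as the
  nesting of ranges and kernels. Multiplication by i is left out, so the locale lives on real
  spaces.\<close>

locale resolution_of_identity =
  fixes F :: "real \<Rightarrow> 'a::{real_inner,complete_space} \<Rightarrow> 'a"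
  assumes F_symmetric: "symmetric_op (F t)"
    and F_F: "F s (F t x) = F (min s t) x"
    and F_right: "((\<lambda>s. F s x) \<longlongrightarrow> F t x) (at_right t)"
    and F_bot: "((\<lambda>t. F t x) \<longlongrightarrow> 0) at_bot"
    and F_top: "((\<lambda>t. F t x) \<longlongrightarrow> x) at_top"

text \<open>The statement T = \<integral> t dF_t expressed through order: F t reduces T, with T
  \<le> t on its range and T \<ge> t on its kernel. These bounds are what the estimates on spectral
  subspaces are drawn from.\<close>

locale spectral_resolution = sa_operator D T + resolution_of_identity F
  for D :: "'a::{real_inner,complete_space} set" and T F +
  assumes F_dom: "x \<in> D \<Longrightarrow> F t x \<in> D"
    and F_T: "x \<in> D \<Longrightarrow> T (F t x) = F t (T x)"
    and F_upper: "x \<in> D \<Longrightarrow> F t x = x \<Longrightarrow> inner (T x) x \<le> t * (norm x)\<^sup>2"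
    and F_lower: "x \<in> D \<Longrightarrow> F t x = 0 \<Longrightarrow> t * (norm x)\<^sup>2 \<le> inner (T x) x"

text \<open>Monotone projections converge strongly along sequences, and the limit vector is fixed by
  every F s beyond the limiting parameter. The three hypotheses identify that vector, so each limit
  follows from a statement about fixed or annihilated vectors.\<close>

lemma spectral_family_tendsto:
  fixes F :: "real \<Rightarrow> 'a::{real_inner,complete_space} \<Rightarrow> 'a"
  assumes sym: "\<And>t. symmetric_op (F t)" and FF: "\<And>s t x. F s (F t x) = F (min s t) x"
    and right: "\<And>t y. (\<And>s. s > t \<Longrightarrow> F s y = y) \<Longrightarrow> F t y = y"
    and bot: "\<And>y. (\<And>s. F s y = y) \<Longrightarrow> y = 0"
    and top: "\<And>y. (\<And>s. F s y = 0) \<Longrightarrow> y = 0"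
  shows "((\<lambda>s. F s x) \<longlongrightarrow> F t x) (at_right t)"
    and "((\<lambda>t. F t x) \<longlongrightarrow> 0) at_bot"
    and "((\<lambda>t. F t x) \<longlongrightarrow> x) at_top"
proof -
  note D = symmetric_opD[OF sym]
  have contr: "norm (F s y) \<le> norm y" for s y
    by (rule symmetric_idempotent_norm_le(2)[OF sym]) (simp add: FF)
  have inner_F: "inner (F s x) (F t x) = (norm (F (min s t) x))\<^sup>2" for s t x
    using D(2)[of s x "F t x"] D(2)[of "min s t" x x] symmetric_idempotent_norm_le(1)[OF sym, of "min s t" x]
    by (simp add: FF inner_commute)
  have decreasing: "\<exists>y. (\<lambda>n. F (r n) x) \<longlonglongrightarrow> y \<and> (\<forall>s. (\<exists>n. r n \<le> s) \<longrightarrow> F s y = y)"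
    if "decseq r" for r :: "nat \<Rightarrow> real"
  proof -
    have mono: "r n \<le> r m" if "m \<le> n" for m n using \<open>decseq r\<close> that by (simp add: decseq_def)
    have "convergent (\<lambda>n. F (r n) x)"
      by (rule decreasing_orthogonal_convergent) (simp add: inner_F min_absorb2 mono)
    then obtain y where y: "(\<lambda>n. F (r n) x) \<longlonglongrightarrow> y" by (auto simp: convergent_def)
    have "F s y = y" if "r n \<le> s" for s n
    proof (rule LIMSEQ_unique)
      show "(\<lambda>n. F s (F (r n) x)) \<longlonglongrightarrow> F s y" by (rule bounded_linear.tendsto[OF D(1) y])
      have "\<forall>\<^sub>F k in sequentially. F (r k) x = F s (F (r k) x)"
        using eventually_ge_at_top[of n]
        by eventually_elim (use that mono in \<open>force simp: FF min_absorb2\<close>)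
      with y show "(\<lambda>n. F s (F (r n) x)) \<longlonglongrightarrow> y" by (simp add: filterlim_cong)
    qed
    with y show ?thesis by blast
  qed
  show "((\<lambda>s. F s x) \<longlongrightarrow> F t x) (at_right t)"
  proof -
    define r where "r = (\<lambda>n. t + inverse (real (Suc n)))"
    have r_lim: "r \<longlonglongrightarrow> t"
      unfolding r_def using tendsto_add[OF tendsto_const LIMSEQ_inverse_real_of_nat] by force
    have dec: "decseq r" unfolding r_def decseq_def by (intro allI impI add_left_mono le_imp_inverse_le) simp_all
    obtain y where y: "(\<lambda>n. F (r n) x) \<longlonglongrightarrow> y" and "\<forall>s. (\<exists>n. r n \<le> s) \<longrightarrow> F s y = y"
      using decreasing[OF dec] by blast
    then have ry: "F s y = y" if "r n \<le> s" for s n using that by blast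
    have "F s y = y" if "s > t" for s
    proof -
      have "\<forall>\<^sub>F n in sequentially. r n < s" using order_tendstoD(2)[OF r_lim that] .
      then obtain n where "r n < s" by (auto simp: eventually_sequentially)
      then show ?thesis using ry[of n s] by simp
    qed
    then have "F t y = y" by (rule right)
    moreover have "(\<lambda>n. F t (F (r n) x)) \<longlonglongrightarrow> F t y" by (rule bounded_linear.tendsto[OF D(1) y])
    moreover have "F t (F (r n) x) = F t x" for n by (simp add: FF r_def)
    ultimately have yt: "y = F t x" by (simp add: LIMSEQ_const_iff)
    show ?thesis
    proof (rule tendstoI)
      fix e :: real assume "e > 0"
      then obtain n where n: "dist (F (r n) x) (F t x) < e"
        using metric_LIMSEQ_D[OF y[unfolded yt]] by blast
      have "dist (F s x) (F t x) < e" if "t < s" "s < r n" for s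
      proof -
        have "F s x - F t x = F s (F (r n) x - F t x)" using that by (simp add: D(4) FF)
        then have "dist (F s x) (F t x) \<le> dist (F (r n) x) (F t x)"
          using contr by (simp add: dist_norm)
        with n show ?thesis by simp
      qed
      moreover have "t < r n" unfolding r_def by simp
      ultimately show "\<forall>\<^sub>F s in at_right t. dist (F s x) (F t x) < e"
        unfolding eventually_at_right_field by blast
    qed
  qed
  show "((\<lambda>t. F t x) \<longlongrightarrow> 0) at_bot"
  proof -
    have "decseq (\<lambda>n. - real n)" by (simp add: decseq_def)
    from decreasing[OF this] obtain y where y: "(\<lambda>n. F (- real n) x) \<longlonglongrightarrow> y"
      and ry: "\<forall>s. (\<exists>n. - real n \<le> s) \<longrightarrow> F s y = y" by blast
    have "F s y = y" for s
      using ry real_arch_simple[of "- s"] by (metis minus_le_iff)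
    then have "y = 0" by (rule bot)
    show ?thesis
    proof (rule tendstoI)
      fix e :: real assume "e > 0"
      then obtain n where n: "norm (F (- real n) x) < e"
        using metric_LIMSEQ_D[OF y[unfolded \<open>y = 0\<close>]] by fastforce
      have "dist (F s x) 0 < e" if "s \<le> - real n" for s
        using contr[of s "F (- real n) x"] that n by (simp add: FF)
      then show "\<forall>\<^sub>F s in at_bot. dist (F s x) 0 < e"
        unfolding eventually_at_bot_linorder by blast
    qed
  qed
  show "((\<lambda>t. F t x) \<longlongrightarrow> x) at_top"
  proof -
    \<comment> \<open>At infinity it is the complementary projections 1 - F that decrease.\<close>
    have "convergent (\<lambda>n. x - F (real n) x)"
    proof (rule decreasing_orthogonal_convergent)
      fix m n :: nat assume "m \<le> n"
      then show "inner (x - F (real m) x) (x - F (real n) x) = (norm (x - F (real n) x))\<^sup>2"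
        using inner_F[of "real m" x "real n"] inner_F[of "real n" x "real n"] D(2)[of "real m" x x]
          symmetric_idempotent_norm_le(1)[OF sym, of "real m" x]
          symmetric_idempotent_norm_le(1)[OF sym, of "real n" x]
        by (simp add: FF inner_simps power2_norm_eq_inner inner_commute)
    qed
    then obtain y where y: "(\<lambda>n. x - F (real n) x) \<longlonglongrightarrow> y" by (auto simp: convergent_def)
    have "F s y = 0" for s
    proof (rule LIMSEQ_unique)
      show "(\<lambda>n. F s (x - F (real n) x)) \<longlonglongrightarrow> F s y" by (rule bounded_linear.tendsto[OF D(1) y])
      have "\<forall>\<^sub>F n in sequentially. 0 = F s (x - F (real n) x)"
        using eventually_ge_at_top[of "nat \<lceil>s\<rceil>"]
        by eventually_elim (simp add: D(4) FF min_absorb1 nat_le_iff ceiling_le_iff)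
      then show "(\<lambda>n. F s (x - F (real n) x)) \<longlonglongrightarrow> 0"
        using tendsto_eventually eventually_mono by (metis (mono_tags, lifting))
    qed
    then have "y = 0" by (rule top)
    show ?thesis
    proof (rule tendstoI)
      fix e :: real assume "e > 0"
      then obtain n where n: "norm (x - F (real n) x) < e"
        using metric_LIMSEQ_D[OF y[unfolded \<open>y = 0\<close>]] by fastforce
      have "dist (F s x) x < e" if s: "s \<ge> real n" for s
      proof -
        have eq: "x - F s x = (x - F (real n) x) - F s (x - F (real n) x)"
          using s by (simp add: D(4) FF min_absorb2)
        have "(norm (z - F s z))\<^sup>2 \<le> (norm z)\<^sup>2" for z
          using symmetric_idempotent_norm_le(1)[OF sym, of s z] inner_ge_zero[of "F s z"]
          by (simp add: FF power2_norm_eq_inner inner_simps inner_commute)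
        then have "norm (z - F s z) \<le> norm z" for z by (rule power2_le_imp_le) simp
        then have "norm (x - F s x) \<le> norm (x - F (real n) x)" by (subst eq)
        with n show ?thesis by (simp add: dist_norm norm_minus_commute)
      qed
      then show "\<forall>\<^sub>F s in at_top. dist (F s x) x < e"
        unfolding eventually_at_top_linorder by blast
    qed
  qed
qed

section \<open>Existence of spectral resolutions\<close>

context sa_operator
begin

text \<open>F t = 1 - E t, where E t is the positive-part projection of a bounded operator with the
  sign of T - t. The second conjunct, commutation with everything that commutes with T, is there for
  U = multiplication by i.\<close>

theorem spectral_resolution_exists:
  "\<exists>F. spectral_resolution D T F \<and>
    (\<forall>U. bounded_linear U \<longrightarrow> (\<forall>z\<in>D. U z \<in> D \<and> T (U z) = U (T z)) \<longrightarrow> (\<forall>t x. U (F t x) = F t (U x)))"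
proof -
  define C where "C = (\<lambda>t x. S x - t *\<^sub>R R x)"
  \<comment> \<open>\<open>C t = (T - t) (1 + T\<^sup>2)\<^sup>-\<^sup>1\<close> is bounded and has the same sign as \<open>T - t\<close>.\<close>
  have C: "symmetric_op (C t)" for t
    unfolding C_def by (intro symmetric_op_diff symmetric_op_scale symmetric_R symmetric_S)
  have "\<forall>t. \<exists>E. symmetric_op E \<and> (\<forall>x. E (E x) = E x) \<and>
    (\<forall>U. bounded_linear U \<longrightarrow> (\<forall>x. U (C t x) = C t (U x)) \<longrightarrow> (\<forall>x. U (E x) = E (U x))) \<and>
    (\<forall>x. E x = x \<longrightarrow> 0 \<le> inner (C t x) x) \<and> (\<forall>x. E x = 0 \<longrightarrow> inner (C t x) x \<le> 0) \<and>
    (\<forall>x. E x = x \<longrightarrow> inner (C t x) x = 0 \<longrightarrow> x = 0)"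
    using positive_part_projection[OF C] by (rule allI)
  from choice[OF this] obtain E where *: "\<forall>t. symmetric_op (E t) \<and> (\<forall>x. E t (E t x) = E t x) \<and>
    (\<forall>U. bounded_linear U \<longrightarrow> (\<forall>x. U (C t x) = C t (U x)) \<longrightarrow> (\<forall>x. U (E t x) = E t (U x))) \<and>
    (\<forall>x. E t x = x \<longrightarrow> 0 \<le> inner (C t x) x) \<and> (\<forall>x. E t x = 0 \<longrightarrow> inner (C t x) x \<le> 0) \<and>
    (\<forall>x. E t x = x \<longrightarrow> inner (C t x) x = 0 \<longrightarrow> x = 0)" ..
  have E: "symmetric_op (E t)" and EE: "E t (E t x) = E t x" for t x
    using * by simp_all
  have E_comm: "U (E t x) = E t (U x)" if "bounded_linear U" "\<And>x. U (C t x) = C t (U x)" for U t x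
    using * that by simp
  have E_pos: "0 \<le> inner (C t x) x" if "E t x = x" for t x using * that by simp
  have E_neg: "inner (C t x) x \<le> 0" if "E t x = 0" for t x using * that by simp
  have E_0: "x = 0" if "E t x = x" "inner (C t x) x = 0" for t x using * that by blast
  note ED = symmetric_opD[OF E] and RD = symmetric_opD[OF symmetric_R] and SD = symmetric_opD[OF symmetric_S]
  have comm: "U (E t x) = E t (U x)"
    if "bounded_linear U" "\<And>x. U (R x) = R (U x)" "\<And>x. U (S x) = S (U x)" for U t x
    by (rule E_comm[OF that(1)]) (simp add: C_def linear_simps[OF that(1)] that(2,3))
  have ER: "R (E t x) = E t (R x)" for t x by (rule comm) (simp_all add: RD RS_commute)
  have ES: "S (E t x) = E t (S x)" for t x by (rule comm) (simp_all add: SD RS_commute)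
  have Ecomm: "E s (E t x) = E t (E s x)" for s t x by (rule comm) (simp_all add: ED ER ES)
  define F where "F = (\<lambda>t x. x - E t x)"
  have F: "symmetric_op (F t)" for t
    unfolding F_def by (intro symmetric_op_diff symmetric_op_ident E)
  have C_diff: "inner (C s x) x = inner (C t x) x + (t - s) * inner (R x) x" for s t x
    unfolding C_def by (simp add: inner_simps algebra_simps)
  \<comment> \<open>For s < t one has C s - C t = (t - s) R with R strictly positive. A vector in
    the range of E t and the kernel of E s would have contradictory signs, so it vanishes.\<close>
  have mono: "E t (F s x) = 0" if "s \<le> t" for s t x
  proof (cases "s = t")
    case True then show ?thesis by (simp add: F_def ED EE)
  next
    case False
    define y where "y = E t (F s x)"
    have "E t y = y" "E s y = 0" by (simp_all add: y_def F_def ED EE Ecomm[of s])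
    then have "(t - s) * inner (R y) y \<le> 0" using C_diff[of s y t] E_pos[of t y] E_neg[of s y] by linarith
    then have "inner (R y) y \<le> 0" using that False by (simp add: mult_le_0_iff)
    then show ?thesis using inner_R_nonneg[of y] inner_R_eq_0[of y] unfolding y_def by linarith
  qed
  have FF: "F s (F t x) = F (min s t) x" for s t x
  proof (cases "s \<le> t")
    case True
    have "F s (F t x) = F t (F s x)" by (simp add: F_def ED Ecomm[of s t])
    then show ?thesis using mono[OF True, of x] True by (simp add: F_def min_absorb1)
  next
    case False
    then show ?thesis using mono[of t s x] by (simp add: F_def min_absorb2)
  qed
  have F_eq: "F t x = x \<longleftrightarrow> E t x = 0" "F t x = 0 \<longleftrightarrow> E t x = x" for t x unfolding F_def by auto
  \<comment> \<open>z = E t y is annihilated by all E s with s > t, which in the limit gives <C t z,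
    z> \<le> 0. Strict positivity on the range of E t leaves z = 0.\<close>
  have right: "F t y = y" if *: "\<And>s. s > t \<Longrightarrow> F s y = y" for t y
  proof -
    define z where "z = E t y"
    have "E s z = 0" if "s > t" for s
      using *[OF that] unfolding F_eq z_def by (subst Ecomm) (simp add: ED)
    then have le: "inner (C t z) z \<le> (s - t) * inner (R z) z" if "s > t" for s
      using C_diff[of t z s] E_neg[of s z] that by fastforce
    have "inner (C t z) z \<le> 0"
    proof (rule field_le_epsilon)
      fix e :: real assume e: "e > 0"
      define s where "s = t + e / (inner (R z) z + 1)"
      have "s > t" unfolding s_def using e inner_R_nonneg[of z] by simp
      have "(s - t) * inner (R z) z \<le> (s - t) * (inner (R z) z + 1)" using \<open>s > t\<close> by simp
      also have "\<dots> = e" unfolding s_def using inner_R_nonneg[of z] by simp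
      finally show "inner (C t z) z \<le> 0 + e" using le[OF \<open>s > t\<close>] by simp
    qed
    moreover have "E t z = z" unfolding z_def by (rule EE)
    ultimately have "z = 0" using E_pos[of t z] E_0[of t z] by simp
    then show ?thesis unfolding F_eq z_def .
  qed
  have bot: "y = 0" if *: "\<And>s. F s y = y" for y
  proof (rule inner_R_eq_0, rule ccontr)
    assume ne: "inner (R y) y \<noteq> 0"
    then have pos: "inner (R y) y > 0" using inner_R_nonneg[of y] by simp
    \<comment> \<open>Makes <C s y, y> equal to 1; the opposite shift in the next claim makes it -
      1.\<close>
    define s where "s = (inner (S y) y - 1) / inner (R y) y"
    have "inner (C s y) y \<le> 0" using * E_neg unfolding F_eq by blast
    then show False using pos unfolding C_def s_def by (simp add: inner_simps)
  qed
  have top: "y = 0" if *: "\<And>s. F s y = 0" for y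
  proof (rule inner_R_eq_0, rule ccontr)
    assume ne: "inner (R y) y \<noteq> 0"
    then have pos: "inner (R y) y > 0" using inner_R_nonneg[of y] by simp
    define s where "s = (inner (S y) y + 1) / inner (R y) y"
    have "0 \<le> inner (C s y) y" using * E_pos unfolding F_eq by blast
    then show False using pos unfolding C_def s_def by (simp add: inner_simps)
  qed
  have red: "F t z \<in> D" "T (F t z) = F t (T z)" if "z \<in> D" for t z
    using commute_RS_reduces[OF symmetric_opD(1)[OF F], OF _ _ that]
    by (simp_all add: F_def RD SD ER ES)
  \<comment> \<open>T - t = C t (1 + T^2), read as a form on D. Since z and T z lie in the same
    range or kernel of F t, both summands have a known sign.\<close>
  have form: "inner (T z) z - t * (norm z)\<^sup>2 = inner (C t z) z + inner (C t (T z)) (T z)" if z: "z \<in> D" for t z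
  proof -
    have STz: "S (T z) = z - R z" using domain_decomp[OF z] by (metis add_diff_cancel_left')
    have "inner (R z) (T z) = inner (S z) z" "inner (S z) (T z) = inner z z - inner (R z) z"
      using T_sym[OF RS(1) z] T_sym[OF RS(3) z] by (simp_all add: RS inner_simps)
    then show ?thesis
      unfolding C_def
      by (simp add: STz R_T[OF z] inner_diff_left power2_norm_eq_inner inner_commute[of z "T z"] right_diff_distrib)
  qed
  have "spectral_resolution D T F"
  proof
    show "((\<lambda>s. F s x) \<longlongrightarrow> F t x) (at_right t)" "((\<lambda>t. F t x) \<longlongrightarrow> 0) at_bot"
      "((\<lambda>t. F t x) \<longlongrightarrow> x) at_top" for t x
      using spectral_family_tendsto[OF F FF right bot top] by blast+
    show "inner (T x) x \<le> t * (norm x)\<^sup>2" if "x \<in> D" "F t x = x" for t x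
    proof -
      have "F t (T x) = T x" using red(2)[OF that(1), of t] that(2) by simp
      then have "inner (C t x) x \<le> 0" "inner (C t (T x)) (T x) \<le> 0"
        using that(2) E_neg unfolding F_eq by auto
      with form[OF that(1), of t] show ?thesis by linarith
    qed
    show "t * (norm x)\<^sup>2 \<le> inner (T x) x" if "x \<in> D" "F t x = 0" for t x
    proof -
      have "F t (T x) = 0" using red(2)[OF that(1), of t] that(2) T_0 by simp
      then have "0 \<le> inner (C t x) x" "0 \<le> inner (C t (T x)) (T x)"
        using that(2) E_pos unfolding F_eq by auto
      with form[OF that(1), of t] show ?thesis by linarith
    qed
  qed (use F FF red in auto)
  moreover have "U (F t x) = F t (U x)"
    if "bounded_linear U" "\<forall>z\<in>D. U z \<in> D \<and> T (U z) = U (T z)" for U t x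
    using comm[OF that(1)] commute_T_commute_RS[OF that(1)] that(2)
    unfolding F_def by (simp add: linear_simps[OF that(1)])
  ultimately show ?thesis by blast
qed

end

section \<open>Spectral measures\<close>

lemma subspace_closure:
  fixes V :: "'a::real_normed_vector set"
  assumes "subspace V" shows "subspace (closure V)"
  unfolding subspace_def
proof (intro conjI ballI allI)
  show "0 \<in> closure V" using assms closure_subset subspace_0 by blast
  fix x y :: 'a and r :: real assume "x \<in> closure V"
  then obtain u where u: "\<And>n. u n \<in> V" "u \<longlonglongrightarrow> x" by (auto simp: closure_sequential)
  have "(\<lambda>n. r *\<^sub>R u n) \<longlonglongrightarrow> r *\<^sub>R x" by (intro tendsto_intros u)
  then show "r *\<^sub>R x \<in> closure V"
    using u(1) subspace_scale[OF assms] unfolding closure_sequential by (intro exI[of _ "\<lambda>n. r *\<^sub>R u n"]) blast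
  assume "y \<in> closure V"
  then obtain v where v: "\<And>n. v n \<in> V" "v \<longlonglongrightarrow> y" by (auto simp: closure_sequential)
  have "(\<lambda>n. u n + v n) \<longlonglongrightarrow> x + y" by (intro tendsto_intros u v)
  then show "x + y \<in> closure V"
    using u(1) v(1) subspace_add[OF assms] unfolding closure_sequential by (intro exI[of _ "\<lambda>n. u n + v n"]) blast
qed

lemma (in sa_operator) dense_domain: "closure D = UNIV"
proof (rule orth_comp_eq_0_imp_UNIV[OF subspace_closure[OF subD] closed_closure])
  fix x assume "\<And>y. y \<in> closure D \<Longrightarrow> inner x y = 0"
  then have "inner y x = 0" if "y \<in> D" for y
    using that closure_subset by (metis inner_commute subsetD)
  then show "x = 0" by (rule orthogonal_domain)
qed

lemma (in sa_operator) domain_sequence: "\<exists>w. (\<forall>n. w n \<in> D) \<and> w \<longlonglongrightarrow> x"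
  using dense_domain closure_sequential[of x D] by auto

text \<open>On \<open>V\<close>, the domain vectors in the range of P, the form bounds make T minus
  the midpoint m Lipschitz with constant r. As T is closed and D is dense, the whole range of P then
  lies in the domain.\<close>

lemma (in sa_operator) reducing_projection:
  assumes P: "symmetric_op P" and PP: "\<And>x. P (P x) = P x"
    and PD: "\<And>x. x \<in> D \<Longrightarrow> P x \<in> D" and PT: "\<And>x. x \<in> D \<Longrightarrow> T (P x) = P (T x)"
    and bounds: "\<And>x. x \<in> D \<Longrightarrow> P x = x \<Longrightarrow> \<alpha> * (norm x)\<^sup>2 \<le> inner (T x) x \<and> inner (T x) x \<le> \<beta> * (norm x)\<^sup>2"
  shows "P x \<in> D"
    and "P x = x \<Longrightarrow> norm (T x - ((\<alpha> + \<beta>) / 2) *\<^sub>R x) \<le> (\<beta> - \<alpha>) / 2 * norm x"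
proof -
  define m r where "m = (\<alpha> + \<beta>) / 2" and "r = (\<beta> - \<alpha>) / 2"
  note PL = symmetric_opD[OF P]
  define V where "V = {x \<in> D. P x = x}"
  have V: "subspace V"
    using subD unfolding V_def subspace_def by (auto simp: PL)
  have VD: "x \<in> V \<Longrightarrow> x \<in> D" for x unfolding V_def by simp
  define f where "f = (\<lambda>x. T x - m *\<^sub>R x)"
  have est: "norm (f u) \<le> r * norm u" if u: "u \<in> V" for u
  proof -
    have form: "\<bar>inner (f u) v\<bar> \<le> r * norm u * norm v" if v: "v \<in> V" for v
    proof (rule symmetric_form_bound[OF V u v])
      show "f (x + y) = f x + f y" if "x \<in> V" "y \<in> V" for x y
        using that VD unfolding f_def by (simp add: T_add algebra_simps)
      show "f (c *\<^sub>R x) = c *\<^sub>R f x" if "x \<in> V" for c x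
        using that VD unfolding f_def by (simp add: T_scale algebra_simps)
      show "inner (f x) y = inner x (f y)" if "x \<in> V" "y \<in> V" for x y
        using T_sym[OF VD VD, OF that] unfolding f_def by (simp add: inner_simps)
      show "\<bar>inner (f x) x\<bar> \<le> r * (norm x)\<^sup>2" if "x \<in> V" for x
        using bounds[of x] that unfolding V_def f_def m_def r_def
        by (auto simp: inner_simps power2_norm_eq_inner field_simps abs_le_iff)
    qed
    have Pf: "P (f u) = f u"
      using u PT[of u] unfolding V_def f_def by (simp add: PL)
    \<comment> \<open>f u is fixed by P, so any test vector of the dense domain may be replaced by
      its projection, for which \<open>form\<close> applies.\<close>
    have le: "inner (f u) w \<le> r * norm u * norm w" if w: "w \<in> D" for w
    proof -
      have "P w \<in> V" using w PD PP unfolding V_def by simp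
      have r0: "0 \<le> r * norm u"
      proof (cases "u = 0")
        case False
        then have "0 \<le> r * norm u * norm u" using form[OF u] by (meson abs_ge_zero order_trans)
        then show ?thesis using False by (simp add: zero_le_mult_iff)
      qed simp
      have "inner (f u) w = inner (f u) (P w)" using PL(2)[of "f u" w] Pf by simp
      also have "\<dots> \<le> r * norm u * norm (P w)" using form[OF \<open>P w \<in> V\<close>] by simp
      also have "\<dots> \<le> r * norm u * norm w"
        using symmetric_idempotent_norm_le(2)[OF P PP] r0 by (rule mult_left_mono)
      finally show ?thesis .
    qed
    obtain w where w: "\<And>n. w n \<in> D" "w \<longlonglongrightarrow> f u" using domain_sequence by blast
    have "inner (f u) (f u) \<le> r * norm u * norm (f u)"
    proof (rule LIMSEQ_le)
      show "(\<lambda>n. inner (f u) (w n)) \<longlonglongrightarrow> inner (f u) (f u)" by (intro tendsto_intros w)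
      show "(\<lambda>n. r * norm u * norm (w n)) \<longlonglongrightarrow> r * norm u * norm (f u)" by (intro tendsto_intros w)
    qed (use le w in blast)
    moreover have "0 \<le> r * norm u * norm u" using form[OF u] by (meson abs_ge_zero order_trans)
    ultimately show ?thesis
      by (cases "f u = 0") (auto simp: dot_square_norm power2_eq_square zero_le_mult_iff)
  qed
  show PxD: "P x \<in> D" for x
  proof -
    obtain w where w: "\<And>n. w n \<in> D" "w \<longlonglongrightarrow> x" using domain_sequence by blast
    have PV: "P (w n) \<in> V" for n unfolding V_def using w PD PP by simp
    have Pw: "(\<lambda>n. P (w n)) \<longlonglongrightarrow> P x" by (rule bounded_linear.tendsto[OF PL(1) w(2)])
    have "Cauchy (\<lambda>n. f (P (w n)))"
    proof (rule CauchyI)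
      fix e :: real assume e: "e > 0"
      have "Cauchy (\<lambda>n. P (w n))" using Pw by (rule LIMSEQ_imp_Cauchy)
      then obtain M where M: "\<And>k n. k \<ge> M \<Longrightarrow> n \<ge> M \<Longrightarrow> norm (P (w k) - P (w n)) < e / (\<bar>r\<bar> + 1)"
        using CauchyD[of _ "e / (\<bar>r\<bar> + 1)"] e by (metis abs_ge_zero divide_pos_pos add_nonneg_pos zero_less_one)
      have "norm (f (P (w k)) - f (P (w n))) < e" if "k \<ge> M" "n \<ge> M" for k n
      proof -
        have "f (P (w k)) - f (P (w n)) = f (P (w k) - P (w n))"
          using VD[OF PV] unfolding f_def by (simp add: T_diff algebra_simps)
        also have "norm \<dots> \<le> r * norm (P (w k) - P (w n))"
          by (intro est subspace_diff[OF V] PV)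
        also have "\<dots> \<le> (\<bar>r\<bar> + 1) * norm (P (w k) - P (w n))" by (intro mult_right_mono) auto
        also have "\<dots> < e" using M[OF that] by (simp add: field_simps)
        finally show ?thesis .
      qed
      then show "\<exists>M. \<forall>k\<ge>M. \<forall>n\<ge>M. norm (f (P (w k)) - f (P (w n))) < e" by blast
    qed
    then obtain y where y: "(\<lambda>n. f (P (w n))) \<longlonglongrightarrow> y"
      using Cauchy_convergent convergent_def by blast
    have "(\<lambda>n. f (P (w n)) + m *\<^sub>R P (w n)) \<longlonglongrightarrow> y + m *\<^sub>R P x" by (intro tendsto_intros y Pw)
    then have "(\<lambda>n. T (P (w n))) \<longlonglongrightarrow> y + m *\<^sub>R P x" unfolding f_def by simp
    from T_closed[OF _ Pw this] show "P x \<in> D" using VD[OF PV] by blast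
  qed
  show "norm (T x - ((\<alpha> + \<beta>) / 2) *\<^sub>R x) \<le> (\<beta> - \<alpha>) / 2 * norm x" if "P x = x"
    using est[of x] PxD[of x] that unfolding V_def f_def m_def r_def by simp
qed

section \<open>Scalar spectral measures; order bounds from integrals\<close>

context resolution_of_identity
begin

lemmas F_lin = symmetric_opD[OF F_symmetric]

lemma F_idem: "F t (F t x) = F t x" by (simp add: F_F)

lemma norm_F_le: "norm (F t x) \<le> norm x"
  by (rule symmetric_idempotent_norm_le(2)[OF F_symmetric F_idem])

lemma norm_F_mono: "s \<le> t \<Longrightarrow> norm (F s x) \<le> norm (F t x)"
  using norm_F_le[of s "F t x"] by (simp add: F_F min_absorb1)

lemma inner_F: "inner (F s x) (F t y) = inner (F (min s t) x) y"
  using F_lin(2)[of t "F s x" y] by (simp add: F_F min.commute)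

lemma inner_F_self: "inner (F t x) x = (norm (F t x))\<^sup>2"
  by (rule symmetric_idempotent_norm_le(1)[OF F_symmetric F_idem, symmetric])

lemma norm_F_diff: "s \<le> t \<Longrightarrow> (norm (F t x - F s x))\<^sup>2 = (norm (F t x))\<^sup>2 - (norm (F s x))\<^sup>2"
  by (simp add: power2_norm_eq_inner inner_simps inner_F min_absorb1 min_absorb2)

definition spec :: "'a \<Rightarrow> real measure"
  where "spec x = interval_measure (\<lambda>t. (norm (F t x))\<^sup>2)"

lemma spec_conditions:
  shows "s \<le> t \<Longrightarrow> (norm (F s x))\<^sup>2 \<le> (norm (F t x))\<^sup>2"
    and "continuous (at_right t) (\<lambda>t. (norm (F t x))\<^sup>2)"
    and "((\<lambda>t. (norm (F t x))\<^sup>2) \<longlongrightarrow> 0) at_bot"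
    and "((\<lambda>t. (norm (F t x))\<^sup>2) \<longlongrightarrow> (norm x)\<^sup>2) at_top"
proof -
  show "s \<le> t \<Longrightarrow> (norm (F s x))\<^sup>2 \<le> (norm (F t x))\<^sup>2" by (simp add: norm_F_mono power_mono)
  show "continuous (at_right t) (\<lambda>t. (norm (F t x))\<^sup>2)"
    unfolding continuous_within by (intro tendsto_intros F_right)
  have "((\<lambda>t. (norm (F t x))\<^sup>2) \<longlongrightarrow> (norm (0::'a))\<^sup>2) at_bot" by (intro tendsto_intros F_bot)
  then show "((\<lambda>t. (norm (F t x))\<^sup>2) \<longlongrightarrow> 0) at_bot" by simp
  show "((\<lambda>t. (norm (F t x))\<^sup>2) \<longlongrightarrow> (norm x)\<^sup>2) at_top" by (intro tendsto_intros F_top)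
qed

lemma finite_borel_measure_spec: "finite_borel_measure (spec x)"
  unfolding spec_def by (rule finite_borel_measure_interval_measure[OF spec_conditions]) simp_all

lemma sets_spec [simp, measurable_cong]: "sets (spec x) = sets borel"
  and space_spec [simp]: "space (spec x) = UNIV"
  by (simp_all add: spec_def)

lemma cdf_spec: "measure (spec x) {..t} = (norm (F t x))\<^sup>2"
  unfolding spec_def by (rule measure_interval_measure_Iic[OF spec_conditions(1,2,3)]) simp_all

lemma measure_spec_UNIV: "measure (spec x) UNIV = (norm x)\<^sup>2"
proof -
  have "emeasure (spec x) UNIV = ennreal ((norm x)\<^sup>2)"
    unfolding spec_def by (rule interval_measure_UNIV[OF spec_conditions]) simp_all
  then show ?thesis by (simp add: measure_def)
qed

lemma measure_spec_Ioc: "s \<le> t \<Longrightarrow> measure (spec x) {s<..t} = (norm (F t x - F s x))\<^sup>2"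
  unfolding norm_F_diff unfolding spec_def
  by (rule measure_interval_measure_Ioc) (simp_all add: spec_conditions norm_F_mono)

lemma spec_eqI:
  assumes "finite_borel_measure M" "\<And>s. measure M {..s} = (norm (F s x))\<^sup>2"
  shows "spec x = M"
  by (rule cdf_unique'[OF finite_borel_measure_spec assms(1)]) (simp add: cdf_def fun_eq_iff assms(2) cdf_spec)

lemma finite_borel_measure_density:
  assumes "A \<in> sets borel" shows "finite_borel_measure (density (spec x) (indicator A))"
proof -
  interpret finite_borel_measure "spec x" by (rule finite_borel_measure_spec)
  have "finite_measure (density (spec x) (indicator A))"
    using assms by (intro finite_measure_restricted) simp
  then show ?thesis unfolding finite_borel_measure_def finite_borel_measure_axioms_def by simp
qed

text \<open>Cutting the vector with F t cuts the measure at t: both distribution functions at s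
  equal |F (min s t) x|^2.\<close>

lemma spec_F: "spec (F t x) = density (spec x) (indicator {..t})"
proof (rule spec_eqI[OF finite_borel_measure_density])
  interpret finite_borel_measure "spec x" by (rule finite_borel_measure_spec)
  have "{..t} \<inter> {..s} = {..min s t}" for s :: real by auto
  then show "measure (density (spec x) (indicator {..t})) {..s} = (norm (F s (F t x)))\<^sup>2" for s
    by (simp add: measure_restricted cdf_spec F_F)
qed simp

lemma spec_F_compl: "spec (x - F t x) = density (spec x) (indicator {t<..})"
proof (rule spec_eqI[OF finite_borel_measure_density])
  interpret finite_borel_measure "spec x" by (rule finite_borel_measure_spec)
  have "{t<..} \<inter> {..s} = {t<..s}" for s :: real by auto
  then show "measure (density (spec x) (indicator {t<..})) {..s} = (norm (F s (x - F t x)))\<^sup>2" for s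
    using measure_spec_Ioc[of t s x]
    by (cases "t \<le> s") (auto simp: measure_restricted F_lin F_F min_absorb1 min_absorb2)
qed simp

lemma integrable_spec_F:
  fixes g :: "real \<Rightarrow> real"
  assumes [measurable]: "g \<in> borel_measurable borel"
  shows "integrable (spec (F t x)) g \<longleftrightarrow> integrable (spec x) (\<lambda>s. indicator {..t} s * g s)"
    and "(\<integral>s. g s \<partial>spec (F t x)) = (\<integral>s. indicator {..t} s * g s \<partial>spec x)"
    and "(\<integral>s. g s \<partial>spec (x - F t x)) = (\<integral>s. indicator {t<..} s * g s \<partial>spec x)"
proof -
  have e: "density (spec x) (indicator A) = density (spec x) (\<lambda>s. ennreal (indicator A s))" for A
    by (simp add: ennreal_indicator)
  show "integrable (spec (F t x)) g \<longleftrightarrow> integrable (spec x) (\<lambda>s. indicator {..t} s * g s)"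
    unfolding spec_F e by (subst integrable_density) auto
  show "(\<integral>s. g s \<partial>spec (F t x)) = (\<integral>s. indicator {..t} s * g s \<partial>spec x)"
    unfolding spec_F e by (subst integral_density) auto
  show "(\<integral>s. g s \<partial>spec (x - F t x)) = (\<integral>s. indicator {t<..} s * g s \<partial>spec x)"
    unfolding spec_F_compl e by (subst integral_density) auto
qed

lemma integrable_spec_bounded:
  fixes g :: "real \<Rightarrow> real"
  assumes "g \<in> borel_measurable borel" "\<And>s. \<bar>g s\<bar> \<le> B"
  shows "integrable (spec x) g"
proof -
  interpret finite_borel_measure "spec x" by (rule finite_borel_measure_spec)
  show ?thesis using assms by (intro integrable_const_bound[of _ B]) auto
qed

lemma integrable_spec_ident:
  assumes "integrable (spec x) (\<lambda>t. t\<^sup>2)" shows "integrable (spec x) (\<lambda>t. t)"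
proof (rule Bochner_Integration.integrable_bound)
  show "integrable (spec x) (\<lambda>t. 1 + t\<^sup>2)"
    using assms integrable_spec_bounded[of "\<lambda>_. 1" 1] by simp
  have "\<bar>t\<bar> \<le> 1 + t\<^sup>2" for t :: real
  proof -
    have "0 \<le> (\<bar>t\<bar> - 1)\<^sup>2" by simp
    then show ?thesis by (simp add: power2_eq_square algebra_simps)
  qed
  then show "AE t in spec x. norm t \<le> norm (1 + t\<^sup>2)" by simp
qed simp

text \<open>The integrals determine only diagonal forms, and commutation of T with F t has to be
  extracted from them. The measure of x = u + v, with u in the range and v in the kernel of F t,
  splits at t, so <T x, x> = <T u, u> + <T v, v>; hence the cross term <T u, v> vanishes.\<close>

theorem spectral_resolutionI:
  assumes sa: "sa_operator D T"
    and dom: "D = {x. integrable (spec x) (\<lambda>t. t\<^sup>2)}"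
    and form: "\<And>x. x \<in> D \<Longrightarrow> inner (T x) x = (\<integral>t. t \<partial>spec x)"
  shows "spectral_resolution D T F"
proof -
  interpret sa_operator D T by (rule sa)
  have int1: "integrable (spec x) (\<lambda>s. s)" if "x \<in> D" for x
    using that integrable_spec_ident unfolding dom by simp
  have int2: "integrable (spec x) (\<lambda>s. indicator A s * s)" if "x \<in> D" "A \<in> sets borel" for x and A :: "real set"
    using integrable_mult_indicator[OF _ int1[OF that(1)], of A] that(2) by simp
  have int3: "integrable (spec x) (\<lambda>s. t * indicator A s)" if "A \<in> sets borel" for x and t :: real and A :: "real set"
    using that by (intro integrable_spec_bounded[of _ "\<bar>t\<bar>"]) (auto split: split_indicator)
  have FD: "F t x \<in> D" if "x \<in> D" for t x
    using that integrable_mult_indicator[of "{..t}" "spec x" "\<lambda>t. t\<^sup>2"]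
    unfolding dom by (simp add: integrable_spec_F)
  have orth: "inner (T u) v = 0" if u: "u \<in> D" "F t u = u" and v: "v \<in> D" "F t v = 0" for t u v
  proof -
    define x where "x = u + v"
    have x: "x \<in> D" "F t x = u" "x - F t x = v"
      using u v subD by (auto simp: x_def F_lin subspace_add)
    have "inner (T x) x = (\<integral>s. indicator {..t} s * s + indicator {t<..} s * s \<partial>spec x)"
      unfolding form[OF x(1)] by (rule Bochner_Integration.integral_cong) (auto split: split_indicator)
    also have "\<dots> = (\<integral>s. s \<partial>spec (F t x)) + (\<integral>s. s \<partial>spec (x - F t x))"
      by (subst Bochner_Integration.integral_add)
        (auto intro: int2[OF x(1)] simp: integrable_spec_F)
    also have "\<dots> = inner (T u) u + inner (T v) v"
      unfolding x(3) unfolding x(2) by (simp add: form u v)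
    finally have "inner (T u) v + inner (T v) u = 0"
      unfolding x_def by (simp add: T_add u v inner_simps)
    then show ?thesis using T_sym[OF v(1) u(1)] by (simp add: inner_commute)
  qed
  have FT: "T (F t x) = F t (T x)" if x: "x \<in> D" for t x
  proof -
    define u v where "u = F t x" and "v = x - F t x"
    have u: "u \<in> D" "F t u = u" unfolding u_def by (simp_all add: FD x F_idem)
    have v: "v \<in> D" "F t v = 0" unfolding v_def using subD by (simp_all add: FD x F_idem F_lin subspace_diff)
    \<comment> \<open>Invariance of the range: T u is orthogonal to the kernel part of every domain
      vector, and the domain is dense. The kernel is treated in the same way below.\<close>
    have "T u - F t (T u) = 0"
    proof (rule orthogonal_domain)
      fix w assume w: "w \<in> D"
      have "inner (T u) (w - F t w) = 0"
        using orth[OF u, of "w - F t w"] w subD by (simp add: FD F_idem F_lin subspace_diff)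
      moreover have "inner w (F t (T u)) = inner (T u) (F t w)" by (metis F_lin(2) inner_commute)
      ultimately show "inner w (T u - F t (T u)) = 0" by (simp add: inner_simps inner_commute)
    qed
    moreover have "F t (T v) = 0"
    proof (rule orthogonal_domain)
      fix w assume w: "w \<in> D"
      have "inner (T (F t w)) v = 0" using orth[of "F t w" t v] w v by (simp add: FD F_idem)
      then show "inner w (F t (T v)) = 0"
        using T_sym[OF FD[OF w] v(1), of t] by (simp add: F_lin(2)[symmetric])
    qed
    moreover have "T x = T u + T v" unfolding u_def v_def by (simp add: T_diff FD x)
    ultimately show ?thesis unfolding u_def[symmetric] by (simp add: F_lin)
  qed
  show ?thesis
  proof
    show "inner (T x) x \<le> t * (norm x)\<^sup>2" if x: "x \<in> D" "F t x = x" for x t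
    proof -
      have "inner (T x) x = (\<integral>s. indicator {..t} s * s \<partial>spec x)"
        using form[OF x(1)] integrable_spec_F(2)[of "\<lambda>s. s" t x] x(2) by simp
      also have "\<dots> \<le> (\<integral>s. t * indicator {..t} s \<partial>spec x)"
        by (intro integral_mono int2 int3 x) (auto split: split_indicator)
      also have "\<dots> = t * (norm x)\<^sup>2" by (simp add: cdf_spec x)
      finally show ?thesis .
    qed
    show "t * (norm x)\<^sup>2 \<le> inner (T x) x" if x: "x \<in> D" "F t x = 0" for x t
    proof -
      interpret M: finite_borel_measure "spec x" by (rule finite_borel_measure_spec)
      have "{t<..} = space (spec x) - {..t}" by auto
      then have m: "measure (spec x) {t<..} = (norm x)\<^sup>2"
        using M.finite_measure_compl[of "{..t}"] by (simp add: measure_spec_UNIV cdf_spec x)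
      have "t * (norm x)\<^sup>2 = (\<integral>s. t * indicator {t<..} s \<partial>spec x)" by (simp add: m)
      also have "\<dots> \<le> (\<integral>s. indicator {t<..} s * s \<partial>spec x)"
        by (intro integral_mono int2 int3 x) (auto split: split_indicator)
      also have "\<dots> = inner (T x) x"
        using form[OF x(1)] integrable_spec_F(3)[of "\<lambda>s. s" x t] x(2) by simp
      finally show ?thesis .
    qed
  qed (simp_all add: FD FT)
qed

end

text \<open>An equidistant partition into N + 1 pieces bounds the total change by K (b - a) (m b - m
  a) / (N + 1). In the application m is the distribution function of a measure and may jump.\<close>

lemma small_increments_imp_eq:
  fixes \<Delta> m :: "real \<Rightarrow> real"
  assumes ab: "a \<le> b" and K: "0 \<le> K"
    and small: "\<And>\<alpha> \<beta>. a \<le> \<alpha> \<Longrightarrow> \<alpha> \<le> \<beta> \<Longrightarrow> \<beta> \<le> b \<Longrightarrow> \<bar>\<Delta> \<beta> - \<Delta> \<alpha>\<bar> \<le> K * (\<beta> - \<alpha>) * (m \<beta> - m \<alpha>)"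
  shows "\<Delta> b = \<Delta> a"
proof -
  have est: "\<bar>\<Delta> b - \<Delta> a\<bar> \<le> K * (b - a) * (m b - m a) / real (Suc N)" for N
  proof -
    define p where "p = (\<lambda>i. a + real i * ((b - a) / real (Suc N)))"
    have p: "p 0 = a" "p (Suc N) = b" "p (Suc i) - p i = (b - a) / real (Suc N)" for i
      unfolding p_def by (simp_all add: field_simps del: of_nat_Suc) (simp add: field_simps)
    have pmono: "p i \<le> p (Suc i)" for i using p(3)[of i] ab by (metis diff_ge_0_iff_ge divide_nonneg_nonneg of_nat_0_le_iff)
    have pmono': "i \<le> j \<Longrightarrow> p i \<le> p j" for i j using pmono lift_Suc_mono_le by blast
    have "\<Delta> b - \<Delta> a = (\<Sum>i<Suc N. \<Delta> (p (Suc i)) - \<Delta> (p i))"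
      using sum_lessThan_telescope[of "\<lambda>i. \<Delta> (p i)" "Suc N"] by (simp only: p)
    also have "\<bar>\<dots>\<bar> \<le> (\<Sum>i<Suc N. \<bar>\<Delta> (p (Suc i)) - \<Delta> (p i)\<bar>)" by (rule sum_abs)
    also have "\<dots> \<le> (\<Sum>i<Suc N. K * ((b - a) / real (Suc N)) * (m (p (Suc i)) - m (p i)))"
    proof (rule sum_mono)
      fix i assume "i \<in> {..<Suc N}"
      then have "a \<le> p i" "p (Suc i) \<le> b" using pmono'[of 0 i] pmono'[of "Suc i" "Suc N"] p by auto
      then show "\<bar>\<Delta> (p (Suc i)) - \<Delta> (p i)\<bar> \<le> K * ((b - a) / real (Suc N)) * (m (p (Suc i)) - m (p i))"
        using small[of "p i" "p (Suc i)"] pmono[of i] p(3)[of i] by simp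
    qed
    also have "\<dots> = K * ((b - a) / real (Suc N)) * (m b - m a)"
      using sum_lessThan_telescope[of "\<lambda>i. m (p i)" "Suc N"] by (simp only: p flip: sum_distrib_left)
    finally show ?thesis by simp
  qed
  have "\<bar>\<Delta> b - \<Delta> a\<bar> \<le> 0"
  proof (rule LIMSEQ_le_const)
    show "(\<lambda>N. K * (b - a) * (m b - m a) / real (Suc N)) \<longlonglongrightarrow> 0"
      using LIMSEQ_Suc[OF lim_const_over_n[of "K * (b - a) * (m b - m a)"]] by simp
  qed (use est in auto)
  then show ?thesis by simp
qed

text \<open>G and the indefinite integral of g both increase by g \<alpha> times the measure of
  (\<alpha>, \<beta>], up to an error of (\<beta> - \<alpha>) times that measure. Such errors vanish
  under refinement.\<close>

lemma finite_measure_integral_Ioc: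
  fixes g G :: "real \<Rightarrow> real"
  assumes fm: "finite_borel_measure M" and ab: "a \<le> b" and K: "0 \<le> K" and L: "0 \<le> L"
    and g: "continuous_on UNIV g"
    and G: "\<And>\<alpha> \<beta>. a \<le> \<alpha> \<Longrightarrow> \<alpha> \<le> \<beta> \<Longrightarrow> \<beta> \<le> b \<Longrightarrow>
        \<bar>G \<beta> - G \<alpha> - g \<alpha> * measure M {\<alpha><..\<beta>}\<bar> \<le> K * (\<beta> - \<alpha>) * measure M {\<alpha><..\<beta>}"
    and lip: "\<And>\<alpha> s. a \<le> \<alpha> \<Longrightarrow> \<alpha> \<le> s \<Longrightarrow> s \<le> b \<Longrightarrow> \<bar>g s - g \<alpha>\<bar> \<le> L * (s - \<alpha>)"
  shows "(\<integral>s. indicator {a<..b} s * g s \<partial>M) = G b - G a"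
proof -
  interpret finite_borel_measure M by (rule fm)
  have [measurable_cong]: "sets M = sets borel" by (rule M_is_borel)
  have [measurable]: "g \<in> borel_measurable borel" using g by (rule borel_measurable_continuous_onI)
  have int: "integrable M (\<lambda>s. indicator {\<alpha><..\<beta>} s * g s)" if "a \<le> \<alpha>" "\<beta> \<le> b" for \<alpha> \<beta>
  proof (rule integrable_const_bound[of _ "\<bar>g a\<bar> + L * (b - a)"])
    have "\<bar>g s\<bar> \<le> \<bar>g a\<bar> + L * (b - a)" if "a \<le> s" "s \<le> b" for s
    proof -
      have "L * (s - a) \<le> L * (b - a)" using that L by (intro mult_left_mono) auto
      then show ?thesis using lip[of a s] that by linarith
    qed
    moreover have "0 \<le> \<bar>g a\<bar> + L * (b - a)" using ab L by simp
    ultimately show "AE s in M. norm (indicator {\<alpha><..\<beta>} s * g s) \<le> \<bar>g a\<bar> + L * (b - a)"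
      using that by (intro AE_I2) (auto split: split_indicator)
  qed simp
  define I where "I = (\<lambda>t. \<integral>s. indicator {a<..t} s * g s \<partial>M)"
  have incr: "\<bar>I \<beta> - I \<alpha> - g \<alpha> * measure M {\<alpha><..\<beta>}\<bar> \<le> L * (\<beta> - \<alpha>) * measure M {\<alpha><..\<beta>}"
    if c: "a \<le> \<alpha>" "\<alpha> \<le> \<beta>" "\<beta> \<le> b" for \<alpha> \<beta>
  proof -
    have "I \<beta> - I \<alpha> = (\<integral>s. indicator {a<..\<beta>} s * g s - indicator {a<..\<alpha>} s * g s \<partial>M)"
      unfolding I_def using c by (intro Bochner_Integration.integral_diff[symmetric] int) auto
    also have "\<dots> = (\<integral>s. indicator {\<alpha><..\<beta>} s * g s \<partial>M)"
      by (rule Bochner_Integration.integral_cong) (use c in \<open>auto split: split_indicator\<close>)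
    finally have "I \<beta> - I \<alpha> - g \<alpha> * measure M {\<alpha><..\<beta>} =
        (\<integral>s. indicator {\<alpha><..\<beta>} s * g s \<partial>M) - (\<integral>s. g \<alpha> * indicator {\<alpha><..\<beta>} s \<partial>M)"
      by simp
    also have "\<dots> = (\<integral>s. indicator {\<alpha><..\<beta>} s * g s - g \<alpha> * indicator {\<alpha><..\<beta>} s \<partial>M)"
      using c by (intro Bochner_Integration.integral_diff[symmetric] int) (auto simp: emeasure_eq_measure)
    also have "\<bar>\<dots>\<bar> \<le> (\<integral>s. L * (\<beta> - \<alpha>) * indicator {\<alpha><..\<beta>} s \<partial>M)"
    proof (rule integral_abs_bound_integral)
      show "integrable M (\<lambda>s. indicator {\<alpha><..\<beta>} s * g s - g \<alpha> * indicator {\<alpha><..\<beta>} s)"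
        using c by (intro Bochner_Integration.integrable_diff int) (auto simp: emeasure_eq_measure)
      show "integrable M (\<lambda>s. L * (\<beta> - \<alpha>) * indicator {\<alpha><..\<beta>} s)"
        by (auto simp: emeasure_eq_measure)
      fix s
      have "\<bar>g s - g \<alpha>\<bar> \<le> L * (\<beta> - \<alpha>)" if "\<alpha> < s" "s \<le> \<beta>"
        using lip[of \<alpha> s] that c mult_left_mono[of "s - \<alpha>" "\<beta> - \<alpha>" L] L by linarith
      then show "\<bar>indicator {\<alpha><..\<beta>} s * g s - g \<alpha> * indicator {\<alpha><..\<beta>} s\<bar> \<le> L * (\<beta> - \<alpha>) * indicator {\<alpha><..\<beta>} s"
        by (auto split: split_indicator)
    qed
    also have "\<dots> = L * (\<beta> - \<alpha>) * measure M {\<alpha><..\<beta>}" by simp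
    finally show ?thesis .
  qed
  have "G b - I b = G a - I a"
  proof (rule small_increments_imp_eq[where \<Delta>="\<lambda>t. G t - I t" and K="K + L" and m="\<lambda>t. measure M {..t}"])
    fix \<alpha> \<beta> assume c: "a \<le> \<alpha>" "\<alpha> \<le> \<beta>" "\<beta> \<le> b"
    have "{\<alpha><..\<beta>} = {..\<beta>} - {..\<alpha>}" by auto
    then have "measure M {\<alpha><..\<beta>} = measure M {..\<beta>} - measure M {..\<alpha>}"
      using c by (simp add: finite_measure_Diff)
    then show "\<bar>G \<beta> - I \<beta> - (G \<alpha> - I \<alpha>)\<bar> \<le> (K + L) * (\<beta> - \<alpha>) * (measure M {..\<beta>} - measure M {..\<alpha>})"
      using G[OF c] incr[OF c] by (simp add: distrib_right abs_le_iff)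
  qed (use ab K L in auto)
  then show ?thesis by (simp add: I_def)
qed

section \<open>The integral representation from the order bounds\<close>

context spectral_resolution
begin

lemma spectral_interval:
  assumes "\<alpha> \<le> \<beta>"
  shows "F \<beta> x - F \<alpha> x \<in> D"
    and "norm (T (F \<beta> x - F \<alpha> x) - ((\<alpha> + \<beta>) / 2) *\<^sub>R (F \<beta> x - F \<alpha> x)) \<le> (\<beta> - \<alpha>) / 2 * norm (F \<beta> x - F \<alpha> x)"
proof -
  define P where "P = (\<lambda>x. F \<beta> x - F \<alpha> x)"
  have PP: "P (P x) = P x" for x
    unfolding P_def using assms by (simp add: F_lin F_F min_absorb1 min_absorb2)
  have P: "symmetric_op P" unfolding P_def by (intro symmetric_op_diff F_symmetric)
  have b: "\<alpha> * (norm x)\<^sup>2 \<le> inner (T x) x \<and> inner (T x) x \<le> \<beta> * (norm x)\<^sup>2" if x: "x \<in> D" "P x = x" for x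
  proof -
    have "F \<beta> (P x) = P x" "F \<alpha> (P x) = 0"
      unfolding P_def using assms by (simp_all add: F_lin F_F min_absorb1 min_absorb2)
    then show ?thesis using x F_upper F_lower by simp
  qed
  have PD: "P x \<in> D" "T (P x) = P (T x)" if "x \<in> D" for x
    unfolding P_def using that F_dom subD by (auto simp: T_diff F_T subspace_diff)
  have "P x \<in> D" by (rule reducing_projection(1)[of P \<alpha> \<beta>, OF P PP]) (use PD b in auto)
  then show "F \<beta> x - F \<alpha> x \<in> D" unfolding P_def .
  have "norm (T (P x) - ((\<alpha> + \<beta>) / 2) *\<^sub>R P x) \<le> (\<beta> - \<alpha>) / 2 * norm (P x)"
    by (rule reducing_projection(2)[of P \<alpha> \<beta> "P x", OF P PP]) (use PD b PP in auto)
  then show "norm (T (F \<beta> x - F \<alpha> x) - ((\<alpha> + \<beta>) / 2) *\<^sub>R (F \<beta> x - F \<alpha> x)) \<le> (\<beta> - \<alpha>) / 2 * norm (F \<beta> x - F \<alpha> x)"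
    unfolding P_def .
qed

lemma spectral_interval_shift:
  assumes "\<alpha> \<le> t" "t \<le> \<beta>"
  shows "norm (T (F \<beta> x - F \<alpha> x) - t *\<^sub>R (F \<beta> x - F \<alpha> x)) \<le> (\<beta> - \<alpha>) * norm (F \<beta> x - F \<alpha> x)"
proof -
  define u where "u = F \<beta> x - F \<alpha> x"
  have "T u - t *\<^sub>R u = (T u - ((\<alpha> + \<beta>) / 2) *\<^sub>R u) + ((\<alpha> + \<beta>) / 2 - t) *\<^sub>R u"
    by (simp add: algebra_simps)
  then have "norm (T u - t *\<^sub>R u) \<le> norm (T u - ((\<alpha> + \<beta>) / 2) *\<^sub>R u) + norm (((\<alpha> + \<beta>) / 2 - t) *\<^sub>R u)"
    by (metis norm_triangle_ineq)
  also have "\<dots> \<le> (\<beta> - \<alpha>) / 2 * norm u + (\<beta> - \<alpha>) / 2 * norm u"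
    using spectral_interval(2)[of \<alpha> \<beta> x] assms unfolding u_def[symmetric] norm_scaleR
    by (intro add_mono mult_right_mono) (auto simp: abs_le_iff field_simps)
  finally show ?thesis unfolding u_def by simp
qed

lemma F_T_diff:
  assumes "\<alpha> \<le> \<beta>"
  shows "F t (T (F \<beta> x - F \<alpha> x)) = T (F t (F \<beta> x - F \<alpha> x))"
  by (rule F_T[OF spectral_interval(1)[OF assms], symmetric])

text \<open>On the range of F \<beta> - F \<alpha> the operator T is within \<beta> - \<alpha> of
  the scalar \<alpha>, which is the increment estimate needed to recognise both sides as the same
  indefinite integral.\<close>

lemma
  assumes ab: "a \<le> b"
  shows integral_spec_ident: "(\<integral>s. indicator {a<..b} s * s \<partial>spec x) = inner (T (F b x - F a x)) x"
    and integral_spec_square: "(\<integral>s. indicator {a<..b} s * s\<^sup>2 \<partial>spec x) = (norm (T (F b x - F a x)))\<^sup>2"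
proof -
  have split: "F \<beta> x - F a x = (F \<beta> x - F \<alpha> x) + (F \<alpha> x - F a x)" for \<alpha> \<beta> by simp
  have T_split: "T (F \<beta> x - F a x) = T (F \<beta> x - F \<alpha> x) + T (F \<alpha> x - F a x)"
    if "a \<le> \<alpha>" "\<alpha> \<le> \<beta>" for \<alpha> \<beta>
    unfolding split[of \<beta> \<alpha>] using that by (intro T_add spectral_interval)
  show "(\<integral>s. indicator {a<..b} s * s \<partial>spec x) = inner (T (F b x - F a x)) x"
  proof -
    have "(\<integral>s. indicator {a<..b} s * s \<partial>spec x) = inner (T (F b x - F a x)) x - inner (T (F a x - F a x)) x"
    proof (rule finite_measure_integral_Ioc[OF finite_borel_measure_spec ab, of 1 1 _ "\<lambda>t. inner (T (F t x - F a x)) x"])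
      fix \<alpha> \<beta> assume c: "a \<le> \<alpha>" "\<alpha> \<le> \<beta>" "\<beta> \<le> b"
      define u where "u = F \<beta> x - F \<alpha> x"
      have "F \<beta> u = u" "F \<alpha> u = 0" unfolding u_def using c by (simp_all add: F_lin F_F min_absorb1 min_absorb2)
      then have "T u = F \<beta> (T u)" "F \<alpha> (T u) = 0"
        using F_T_diff[OF c(2), of _ x, folded u_def] by (simp_all add: T_0)
      \<comment> \<open>T u lies in the range of F \<beta> and in the kernel of F \<alpha>, so x may
        be replaced by u in the second slot.\<close>
      then have "inner (T u) x = inner (T u) (F \<beta> x) - inner (T u) (F \<alpha> x)"
        by (metis F_lin(2) diff_zero inner_zero_left)
      then have "inner (T u) x = inner (T u) u" unfolding u_def by (simp add: inner_simps)
      moreover have "inner (T (F \<beta> x - F a x)) x - inner (T (F \<alpha> x - F a x)) x = inner (T u) x"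
        using T_split[OF c(1,2)] by (simp add: u_def inner_simps)
      moreover have "\<bar>inner (T u) u - \<alpha> * (norm u)\<^sup>2\<bar> \<le> (\<beta> - \<alpha>) * (norm u)\<^sup>2"
      proof -
        have "inner (T u) u - \<alpha> * (norm u)\<^sup>2 = inner (T u - \<alpha> *\<^sub>R u) u"
          by (simp add: inner_simps power2_norm_eq_inner)
        also have "\<bar>\<dots>\<bar> \<le> norm (T u - \<alpha> *\<^sub>R u) * norm u" by (rule Cauchy_Schwarz_ineq2)
        also have "\<dots> \<le> ((\<beta> - \<alpha>) * norm u) * norm u"
          using spectral_interval_shift[of \<alpha> \<alpha> \<beta> x] c unfolding u_def by (intro mult_right_mono) auto
        finally show ?thesis by (simp add: power2_eq_square)
      qed
      ultimately show "\<bar>inner (T (F \<beta> x - F a x)) x - inner (T (F \<alpha> x - F a x)) x - \<alpha> * measure (spec x) {\<alpha><..\<beta>}\<bar>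
          \<le> 1 * (\<beta> - \<alpha>) * measure (spec x) {\<alpha><..\<beta>}"
        unfolding measure_spec_Ioc[OF c(2)] u_def[symmetric] by simp
    qed (auto intro: continuous_intros)
    then show ?thesis by (simp add: T_0)
  qed
  show "(\<integral>s. indicator {a<..b} s * s\<^sup>2 \<partial>spec x) = (norm (T (F b x - F a x)))\<^sup>2"
  proof -
    \<comment> \<open>Bounds |\<alpha>| on the interval and makes \<beta> - \<alpha> at most 2 M.
      Then |T u| + |\<alpha>| |u| \<le> (\<beta> - \<alpha> + 2 |\<alpha>|) |u| \<le> 4 M |u|,
      whence the constant 4 M.\<close>
    define M where "M = \<bar>a\<bar> + \<bar>b\<bar>"
    have "(\<integral>s. indicator {a<..b} s * s\<^sup>2 \<partial>spec x) = (norm (T (F b x - F a x)))\<^sup>2 - (norm (T (F a x - F a x)))\<^sup>2"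
    proof (rule finite_measure_integral_Ioc[OF finite_borel_measure_spec ab, of "4 * M" "2 * M" _ "\<lambda>t. (norm (T (F t x - F a x)))\<^sup>2"])
      fix \<alpha> \<beta> assume c: "a \<le> \<alpha>" "\<alpha> \<le> \<beta>" "\<beta> \<le> b"
      define u v where "u = F \<beta> x - F \<alpha> x" and "v = F \<alpha> x - F a x"
      have uv: "F \<alpha> u = 0" "F \<alpha> v = v"
        unfolding u_def v_def using c by (simp_all add: F_lin F_F min_absorb1 min_absorb2)
      then have "F \<alpha> (T u) = 0" "F \<alpha> (T v) = T v"
        using F_T_diff[OF c(2), of \<alpha> x, folded u_def] F_T_diff[OF c(1), of \<alpha> x, folded v_def]
        by (simp_all add: T_0)
      then have "inner (T u) (T v) = 0" by (metis F_lin(2) inner_zero_left)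
      then have "(norm (T (F \<beta> x - F a x)))\<^sup>2 - (norm (T (F \<alpha> x - F a x)))\<^sup>2 = (norm (T u))\<^sup>2"
        unfolding T_split[OF c(1,2)] u_def[symmetric] v_def[symmetric]
        by (simp add: power2_norm_eq_inner inner_simps inner_commute)
      moreover have "\<bar>(norm (T u))\<^sup>2 - \<alpha>\<^sup>2 * (norm u)\<^sup>2\<bar> \<le> 4 * M * (\<beta> - \<alpha>) * (norm u)\<^sup>2"
      proof -
        have d: "norm (T u - \<alpha> *\<^sub>R u) \<le> (\<beta> - \<alpha>) * norm u"
          using spectral_interval_shift[of \<alpha> \<alpha> \<beta> x] c unfolding u_def by simp
        have al: "\<bar>\<alpha>\<bar> \<le> M" "\<beta> - \<alpha> \<le> 2 * M" unfolding M_def using c by auto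
        have d': "\<bar>norm (T u) - \<bar>\<alpha>\<bar> * norm u\<bar> \<le> (\<beta> - \<alpha>) * norm u"
          using d norm_triangle_ineq3[of "T u" "\<alpha> *\<^sub>R u"] by simp
        have "norm (T u) + \<bar>\<alpha>\<bar> * norm u \<le> ((\<beta> - \<alpha>) + 2 * \<bar>\<alpha>\<bar>) * norm u"
          using d' by (simp add: algebra_simps abs_le_iff)
        also have "\<dots> \<le> (4 * M) * norm u" using al by (intro mult_right_mono) auto
        finally have s: "norm (T u) + \<bar>\<alpha>\<bar> * norm u \<le> (4 * M) * norm u" .
        have "(norm (T u))\<^sup>2 - \<alpha>\<^sup>2 * (norm u)\<^sup>2 = (norm (T u) - \<bar>\<alpha>\<bar> * norm u) * (norm (T u) + \<bar>\<alpha>\<bar> * norm u)"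
          by (simp add: power2_eq_square algebra_simps)
        then have "\<bar>(norm (T u))\<^sup>2 - \<alpha>\<^sup>2 * (norm u)\<^sup>2\<bar> =
            \<bar>norm (T u) - \<bar>\<alpha>\<bar> * norm u\<bar> * (norm (T u) + \<bar>\<alpha>\<bar> * norm u)"
          by (simp add: abs_mult)
        also have "\<dots> \<le> ((\<beta> - \<alpha>) * norm u) * ((4 * M) * norm u)"
          using c by (intro mult_mono d' s) auto
        finally show ?thesis by (simp add: power2_eq_square mult_ac)
      qed
      ultimately show "\<bar>(norm (T (F \<beta> x - F a x)))\<^sup>2 - (norm (T (F \<alpha> x - F a x)))\<^sup>2 - \<alpha>\<^sup>2 * measure (spec x) {\<alpha><..\<beta>}\<bar>
          \<le> 4 * M * (\<beta> - \<alpha>) * measure (spec x) {\<alpha><..\<beta>}"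
        unfolding measure_spec_Ioc[OF c(2)] u_def[symmetric] by simp
    next
      fix \<alpha> s assume c: "a \<le> \<alpha>" "\<alpha> \<le> s" "s \<le> b"
      have "s\<^sup>2 - \<alpha>\<^sup>2 = (s + \<alpha>) * (s - \<alpha>)" by (simp add: power2_eq_square algebra_simps)
      then have "\<bar>s\<^sup>2 - \<alpha>\<^sup>2\<bar> = \<bar>s + \<alpha>\<bar> * (s - \<alpha>)" using c by (simp add: abs_mult)
      also have "\<dots> \<le> 2 * M * (s - \<alpha>)" using c unfolding M_def by (intro mult_right_mono) auto
      finally show "\<bar>s\<^sup>2 - \<alpha>\<^sup>2\<bar> \<le> 2 * M * (s - \<alpha>)" .
    qed (auto intro: continuous_intros simp: M_def)
    then show ?thesis by (simp add: T_0)
  qed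
qed

lemma symmetric_interval_tendsto: "(\<lambda>n. F (real n) x - F (- real n) x) \<longlonglongrightarrow> x"
proof -
  have "(\<lambda>n. F (real n) x) \<longlonglongrightarrow> x"
    by (rule filterlim_compose[OF F_top filterlim_real_sequentially])
  moreover have "(\<lambda>n. F (- real n) x) \<longlonglongrightarrow> 0"
    by (rule filterlim_compose[OF F_bot filterlim_compose[OF filterlim_uminus_at_bot_at_top filterlim_real_sequentially]])
  ultimately show ?thesis using tendsto_diff by fastforce
qed

lemma indicator_tendsto: "(\<lambda>n. indicator {- real n<..real n} s * g s) \<longlonglongrightarrow> (g s :: real)"
proof (rule tendsto_eventually)
  show "\<forall>\<^sub>F n in sequentially. indicator {- real n<..real n} s * g s = g s"
    using eventually_gt_at_top[of "nat \<lceil>\<bar>s\<bar>\<rceil>"]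
  proof eventually_elim
    case (elim n)
    then have "\<bar>s\<bar> < real n" by linarith
    then show ?case by (simp add: indicator_def abs_less_iff)
  qed
qed

text \<open>On (-n, n] the second moment is the squared norm of the truncation of T x, which tends
  to |T x|^2; monotone and dominated convergence do the rest.\<close>

lemma spec_square_integrable:
  assumes x: "x \<in> D"
  shows "integrable (spec x) (\<lambda>t. t\<^sup>2)" "inner (T x) x = (\<integral>t. t \<partial>spec x)"
proof -
  have TP: "T (F b x - F a x) = F b (T x) - F a (T x)" for a b
    by (simp add: T_diff F_dom x F_T)
  have int: "integrable (spec x) (\<lambda>s. indicator {- real n<..real n} s * s\<^sup>2)" for n
    by (rule integrable_spec_bounded[of _ "(real n)\<^sup>2"])
      (auto split: split_indicator simp: abs_le_square_iff[symmetric])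
  show int2: "integrable (spec x) (\<lambda>t. t\<^sup>2)"
  proof (rule integrable_monotone_convergence[OF int])
    show "AE s in spec x. mono (\<lambda>n. indicator {- real n<..real n} s * s\<^sup>2)"
      by (intro AE_I2 monoI) (auto split: split_indicator)
    show "AE s in spec x. (\<lambda>n. indicator {- real n<..real n} s * s\<^sup>2) \<longlonglongrightarrow> s\<^sup>2"
      using indicator_tendsto[of _ "\<lambda>s. s\<^sup>2"] by simp
    show "(\<lambda>n. \<integral>s. indicator {- real n<..real n} s * s\<^sup>2 \<partial>spec x) \<longlonglongrightarrow> (norm (T x))\<^sup>2"
      using tendsto_power[OF tendsto_norm[OF symmetric_interval_tendsto[of "T x"]], of 2]
      by (simp add: integral_spec_square TP)
  qed simp
  have "(\<lambda>n. \<integral>s. indicator {- real n<..real n} s * s \<partial>spec x) \<longlonglongrightarrow> (\<integral>t. t \<partial>spec x)"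
  proof (rule integral_dominated_convergence)
    show "integrable (spec x) (\<lambda>s. \<bar>s\<bar>)" using integrable_spec_ident[OF int2] by (rule integrable_abs)
    show "AE s in spec x. (\<lambda>n. indicator {- real n<..real n} s * s) \<longlonglongrightarrow> s"
      using indicator_tendsto[of _ "\<lambda>s. s"] by simp
  qed (auto split: split_indicator)
  moreover have "(\<lambda>n. \<integral>s. indicator {- real n<..real n} s * s \<partial>spec x) \<longlonglongrightarrow> inner (T x) x"
    using tendsto_inner[OF symmetric_interval_tendsto[of "T x"] tendsto_const[of x]]
    by (simp add: integral_spec_ident TP)
  ultimately show "inner (T x) x = (\<integral>t. t \<partial>spec x)" by (rule LIMSEQ_unique[symmetric])
qed

text \<open>The squared norms of T (u n) are the truncated second moments and converge, so T (u n)
  itself converges. Closedness of T puts the limit x of u n into D.\<close>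

lemma square_integrable_in_domain:
  assumes int: "integrable (spec x) (\<lambda>t. t\<^sup>2)"
  shows "x \<in> D"
proof -
  define u where "u = (\<lambda>n. F (real n) x - F (- real n) x)"
  have uD: "u n \<in> D" for n unfolding u_def by (rule spectral_interval) simp
  have "convergent (\<lambda>n. T (u n))"
  proof (rule norm_increment_convergent)
    fix m n :: nat assume mn: "m \<le> n"
    define P where "P = (\<lambda>y. F (real m) y - F (- real m) y)"
    have "P (u n) = u m" unfolding P_def u_def using mn
      by (simp add: F_lin F_F min_absorb1 min_absorb2)
    then have "T (u m) = P (T (u n))" unfolding P_def by (metis F_T F_dom T_diff uD)
    moreover have "P (P y) = P y" for y
      unfolding P_def by (simp add: F_lin F_F min_absorb1 min_absorb2)
    moreover have "symmetric_op P" unfolding P_def by (intro symmetric_op_diff F_symmetric)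
    ultimately have "(norm (T (u m)))\<^sup>2 = inner (T (u m)) (T (u n))"
      using symmetric_idempotent_norm_le(1) by metis
    then have "(norm (T (u m) - T (u n)))\<^sup>2 = (norm (T (u n)))\<^sup>2 - (norm (T (u m)))\<^sup>2"
      by (simp add: power2_norm_eq_inner inner_simps inner_commute)
    then show "(norm (T (u m) - T (u n)))\<^sup>2 \<le> \<bar>(norm (T (u m)))\<^sup>2 - (norm (T (u n)))\<^sup>2\<bar>" by simp
  next
    have "(\<lambda>n. \<integral>s. indicator {- real n<..real n} s * s\<^sup>2 \<partial>spec x) \<longlonglongrightarrow> (\<integral>t. t\<^sup>2 \<partial>spec x)"
    proof (rule integral_dominated_convergence[OF _ _ int])
      show "AE s in spec x. (\<lambda>n. indicator {- real n<..real n} s * s\<^sup>2) \<longlonglongrightarrow> s\<^sup>2"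
        using indicator_tendsto[of _ "\<lambda>s. s\<^sup>2"] by simp
    qed (auto split: split_indicator)
    then show "convergent (\<lambda>n. (norm (T (u n)))\<^sup>2)"
      unfolding u_def by (simp add: integral_spec_square convergentI)
  qed
  then obtain y where y: "(\<lambda>n. T (u n)) \<longlonglongrightarrow> y" by (auto simp: convergent_def)
  from T_closed[OF uD _ y] show ?thesis using symmetric_interval_tendsto[of x] unfolding u_def by blast
qed

end

section \<open>Complex structure and spectral projections\<close>

lemma cinner_add_right: "cinner (x::'h::complex_hilbert_space) (y + z) = cinner x y + cinner x z"
  by (metis cinner_add_left cinner_commute complex_cnj_add)

lemma cinner_scaleC_right: "cinner (x::'h::complex_hilbert_space) (c *\<^sub>C y) = cnj c * cinner x y"
  by (metis cinner_commute cinner_scaleC_left complex_cnj_mult)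

lemma inner_ii_right: "inner (x::'h::complex_hilbert_space) (\<i> *\<^sub>C y) = Im (cinner x y)"
  by (simp add: inner_cinner cinner_scaleC_right)

text \<open>The real scalar product and multiplication by i encode the complex one, so complex
  statements become real ones together with commutation with i.\<close>

lemma cinner_eq_Complex: "cinner (x::'h::complex_hilbert_space) y = Complex (inner x y) (inner x (\<i> *\<^sub>C y))"
  by (simp add: inner_ii_right) (simp add: inner_cinner complex_eq_iff)

lemma inner_ii_ii: "inner (\<i> *\<^sub>C x) (\<i> *\<^sub>C y) = inner (x::'h::complex_hilbert_space) y"
  by (simp add: inner_cinner cinner_scaleC_right cinner_scaleC_left)

lemma ii_ii: "\<i> *\<^sub>C \<i> *\<^sub>C x = - (x::'h::complex_hilbert_space)"
  using scaleR_scaleC[of "-1" x] by (simp add: scaleC_scaleC)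

lemma scaleC_conv_ii: "c *\<^sub>C x = Re c *\<^sub>R x + Im c *\<^sub>R \<i> *\<^sub>C (x::'h::complex_hilbert_space)"
proof -
  have "c = complex_of_real (Re c) + complex_of_real (Im c) * \<i>" by (simp add: complex_eq_iff)
  then show ?thesis by (metis scaleC_add_left scaleC_scaleC scaleR_scaleC)
qed

lemma bounded_linear_ii: "bounded_linear (\<lambda>x::'h::complex_hilbert_space. \<i> *\<^sub>C x)"
proof (rule bounded_linear_intro[where K=1])
  show "\<i> *\<^sub>C r *\<^sub>R x = r *\<^sub>R \<i> *\<^sub>C x" for r and x :: 'h
    by (simp add: scaleR_scaleC scaleC_scaleC mult.commute)
  show "norm (\<i> *\<^sub>C x) \<le> norm x * 1" for x :: 'h
    using inner_ii_ii[of x x] by (simp add: norm_eq_sqrt_inner)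
qed (rule scaleC_add_right)

lemmas ii_simps = linear_simps[OF bounded_linear_ii]

lemma inner_ii_left: "inner (\<i> *\<^sub>C x) y = - inner (x::'h::complex_hilbert_space) (\<i> *\<^sub>C y)"
  using inner_ii_ii[of x "\<i> *\<^sub>C y"] by (simp add: ii_ii)

lemma bounded_clinear_iff:
  "bounded_clinear P \<longleftrightarrow> bounded_linear P \<and> (\<forall>x. P (\<i> *\<^sub>C x) = \<i> *\<^sub>C P x)"
proof
  assume *: "bounded_linear P \<and> (\<forall>x. P (\<i> *\<^sub>C x) = \<i> *\<^sub>C P x)"
  have "P (c *\<^sub>C x) = c *\<^sub>C P x" for c x
    using * scaleC_conv_ii[of c x] scaleC_conv_ii[of c "P x"] by (simp add: linear_simps)
  with * show "bounded_clinear P" by (simp add: bounded_clinear_def)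
qed (simp add: bounded_clinear_def)

lemma orthogonal_projection_iff:
  "orthogonal_projection P \<longleftrightarrow> symmetric_op P \<and> (\<forall>x. P (P x) = P x) \<and> (\<forall>x. P (\<i> *\<^sub>C x) = \<i> *\<^sub>C P x)"
proof -
  have "(\<forall>x y. cinner (P x) y = cinner x (P y)) \<longleftrightarrow> (\<forall>x y. inner (P x) y = inner x (P y))"
    if "\<forall>x. P (\<i> *\<^sub>C x) = \<i> *\<^sub>C P x"
    unfolding cinner_eq_Complex using that by (metis complex.inject)
  then show ?thesis
    unfolding orthogonal_projection_def bounded_clinear_iff symmetric_op_def
    by (auto simp: fun_eq_iff)
qed

lemma csubspace_imp_subspace: "csubspace S \<Longrightarrow> subspace S"
  unfolding csubspace_def subspace_def by (simp add: scaleR_scaleC)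

text \<open>Density makes the adjoint vector unique, so the \<open>THE\<close> in
  \<open>adjoint_operator\<close> denotes it. For maximality, the real adjoint relation is tested at
  x and at i x, which recovers the complex relation.\<close>

lemma
  fixes T :: "'h::complex_hilbert_space operator"
  assumes T: "selfadjoint T"
  shows selfadjoint_imp_sa_operator: "sa_operator (op_dom T) (op_fun T)"
    and selfadjoint_ii: "x \<in> op_dom T \<Longrightarrow> \<i> *\<^sub>C x \<in> op_dom T \<and> op_fun T (\<i> *\<^sub>C x) = \<i> *\<^sub>C op_fun T x"
proof -
  have lin: "linear_operator T" and dense: "closure (op_dom T) = UNIV"
    and adj: "op_graph (adjoint_operator T) = op_graph T"
    using T by (auto simp: selfadjoint_def)
  show ii: "\<i> *\<^sub>C x \<in> op_dom T \<and> op_fun T (\<i> *\<^sub>C x) = \<i> *\<^sub>C op_fun T x" if "x \<in> op_dom T" for x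
    using lin that unfolding linear_operator_def csubspace_def by blast
  have sub: "subspace (op_dom T)"
    using lin unfolding linear_operator_def by (blast intro: csubspace_imp_subspace)
  have uniq: "z = z'" if "\<And>x. x \<in> op_dom T \<Longrightarrow> cinner x z = cinner x z'" for z z'
  proof -
    have "inner x (z - z') = 0" if "x \<in> op_dom T" for x
      using \<open>\<And>x. x \<in> op_dom T \<Longrightarrow> cinner x z = cinner x z'\<close>[OF that]
      by (simp add: inner_simps) (simp add: inner_cinner)
    then have "op_dom T \<subseteq> {x. inner x (z - z') = 0}" by blast
    then have "closure (op_dom T) \<subseteq> {x. inner x (z - z') = 0}"
      by (rule closure_minimal) (intro closed_Collect_eq continuous_intros)
    then have "inner (z - z') (z - z') = 0" using dense by blast
    then show ?thesis by simp
  qed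
  have the: "(THE z. \<forall>x\<in>op_dom T. cinner (op_fun T x) y = cinner x z) = z"
    if "\<And>x. x \<in> op_dom T \<Longrightarrow> cinner (op_fun T x) y = cinner x z" for y z
  proof (rule the_equality)
    show "\<forall>x\<in>op_dom T. cinner (op_fun T x) y = cinner x z" using that by blast
    show "z' = z" if "\<forall>x\<in>op_dom T. cinner (op_fun T x) y = cinner x z'" for z'
      using that \<open>\<And>x. x \<in> op_dom T \<Longrightarrow> cinner (op_fun T x) y = cinner x z\<close> by (intro uniq) simp
  qed
  have graph_iff: "(y, z) \<in> op_graph T \<longleftrightarrow> (\<forall>x\<in>op_dom T. cinner (op_fun T x) y = cinner x z)" for y z
  proof
    assume "(y, z) \<in> op_graph T"
    then obtain z' where *: "\<forall>x\<in>op_dom T. cinner (op_fun T x) y = cinner x z'"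
      and "z = (THE z. \<forall>x\<in>op_dom T. cinner (op_fun T x) y = cinner x z)"
      unfolding adj[symmetric] by (auto simp: op_graph_def adjoint_operator_def)
    then have "z = z'" using the[of y z'] by simp
    then show "\<forall>x\<in>op_dom T. cinner (op_fun T x) y = cinner x z" using * by simp
  next
    assume "\<forall>x\<in>op_dom T. cinner (op_fun T x) y = cinner x z"
    then show "(y, z) \<in> op_graph T"
      unfolding adj[symmetric] using the[of y z] by (auto simp: op_graph_def adjoint_operator_def)
  qed
  show "sa_operator (op_dom T) (op_fun T)"
  proof
    show "subspace (op_dom T)" by (rule sub)
    show "op_fun T (x + y) = op_fun T x + op_fun T y" if "x \<in> op_dom T" "y \<in> op_dom T" for x y
      using lin that unfolding linear_operator_def by blast
    show "op_fun T (r *\<^sub>R x) = r *\<^sub>R op_fun T x" if "x \<in> op_dom T" for r x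
      using lin that unfolding linear_operator_def scaleR_scaleC by blast
    show "inner (op_fun T x) y = inner x (op_fun T y)" if "x \<in> op_dom T" "y \<in> op_dom T" for x y
    proof -
      have "(y, op_fun T y) \<in> op_graph T" using that by (auto simp: op_graph_def)
      then show ?thesis using that unfolding graph_iff inner_cinner by simp
    qed
    show "y \<in> op_dom T \<and> op_fun T y = z"
      if *: "\<And>x. x \<in> op_dom T \<Longrightarrow> inner (op_fun T x) y = inner x z" for y z
    proof -
      have "cinner (op_fun T x) y = cinner x z" if x: "x \<in> op_dom T" for x
        using *[OF x] *[of "\<i> *\<^sub>C x"] ii[OF x] unfolding cinner_eq_Complex by (simp add: inner_ii_left)
      then have "(y, z) \<in> op_graph T" unfolding graph_iff by blast
      then show ?thesis by (auto simp: op_graph_def)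
    qed
  qed
qed

lemma op_graph_conv_graph:
  assumes "selfadjoint T" shows "op_graph T = sa_operator.graph (op_dom T) (op_fun T)"
  unfolding sa_operator.graph_def[OF selfadjoint_imp_sa_operator[OF assms]] op_graph_def by blast

lemma spectral_family_iff:
  "spectral_family F \<longleftrightarrow> resolution_of_identity F \<and> (\<forall>t x. F t (\<i> *\<^sub>C x) = \<i> *\<^sub>C F t x)"
proof
  assume F: "spectral_family F"
  have sym: "symmetric_op (F t)" and idem: "F t (F t x) = F t x" for t x
    using F unfolding spectral_family_def orthogonal_projection_iff by auto
  have mono: "F t (F s x) = F s x" if "s \<le> t" for s t x
  proof -
    have "F s x \<in> range (F t)" using F that unfolding spectral_family_def by blast
    then show ?thesis using idem by auto
  qed
  have mono': "F s (F t x) = F s x" if "s \<le> t" for s t x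
  proof -
    have "inner (F s (F t x) - F s x) y = 0" for y
      using mono[OF that, of y] by (simp add: inner_diff_left symmetric_opD(2)[OF sym])
    then show ?thesis by (metis inner_eq_zero_iff eq_iff_diff_eq_0)
  qed
  have "resolution_of_identity F"
  proof
    show "F s (F t x) = F (min s t) x" for s t x
      using mono[of t s x] mono'[of s t x] by (cases "s \<le> t") (auto simp: min_def)
  qed (use F sym in \<open>auto simp: spectral_family_def\<close>)
  then show "resolution_of_identity F \<and> (\<forall>t x. F t (\<i> *\<^sub>C x) = \<i> *\<^sub>C F t x)"
    using F unfolding spectral_family_def orthogonal_projection_iff by auto
next
  assume *: "resolution_of_identity F \<and> (\<forall>t x. F t (\<i> *\<^sub>C x) = \<i> *\<^sub>C F t x)"
  then interpret resolution_of_identity F by simp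
  have "range (F s) \<subseteq> range (F t)" if "s \<le> t" for s t
    using F_F[of t s] that by (metis image_subsetI min_absorb2 rangeI)
  then show "spectral_family F"
    unfolding spectral_family_def orthogonal_projection_iff
    using * F_symmetric F_idem F_right F_bot F_top by blast
qed

text \<open>The bridge between integrals and order bounds. Left to right it gives access to the
  family chosen by \<open>SOME\<close>; right to left it turns the constructed family into a
  witness.\<close>

lemma is_spectral_family_of_iff:
  assumes T: "selfadjoint T"
  shows "is_spectral_family_of T F \<longleftrightarrow>
    spectral_resolution (op_dom T) (op_fun T) F \<and> (\<forall>t x. F t (\<i> *\<^sub>C x) = \<i> *\<^sub>C F t x)"
proof -
  interpret sa_operator "op_dom T" "op_fun T" by (rule selfadjoint_imp_sa_operator[OF T])
  have real: "cinner (op_fun T x) x = complex_of_real (inner (op_fun T x) x)" if "x \<in> op_dom T" for x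
  proof -
    have "inner (op_fun T x) (\<i> *\<^sub>C x) = 0"
      using T_sym[of x "\<i> *\<^sub>C x"] selfadjoint_ii[OF T that] that inner_ii_left[of x "op_fun T x"]
      by (simp add: inner_commute)
    then show ?thesis unfolding cinner_eq_Complex by (simp add: complex_eq_iff)
  qed
  show ?thesis
  proof
    assume *: "is_spectral_family_of T F"
    then have F: "resolution_of_identity F" "\<forall>t x. F t (\<i> *\<^sub>C x) = \<i> *\<^sub>C F t x"
      by (auto simp: is_spectral_family_of_def spectral_family_iff)
    interpret F: resolution_of_identity F by (rule F(1))
    have sp: "spectral_measure_at F = F.spec" by (simp add: fun_eq_iff spectral_measure_at_def F.spec_def)
    have "spectral_resolution (op_dom T) (op_fun T) F"
    proof (rule F.spectral_resolutionI)
      show "sa_operator (op_dom T) (op_fun T)" by unfold_locales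
      show "op_dom T = {x. integrable (F.spec x) power2}"
        using * unfolding is_spectral_family_of_def sp by blast
      fix x assume "x \<in> op_dom T"
      then have "cinner (op_fun T x) x = complex_of_real (\<integral>t. t \<partial>F.spec x)"
        using * unfolding is_spectral_family_of_def sp by blast
      then show "inner (op_fun T x) x = (\<integral>t. t \<partial>F.spec x)" by (simp add: inner_cinner)
    qed
    with F(2) show "spectral_resolution (op_dom T) (op_fun T) F \<and> (\<forall>t x. F t (\<i> *\<^sub>C x) = \<i> *\<^sub>C F t x)" by blast
  next
    assume *: "spectral_resolution (op_dom T) (op_fun T) F \<and> (\<forall>t x. F t (\<i> *\<^sub>C x) = \<i> *\<^sub>C F t x)"
    then interpret F: spectral_resolution "op_dom T" "op_fun T" F by simp
    have sp: "spectral_measure_at F = F.spec" by (simp add: fun_eq_iff spectral_measure_at_def F.spec_def)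
    show "is_spectral_family_of T F"
      unfolding is_spectral_family_of_def sp spectral_family_iff
    proof (intro conjI ballI)
      show "resolution_of_identity F" by unfold_locales
      show "op_dom T = {x. integrable (F.spec x) power2}"
        using F.spec_square_integrable(1) F.square_integrable_in_domain by blast
      show "cinner (op_fun T x) x = complex_of_real (\<integral>t. t \<partial>F.spec x)" if "x \<in> op_dom T" for x
        using real[OF that] F.spec_square_integrable(2)[OF that] by simp
    qed (use * in blast)
  qed
qed

text \<open>Multiplication by i preserves the domain and commutes with T, so the constructed family
  commutes with i and is a legitimate witness for the choice.\<close>

lemma spectral_family_of:
  assumes T: "selfadjoint T"
  shows "spectral_resolution (op_dom T) (op_fun T) (spectral_family_of T)"
    and "spectral_family_of T t (\<i> *\<^sub>C x) = \<i> *\<^sub>C spectral_family_of T t x"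
proof -
  interpret sa_operator "op_dom T" "op_fun T" by (rule selfadjoint_imp_sa_operator[OF T])
  obtain F where "spectral_resolution (op_dom T) (op_fun T) F"
    and "\<forall>U. bounded_linear U \<longrightarrow> (\<forall>z\<in>op_dom T. U z \<in> op_dom T \<and> op_fun T (U z) = U (op_fun T z))
      \<longrightarrow> (\<forall>t x. U (F t x) = F t (U x))"
    using spectral_resolution_exists by blast
  then have "is_spectral_family_of T F"
    unfolding is_spectral_family_of_iff[OF T]
    using bounded_linear_ii selfadjoint_ii[OF T] by metis
  then have "is_spectral_family_of T (spectral_family_of T)"
    unfolding spectral_family_of_def by (rule someI[of "is_spectral_family_of T"])
  then show "spectral_resolution (op_dom T) (op_fun T) (spectral_family_of T)"
    "spectral_family_of T t (\<i> *\<^sub>C x) = \<i> *\<^sub>C spectral_family_of T t x"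
    unfolding is_spectral_family_of_iff[OF T] by auto
qed

section \<open>Spectral projections of closed intervals\<close>

context resolution_of_identity
begin

text \<open>The range of \<open>\<chi>\<^bsub>[a,b]\<^esub>(T)\<close>.\<close>

definition band :: "real \<Rightarrow> real \<Rightarrow> 'a set"
  where "band a b = {x. F b x = x \<and> (\<forall>s<a. F s x = 0)}"

lemma subspace_band: "subspace (band a b)"
  unfolding band_def subspace_def by (auto simp: F_lin)

lemma closed_band: "closed (band a b)"
proof -
  have "band a b = {x. F b x = x} \<inter> (\<Inter>s\<in>{..<a}. {x. F s x = 0})"
    unfolding band_def by auto
  moreover have "closed \<dots>"
    by (intro closed_Int closed_INT ballI closed_Collect_eq continuous_intros
        bounded_linear.continuous_on[OF F_lin(1)])
  ultimately show ?thesis by simp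
qed

definition band_proj :: "real \<Rightarrow> real \<Rightarrow> 'a \<Rightarrow> 'a" where "band_proj a b = orth_proj (band a b)"

lemma band_proj_symmetric: "symmetric_op (band_proj a b)"
  unfolding symmetric_op_def band_proj_def
  using bounded_linear_orth_proj[OF subspace_band closed_band] orth_proj_symmetric[OF subspace_band closed_band]
  by blast

lemma band_proj_in: "band_proj a b x \<in> band a b"
  unfolding band_proj_def by (rule orth_proj_in[OF subspace_band closed_band])

lemma band_proj_ident: "x \<in> band a b \<Longrightarrow> band_proj a b x = x"
  unfolding band_proj_def by (rule orth_proj_ident[OF subspace_band closed_band])

lemma band_proj_idem: "band_proj a b (band_proj a b x) = band_proj a b x"
  by (rule band_proj_ident[OF band_proj_in])

lemma range_band_proj: "range (band_proj a b) = band a b"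
  using band_proj_in band_proj_ident by (metis image_subset_iff rangeI subsetI subset_antisym)

text \<open>F is right-continuous, so F a already contains the eigenspace at a. To keep that
  eigenspace in the band, the lower end must be approached strictly from below, along a - 1 / (n +
  1).\<close>

lemma band_proj_tendsto:
  assumes ab: "a \<le> b"
  shows "(\<lambda>n. F b x - F (a - inverse (real (Suc n))) x) \<longlonglongrightarrow> band_proj a b x"
proof -
  define r where "r = (\<lambda>n. a - inverse (real (Suc n)))"
  have r: "r n < a" for n unfolding r_def by simp
  have rb: "r n \<le> b" for n using r[of n] ab by simp
  have r_mono: "r m \<le> r n" if "m \<le> n" for m n
    unfolding r_def using that by (intro diff_left_mono le_imp_inverse_le) simp_all
  have r_lim: "r \<longlonglongrightarrow> a"
    unfolding r_def using tendsto_diff[OF tendsto_const LIMSEQ_inverse_real_of_nat] by force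
  define y where "y = (\<lambda>n. F b x - F (r n) x)"
  have "convergent y"
  proof (rule decreasing_orthogonal_convergent)
    fix m n :: nat assume "m \<le> n"
    then show "inner (y m) (y n) = (norm (y n))\<^sup>2"
      unfolding y_def norm_F_diff[OF rb]
      using r_mono[of m n] rb[of m] rb[of n]
      by (simp add: inner_simps inner_F min_absorb1 min_absorb2 inner_F_self)
  qed
  then obtain p where p: "y \<longlonglongrightarrow> p" by (auto simp: convergent_def)
  have lim: "(\<lambda>n. F t (y n)) \<longlonglongrightarrow> F t p" for t by (rule bounded_linear.tendsto[OF F_lin(1) p])
  have "F b p = p"
    using lim[of b] p rb unfolding y_def by (auto simp: F_lin F_F min_absorb1 min_absorb2 intro: LIMSEQ_unique)
  moreover have "F s p = 0" if s: "s < a" for s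
  proof (rule LIMSEQ_unique[OF lim])
    have "\<forall>\<^sub>F n in sequentially. s < r n" by (rule order_tendstoD(1)[OF r_lim s])
    then have "\<forall>\<^sub>F n in sequentially. F s (y n) = 0"
      by eventually_elim (use s ab in \<open>simp add: y_def F_lin F_F min_absorb1\<close>)
    then show "(\<lambda>n. F s (y n)) \<longlonglongrightarrow> 0" by (rule tendsto_eventually)
  qed
  ultimately have pb: "p \<in> band a b" unfolding band_def by blast
  have "x - p \<in> (band a b)\<^sup>\<bottom>"
    unfolding orthogonal_comp_def orthogonal_def
  proof (intro CollectI ballI)
    fix z assume z: "z \<in> band a b"
    then have "F b z = z" "F (r n) z = 0" for n using r unfolding band_def by auto
    then have "inner z (x - y n) = 0" for n
      unfolding y_def by (simp add: inner_simps F_lin(2)[symmetric])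
    moreover have "(\<lambda>n. inner z (x - y n)) \<longlonglongrightarrow> inner z (x - p)" by (intro tendsto_intros p)
    ultimately show "inner z (x - p) = 0" by (simp add: LIMSEQ_const_iff)
  qed
  then have "band_proj a b x = p"
    unfolding band_proj_def by (rule orth_proj_unique[OF subspace_band pb])
  then show ?thesis using p unfolding y_def r_def by simp
qed

lemma measure_spec_Icc:
  assumes ab: "a \<le> b"
  shows "measure (spec x) {a..b} = inner (band_proj a b x) x"
proof (rule LIMSEQ_unique)
  interpret finite_borel_measure "spec x" by (rule finite_borel_measure_spec)
  define r where "r = (\<lambda>n. a - inverse (real (Suc n)))"
  have r: "r n < a" for n unfolding r_def by simp
  have r_mono: "r m \<le> r n" if "m \<le> n" for m n
    unfolding r_def using that by (intro diff_left_mono le_imp_inverse_le) simp_all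
  have r_lim: "r \<longlonglongrightarrow> a"
    unfolding r_def using tendsto_diff[OF tendsto_const LIMSEQ_inverse_real_of_nat] by force
  have "(\<Inter>n. {r n<..b}) = {a..b}"
  proof (intro equalityI subsetI)
    fix t assume t: "t \<in> (\<Inter>n. {r n<..b})"
    then have "a \<le> t" by (intro LIMSEQ_le_const2[OF r_lim]) (auto intro: less_imp_le)
    then show "t \<in> {a..b}" using t by auto
  qed (use r in \<open>auto intro: less_le_trans\<close>)
  moreover have "(\<lambda>n. measure (spec x) {r n<..b}) \<longlonglongrightarrow> measure (spec x) (\<Inter>n. {r n<..b})"
    by (intro finite_Lim_measure_decseq) (auto simp: decseq_def intro: le_less_trans[OF r_mono])
  ultimately show "(\<lambda>n. measure (spec x) {r n<..b}) \<longlonglongrightarrow> measure (spec x) {a..b}" by simp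
  have "(norm (band_proj a b x))\<^sup>2 = inner (band_proj a b x) x"
    by (rule symmetric_idempotent_norm_le(1)[OF band_proj_symmetric band_proj_idem])
  moreover have "r n \<le> b" for n using r[of n] ab by simp
  ultimately show "(\<lambda>n. measure (spec x) {r n<..b}) \<longlonglongrightarrow> inner (band_proj a b x) x"
    using tendsto_power[OF tendsto_norm[OF band_proj_tendsto[OF ab, of x]], of 2]
    by (simp add: measure_spec_Ioc r_def)
qed

end

text \<open>Complex polarisation: the diagonal identity at x + y and at x + i y separates <P x, y>
  from <P y, x>. It provides the uniqueness for the \<open>THE\<close> in
  \<open>spectral_proj\<close>.\<close>

lemma bounded_clinear_eqI:
  fixes P Q :: "'h::complex_hilbert_space \<Rightarrow> 'h"
  assumes P: "bounded_clinear P" and Q: "bounded_clinear Q"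
    and eq: "\<And>x. cinner (P x) x = cinner (Q x) x"
  shows "P = Q"
proof
  fix x
  note lin = linear_simps[OF P[unfolded bounded_clinear_iff, THEN conjunct1]]
    linear_simps[OF Q[unfolded bounded_clinear_iff, THEN conjunct1]]
  have ii: "P (\<i> *\<^sub>C y) = \<i> *\<^sub>C P y" "Q (\<i> *\<^sub>C y) = \<i> *\<^sub>C Q y" for y
    using P Q unfolding bounded_clinear_iff by auto
  have pol: "cinner (P x) y + cinner (P y) x = cinner (Q x) y + cinner (Q y) x" for x y
    using eq[of "x + y"] eq[of x] eq[of y] by (simp add: lin cinner_add_left cinner_add_right algebra_simps)
  have "cinner (P x) y = cinner (Q x) y" for y
  proof -
    have "\<i> * (cinner (P y) x - cinner (P x) y) = \<i> * (cinner (Q y) x - cinner (Q x) y)"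
      using pol[of x "\<i> *\<^sub>C y"]
      by (simp add: ii cinner_scaleC_left cinner_scaleC_right algebra_simps)
    then have "cinner (P y) x - cinner (P x) y = cinner (Q y) x - cinner (Q x) y" by simp
    moreover have "cinner (P x) y + cinner (P y) x - (cinner (P y) x - cinner (P x) y) = 2 * cinner (P x) y"
      "cinner (Q x) y + cinner (Q y) x - (cinner (Q y) x - cinner (Q x) y) = 2 * cinner (Q x) y"
      by simp_all
    ultimately have "2 * cinner (P x) y = 2 * cinner (Q x) y" by (metis pol)
    then show ?thesis by simp
  qed
  then have "inner (P x - Q x) y = 0" for y by (simp add: inner_simps) (simp add: inner_cinner)
  then show "P x = Q x" by (metis inner_eq_zero_iff eq_iff_diff_eq_0)
qed

lemma spectral_proj_Icc:
  assumes T: "selfadjoint T" and ab: "a \<le> b"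
  shows "spectral_proj {a..b} T = resolution_of_identity.band_proj (spectral_family_of T) a b"
proof -
  define F where "F = spectral_family_of T"
  interpret spectral_resolution "op_dom T" "op_fun T" F
    unfolding F_def by (rule spectral_family_of[OF T])
  have ii: "F t (\<i> *\<^sub>C x) = \<i> *\<^sub>C F t x" for t x unfolding F_def by (rule spectral_family_of[OF T])
  have sp: "spectral_measure_at F = spec" by (simp add: fun_eq_iff spectral_measure_at_def spec_def)
  have P_ii: "band_proj a b (\<i> *\<^sub>C x) = \<i> *\<^sub>C band_proj a b x" for x
    using bounded_linear.tendsto[OF bounded_linear_ii band_proj_tendsto[OF ab, of x]]
      band_proj_tendsto[OF ab, of "\<i> *\<^sub>C x"]
    by (auto simp: ii ii_simps intro: LIMSEQ_unique)
  have P: "bounded_clinear (band_proj a b)"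
    unfolding bounded_clinear_iff using P_ii symmetric_opD(1)[OF band_proj_symmetric] by blast
  have form: "cinner (band_proj a b x) x = complex_of_real (measure (spec x) {a..b})" for x
  proof -
    let ?P = "band_proj a b"
    have "inner (?P x) (\<i> *\<^sub>C x) = - inner (?P x) (\<i> *\<^sub>C x)"
      using symmetric_opD(2)[OF band_proj_symmetric, of a b x "\<i> *\<^sub>C x"] inner_ii_left[of x "?P x"]
      unfolding P_ii by (simp add: inner_commute)
    then have "inner (?P x) (\<i> *\<^sub>C x) = 0" by simp
    then show ?thesis unfolding cinner_eq_Complex measure_spec_Icc[OF ab] by (simp add: complex_eq_iff)
  qed
  show ?thesis
    unfolding spectral_proj_def F_def[symmetric] sp
  proof (rule the_equality)
    show "bounded_clinear (band_proj a b) \<and>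
        (\<forall>x. cinner (band_proj a b x) x = complex_of_real (measure (spec x) {a..b}))"
      using P form by blast
    show "Q = band_proj a b"
      if "bounded_clinear Q \<and> (\<forall>x. cinner (Q x) x = complex_of_real (measure (spec x) {a..b}))" for Q
      by (rule bounded_clinear_eqI) (use that P form in auto)
  qed
qed

section \<open>Eigenspaces and spectral gaps\<close>

context spectral_resolution
begin

lemma band_proj_reduces:
  assumes ab: "a \<le> b" and x: "x \<in> D"
  shows "band_proj a b x \<in> D" "T (band_proj a b x) = band_proj a b (T x)"
proof -
  have "T (F b x - F s x) = F b (T x) - F s (T x)" for s by (simp add: T_diff F_dom x F_T)
  then show "band_proj a b x \<in> D" "T (band_proj a b x) = band_proj a b (T x)"
    using T_closed[OF _ band_proj_tendsto[OF ab, of x], of "band_proj a b (T x)"]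
      band_proj_tendsto[OF ab, of "T x"] F_dom[OF x] subspace_diff[OF subD] by auto
qed

lemma band_bounds:
  assumes "x \<in> D" "x \<in> band a b"
  shows "a * (norm x)\<^sup>2 \<le> inner (T x) x" "inner (T x) x \<le> b * (norm x)\<^sup>2"
proof -
  show "inner (T x) x \<le> b * (norm x)\<^sup>2" using assms F_upper unfolding band_def by blast
  have "s * (norm x)\<^sup>2 \<le> inner (T x) x" if "s < a" for s
    using assms F_lower that unfolding band_def by blast
  then show "a * (norm x)\<^sup>2 \<le> inner (T x) x"
    by (intro tendsto_le[of "at_left a" "\<lambda>_. inner (T x) x" _ "\<lambda>s. s * (norm x)\<^sup>2"])
      (auto intro!: tendsto_intros simp: eventually_at_filter)
qed

lemma band_domain:
  assumes ab: "a \<le> b" and x: "x \<in> band a b"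
  shows "x \<in> D" "norm (T x - ((a + b) / 2) *\<^sub>R x) \<le> (b - a) / 2 * norm x"
proof -
  have bnd: "a * (norm x)\<^sup>2 \<le> inner (T x) x \<and> inner (T x) x \<le> b * (norm x)\<^sup>2"
    if "x \<in> D" "band_proj a b x = x" for x
    using band_bounds[OF that(1)] band_proj_in[of a b x] that(2) by auto
  have "band_proj a b x \<in> D"
    by (rule reducing_projection(1)[of "band_proj a b" a b, OF band_proj_symmetric band_proj_idem])
      (use bnd band_proj_reduces[OF ab] in auto)
  then show "x \<in> D" by (simp add: band_proj_ident[OF x])
  show "norm (T x - ((a + b) / 2) *\<^sub>R x) \<le> (b - a) / 2 * norm x"
    by (rule reducing_projection(2)[of "band_proj a b" a b, OF band_proj_symmetric band_proj_idem])
      (use bnd band_proj_reduces[OF ab] band_proj_ident[OF x] in auto)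
qed

lemma norm_T_band_le: "0 \<le> a \<Longrightarrow> x \<in> band (- a) a \<Longrightarrow> norm (T x) \<le> a * norm x"
  using band_domain(2)[of "- a" a x] by simp

text \<open>x splits into u above a and w below - a, where w is the limit of F (r n) x from the left
  of - a. Each part satisfies |<T v, v>| \<ge> a |v|^2, and the parts as well as their images under
  T are orthogonal, so the estimates add up.\<close>

lemma norm_T_compl_band_ge:
  assumes a: "0 \<le> a" and x: "x \<in> D" and Px: "band_proj (- a) a x = 0"
  shows "a * norm x \<le> norm (T x)"
proof -
  define u w where "u = x - F a x" and "w = F a x"
  have uD: "u \<in> D" and wD: "w \<in> D"
    unfolding u_def w_def using x F_dom subD by (auto intro: subspace_diff)
  have Fu: "F a u = 0" and Fw: "F a w = w" unfolding u_def w_def by (simp_all add: F_lin F_idem)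
  have ab: "- a \<le> a" using a by simp
  define r where "r = (\<lambda>n. - a - inverse (real (Suc n)))"
  have wl: "(\<lambda>n. F (r n) x) \<longlonglongrightarrow> w"
    using tendsto_diff[OF tendsto_const[of "F a x"] band_proj_tendsto[OF ab, of x]]
    unfolding Px w_def r_def by simp
  have "band_proj (- a) a (T x) = 0" using band_proj_reduces[OF ab x] Px T_0 by simp
  then have Twl: "(\<lambda>n. F (r n) (T x)) \<longlonglongrightarrow> T w"
    using tendsto_diff[OF tendsto_const[of "F a (T x)"] band_proj_tendsto[OF ab, of "T x"]]
    unfolding w_def r_def by (simp add: F_T x)
  have "inner (T w) w \<le> - a * (norm w)\<^sup>2"
  proof (rule LIMSEQ_le)
    show "(\<lambda>n. inner (F (r n) (T x)) (F (r n) x)) \<longlonglongrightarrow> inner (T w) w" by (intro tendsto_intros wl Twl)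
    show "(\<lambda>n. - a * (norm (F (r n) x))\<^sup>2) \<longlonglongrightarrow> - a * (norm w)\<^sup>2" by (intro tendsto_intros wl)
    have "inner (F (r n) (T x)) (F (r n) x) \<le> - a * (norm (F (r n) x))\<^sup>2" for n
    proof -
      have "inner (T (F (r n) x)) (F (r n) x) \<le> r n * (norm (F (r n) x))\<^sup>2"
        by (rule F_upper[OF F_dom[OF x] F_idem])
      also have "\<dots> \<le> - a * (norm (F (r n) x))\<^sup>2" unfolding r_def by (intro mult_right_mono) auto
      finally show ?thesis by (simp add: F_T x)
    qed
    then show "\<exists>N. \<forall>n\<ge>N. inner (F (r n) (T x)) (F (r n) x) \<le> - a * (norm (F (r n) x))\<^sup>2" by blast
  qed
  moreover have "a * (norm u)\<^sup>2 \<le> inner (T u) u" by (rule F_lower[OF uD Fu])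
  moreover have "a * norm v \<le> norm (T v)" if "a * (norm v)\<^sup>2 \<le> \<bar>inner (T v) v\<bar>" for v
  proof (cases "v = 0")
    case False
    have "a * norm v * norm v \<le> norm (T v) * norm v"
      using that Cauchy_Schwarz_ineq2[of "T v" v] by (simp add: power2_eq_square)
    then show ?thesis using False by simp
  qed (simp add: T_0)
  ultimately have le: "a * norm u \<le> norm (T u)" "a * norm w \<le> norm (T w)" by fastforce+
  have uw: "inner u w = 0" unfolding w_def u_def by (metis Fu F_lin(2) inner_zero_left u_def)
  have "F a (T u) = 0" using F_T[OF uD, of a] Fu T_0 by simp
  moreover have "F a (T w) = T w" using F_T[OF wD, of a] Fw by simp
  ultimately have Tuw: "inner (T u) (T w) = 0" by (metis F_lin(2) inner_zero_left)
  have "x = u + w" by (simp add: u_def w_def)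
  then have "T x = T u + T w" using T_add[OF uD wD] by simp
  then have "(norm (T x))\<^sup>2 = (norm (T u))\<^sup>2 + (norm (T w))\<^sup>2"
    using Tuw by (simp add: power2_norm_eq_inner inner_simps inner_commute)
  moreover have "(norm x)\<^sup>2 = (norm u)\<^sup>2 + (norm w)\<^sup>2"
    using uw unfolding \<open>x = u + w\<close> by (simp add: power2_norm_eq_inner inner_simps inner_commute)
  moreover have "(a * norm u)\<^sup>2 \<le> (norm (T u))\<^sup>2" "(a * norm w)\<^sup>2 \<le> (norm (T w))\<^sup>2"
    using le a by (intro power_mono; simp)+
  ultimately have "(a * norm x)\<^sup>2 \<le> (norm (T x))\<^sup>2" by (simp add: power_mult_distrib algebra_simps)
  then show ?thesis by (rule power2_le_imp_le) simp
qed

end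

section \<open>Eigenspaces, lower bounds off the kernel, and ranges\<close>

context sa_operator
begin

definition eigenspace :: "real \<Rightarrow> 'a set" where "eigenspace t = {x \<in> D. T x = t *\<^sub>R x}"

lemma subspace_eigenspace: "subspace (eigenspace t)"
  using subD unfolding eigenspace_def subspace_def by (auto simp: T_0 T_add T_scale algebra_simps)

lemma closed_eigenspace: "closed (eigenspace t)"
proof (rule closed_sequential_limits[THEN iffD2], intro allI impI, elim conjE)
  fix x l assume x: "\<forall>n. x n \<in> eigenspace t" and l: "x \<longlonglongrightarrow> l"
  have "(\<lambda>n. T (x n)) \<longlonglongrightarrow> t *\<^sub>R l"
    using x tendsto_scaleR[OF tendsto_const l, of t] unfolding eigenspace_def by simp
  then show "l \<in> eigenspace t" using T_closed[OF _ l] x unfolding eigenspace_def by blast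
qed

lemma eigenspace_orthogonal:
  assumes "x \<in> eigenspace s" "y \<in> eigenspace t" "s \<noteq> t" shows "inner x y = 0"
  using T_sym[of x y] assms unfolding eigenspace_def by auto

lemma orthogonal_range_imp_eigenspace:
  assumes "\<And>x. x \<in> D \<Longrightarrow> inner (T x - t *\<^sub>R x) z = 0" shows "z \<in> eigenspace t"
  using T_max[of z "t *\<^sub>R z"] assms unfolding eigenspace_def by (simp add: inner_simps)

lemma shift_symmetric:
  "x \<in> D \<Longrightarrow> y \<in> D \<Longrightarrow> inner (T x - t *\<^sub>R x) y = inner x (T y - t *\<^sub>R y)"
  using T_sym[of x y] by (simp add: inner_simps)

text \<open>Quantitative form of closed range: the reduced minimum modulus of T - t is
  positive.\<close>

definition gap_at :: "real \<Rightarrow> bool"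
  where "gap_at t \<longleftrightarrow> (\<exists>c>0. \<forall>x\<in>D. (\<forall>k\<in>eigenspace t. inner x k = 0) \<longrightarrow> c * norm x \<le> norm (T x - t *\<^sub>R x))"

text \<open>
  If the range has finite codimension but there is no gap, then there are unit vectors \<open>x n\<close>
  orthogonal to the kernel with \<open>(T - t) (x n) \<longlonglongrightarrow> 0\<close>. They converge weakly to \<open>0\<close>, and can be
  blown up so slowly that they stay weakly bounded, in contradiction to the uniform boundedness
  principle.
\<close>

lemma finite_codimensional_imp_gap:
  assumes fc: "finite_codimensional ((\<lambda>x. T x - t *\<^sub>R x) ` D)"
  shows "gap_at t"
proof (rule ccontr)
  assume "\<not> gap_at t"
  then have neg: "\<exists>x\<in>D. (\<forall>k\<in>eigenspace t. inner x k = 0) \<and> norm (T x - t *\<^sub>R x) < c * norm x" if "c > 0" for c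
    using that unfolding gap_at_def by (metis not_le)
  have "\<exists>x\<in>D. (\<forall>k\<in>eigenspace t. inner x k = 0) \<and> norm x = 1 \<and> norm (T x - t *\<^sub>R x) < inverse (real (Suc n))" for n
  proof -
    obtain x where x: "x \<in> D" "\<forall>k\<in>eigenspace t. inner x k = 0"
      "norm (T x - t *\<^sub>R x) < inverse (real (Suc n)) * norm x"
      using neg[of "inverse (real (Suc n))"] by auto
    then have x0: "norm x > 0" by (cases "x = 0") (auto simp: T_0)
    define y where "y = inverse (norm x) *\<^sub>R x"
    have "T y - t *\<^sub>R y = inverse (norm x) *\<^sub>R (T x - t *\<^sub>R x)"
      unfolding y_def by (simp add: T_scale x algebra_simps)
    then have "norm (T y - t *\<^sub>R y) = norm (T x - t *\<^sub>R x) / norm x"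
      by (simp add: divide_inverse mult.commute)
    then have "norm (T y - t *\<^sub>R y) < inverse (real (Suc n))"
      using x(3) x0 by (simp only: pos_divide_less_eq)
    moreover have "y \<in> D" "norm y = 1" "\<forall>k\<in>eigenspace t. inner y k = 0"
      unfolding y_def using x x0 subD by (simp_all add: subspace_scale)
    ultimately show ?thesis by blast
  qed
  then obtain x where x: "\<And>n. x n \<in> D" "\<And>n k. k \<in> eigenspace t \<Longrightarrow> inner (x n) k = 0" "\<And>n. norm (x n) = 1"
    and xT: "\<And>n. norm (T (x n) - t *\<^sub>R x n) < inverse (real (Suc n))" by metis
  define d where "d = (\<lambda>n. norm (T (x n) - t *\<^sub>R x n))"
  have d_pos: "d n > 0" for n
  proof (rule ccontr)
    assume "\<not> d n > 0"
    then have "x n \<in> eigenspace t" unfolding d_def eigenspace_def using x by simp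
    then have "inner (x n) (x n) = 0" by (rule x(2))
    then show False using x(3)[of n] by simp
  qed
  have d_lim: "d \<longlonglongrightarrow> 0"
    by (rule Lim_null_comparison[OF _ LIMSEQ_inverse_real_of_nat])
      (use less_imp_le[OF xT] in \<open>simp add: d_def del: of_nat_Suc\<close>)
  \<comment> \<open>W is closed because the \<open>x n\<close> are unit vectors, and it contains the
    range of T - t by symmetry. A vector orthogonal to W is therefore an eigenvector, hence
    orthogonal to all \<open>x n\<close>, hence in W and zero.\<close>
  define W where "W = {y. (\<lambda>n. inner (x n) y) \<longlonglongrightarrow> 0}"
  have "W = UNIV"
  proof (rule orth_comp_eq_0_imp_UNIV)
    show "subspace W" unfolding subspace_def
    proof (intro conjI ballI allI)
      show "0 \<in> W" by (simp add: W_def)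
      show "y + z \<in> W" if "y \<in> W" "z \<in> W" for y z
        using that tendsto_add[of "\<lambda>n. inner (x n) y" 0 _ "\<lambda>n. inner (x n) z" 0]
        by (simp add: W_def inner_add_right)
      show "c *\<^sub>R y \<in> W" if "y \<in> W" for c y
        using that tendsto_mult_right_zero[of "\<lambda>n. inner (x n) y" _ c] by (simp add: W_def)
    qed
    show "closed W"
    proof (rule closed_sequential_limits[THEN iffD2], intro allI impI, elim conjE)
      fix y l assume y: "\<forall>k. y k \<in> W" and l: "y \<longlonglongrightarrow> l"
      have "(\<lambda>n. inner (x n) l) \<longlonglongrightarrow> 0"
      proof (rule tendstoI)
        fix e :: real assume e: "e > 0"
        then obtain k where k: "norm (y k - l) < e / 2"
          using metric_LIMSEQ_D[OF l, of "e / 2"] by (auto simp: dist_norm)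
        have "\<forall>\<^sub>F n in sequentially. dist (inner (x n) (y k)) 0 < e / 2"
          using y e unfolding W_def by (intro tendstoD) auto
        then show "\<forall>\<^sub>F n in sequentially. dist (inner (x n) l) 0 < e"
        proof eventually_elim
          case (elim n)
          have "\<bar>inner (x n) (y k - l)\<bar> < e / 2"
            using Cauchy_Schwarz_ineq2[of "x n" "y k - l"] k x(3)[of n] by simp
          then show ?case using elim unfolding inner_diff_right dist_real_def by linarith
        qed
      qed
      then show "l \<in> W" by (simp add: W_def)
    qed
    fix z assume z: "\<And>y. y \<in> W \<Longrightarrow> inner z y = 0"
    have R: "T w - t *\<^sub>R w \<in> W" if w: "w \<in> D" for w
    proof -
      have "(\<lambda>n. inner (x n) (T w - t *\<^sub>R w)) \<longlonglongrightarrow> 0"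
      proof (rule Lim_null_comparison)
        show "(\<lambda>n. d n * norm w) \<longlonglongrightarrow> 0" using tendsto_mult_left_zero[OF d_lim] .
        show "\<forall>\<^sub>F n in sequentially. norm (inner (x n) (T w - t *\<^sub>R w)) \<le> d n * norm w"
          using Cauchy_Schwarz_ineq2[of "T (x _) - t *\<^sub>R x _" w]
          by (intro always_eventually allI) (simp add: d_def shift_symmetric[OF x(1) w, symmetric])
      qed
      then show ?thesis by (simp add: W_def)
    qed
    have "z \<in> eigenspace t"
      by (rule orthogonal_range_imp_eigenspace) (metis R z inner_commute)
    then have "z \<in> W" using x(2) by (simp add: W_def)
    then show "z = 0" using z[of z] by simp
  qed
  then have weak: "(\<lambda>n. inner (x n) y) \<longlonglongrightarrow> 0" for y unfolding W_def by blast
  obtain B where B: "finite B" "span ((\<lambda>x. T x - t *\<^sub>R x) ` D \<union> B) = UNIV"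
    using fc unfolding finite_codimensional_def by blast
  \<comment> \<open>Size of \<open>x n\<close> on the finitely many vectors completing the range;
    \<open>d n\<close> plays that role on the range itself. Division by \<open>d n + p n\<close>
    thus keeps all pairings bounded, although this quantity tends to 0.\<close>
  define p where "p = (\<lambda>n. \<Sum>b\<in>B. \<bar>inner (x n) b\<bar>)"
  have p_pos: "p n \<ge> 0" for n unfolding p_def by (intro sum_nonneg) simp
  have p_lim: "p \<longlonglongrightarrow> 0"
    unfolding p_def using tendsto_sum[of B "\<lambda>b n. \<bar>inner (x n) b\<bar>" "\<lambda>_. 0"] tendsto_rabs_zero[OF weak] by simp
  have dp: "d n + p n > 0" for n using d_pos[of n] p_pos[of n] by simp
  define z where "z = (\<lambda>n. inverse (d n + p n) *\<^sub>R x n)"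
  define Z where "Z = {y. \<exists>M. \<forall>n. \<bar>inner (z n) y\<bar> \<le> M}"
  have "subspace Z" unfolding subspace_def
  proof (intro conjI ballI allI)
    show "0 \<in> Z" by (auto simp: Z_def)
    show "u + v \<in> Z" if u: "u \<in> Z" and v: "v \<in> Z" for u v
    proof -
      obtain M N where "\<forall>n. \<bar>inner (z n) u\<bar> \<le> M" "\<forall>n. \<bar>inner (z n) v\<bar> \<le> N"
        using u v unfolding Z_def by blast
      then have "\<forall>n. \<bar>inner (z n) (u + v)\<bar> \<le> M + N"
        by (metis abs_triangle_ineq add_mono inner_add_right order_trans)
      then show ?thesis unfolding Z_def by blast
    qed
    show "c *\<^sub>R u \<in> Z" if u: "u \<in> Z" for c u
    proof -
      obtain M where "\<forall>n. \<bar>inner (z n) u\<bar> \<le> M" using u unfolding Z_def by blast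
      then have "\<forall>n. \<bar>inner (z n) (c *\<^sub>R u)\<bar> \<le> \<bar>c\<bar> * M" by (simp add: abs_mult mult_left_mono)
      then show ?thesis unfolding Z_def by blast
    qed
  qed
  moreover have "T w - t *\<^sub>R w \<in> Z" if w: "w \<in> D" for w
  proof -
    have "\<bar>inner (z n) (T w - t *\<^sub>R w)\<bar> \<le> norm w" for n
    proof -
      have "\<bar>inner (x n) (T w - t *\<^sub>R w)\<bar> \<le> d n * norm w"
        unfolding shift_symmetric[OF x(1) w, symmetric] d_def by (rule Cauchy_Schwarz_ineq2)
      also have "\<dots> \<le> (d n + p n) * norm w" using p_pos by (intro mult_right_mono) auto
      finally show ?thesis unfolding z_def using dp[of n] by (simp add: abs_mult field_simps)
    qed
    then show ?thesis unfolding Z_def by blast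
  qed
  moreover have "b \<in> Z" if b: "b \<in> B" for b
  proof -
    have "\<bar>inner (z n) b\<bar> \<le> 1" for n
    proof -
      have "\<bar>inner (x n) b\<bar> \<le> p n" unfolding p_def using B(1) b by (intro member_le_sum) auto
      then show ?thesis unfolding z_def using dp[of n] d_pos[of n] by (simp add: abs_mult field_simps)
    qed
    then show ?thesis unfolding Z_def by blast
  qed
  ultimately have "span ((\<lambda>x. T x - t *\<^sub>R x) ` D \<union> B) \<subseteq> Z" by (intro span_minimal) auto
  then have "\<exists>M. \<forall>n. \<bar>inner (z n) y\<bar> \<le> M" for y using B(2) unfolding Z_def by blast
  then obtain K where K: "\<And>n. norm (z n) \<le> K" using weakly_bounded_imp_bounded[of z] by blast
  have "1 \<le> K * (d n + p n)" for n
    using K[of n] dp[of n] x(3)[of n] unfolding z_def by (simp add: field_simps)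
  moreover have "(\<lambda>n. K * (d n + p n)) \<longlonglongrightarrow> K * (0 + 0)" by (intro tendsto_intros d_lim p_lim)
  ultimately have "1 \<le> K * (0 + 0 :: real)" by (intro LIMSEQ_le_const) auto
  then show False by simp
qed

lemma shift_limit:
  assumes "\<And>n. x n \<in> D" "x \<longlonglongrightarrow> u" "(\<lambda>n. T (x n) - t *\<^sub>R x n) \<longlonglongrightarrow> v"
  shows "u \<in> D" "T u - t *\<^sub>R u = v"
proof -
  have "(\<lambda>n. (T (x n) - t *\<^sub>R x n) + t *\<^sub>R x n) \<longlonglongrightarrow> v + t *\<^sub>R u" by (intro tendsto_intros assms)
  then have "u \<in> D \<and> T u = v + t *\<^sub>R u" using T_closed[OF assms(1,2)] by simp
  then show "u \<in> D" "T u - t *\<^sub>R u = v" by auto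
qed

text \<open>Preimages are made orthogonal to the kernel, where the lower bound turns a Cauchy
  sequence of images into a Cauchy sequence of preimages.\<close>

lemma gap_imp_closed_range:
  assumes "gap_at t" shows "closed ((\<lambda>x. T x - t *\<^sub>R x) ` D)"
proof (rule closed_sequential_limits[THEN iffD2], intro allI impI, elim conjE)
  fix y l assume y: "\<forall>n. y n \<in> (\<lambda>x. T x - t *\<^sub>R x) ` D" and l: "y \<longlonglongrightarrow> l"
  obtain c where c: "c > 0" "\<And>x. x \<in> D \<Longrightarrow> (\<And>k. k \<in> eigenspace t \<Longrightarrow> inner x k = 0) \<Longrightarrow> c * norm x \<le> norm (T x - t *\<^sub>R x)"
    using assms unfolding gap_at_def by blast
  have "\<exists>x\<in>D. (\<forall>k\<in>eigenspace t. inner x k = 0) \<and> T x - t *\<^sub>R x = y n" for n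
  proof -
    obtain w where w: "w \<in> D" "y n = T w - t *\<^sub>R w" using y by blast
    let ?P = "orth_proj (eigenspace t)"
    have k: "?P w \<in> eigenspace t" by (rule orth_proj_in[OF subspace_eigenspace closed_eigenspace])
    then have kD: "?P w \<in> D" "T (?P w) = t *\<^sub>R ?P w" by (auto simp: eigenspace_def)
    show ?thesis
    proof (intro bexI conjI ballI)
      show "w - ?P w \<in> D" using w kD subD by (simp add: subspace_diff)
      show "inner (w - ?P w) k = 0" if "k \<in> eigenspace t" for k
        by (rule inner_orth_proj_diff[OF subspace_eigenspace closed_eigenspace that])
      show "T (w - ?P w) - t *\<^sub>R (w - ?P w) = y n" using w kD by (simp add: T_diff algebra_simps)
    qed
  qed
  then obtain x where x: "\<And>n. x n \<in> D" "\<And>n k. k \<in> eigenspace t \<Longrightarrow> inner (x n) k = 0" "\<And>n. T (x n) - t *\<^sub>R x n = y n"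
    by metis
  have "Cauchy x"
  proof (rule metric_CauchyI)
    fix e :: real assume e: "e > 0"
    obtain M where M: "\<And>m n. m \<ge> M \<Longrightarrow> n \<ge> M \<Longrightarrow> dist (y m) (y n) < c * e"
      using metric_CauchyD[OF LIMSEQ_imp_Cauchy[OF l], of "c * e"] c(1) e by auto
    have "dist (x m) (x n) < e" if "m \<ge> M" "n \<ge> M" for m n
    proof -
      have "c * norm (x m - x n) \<le> norm (T (x m - x n) - t *\<^sub>R (x m - x n))"
        using x(1,2) subD by (intro c(2)) (auto simp: subspace_diff inner_simps)
      also have "T (x m - x n) - t *\<^sub>R (x m - x n) = y m - y n"
        unfolding x(3)[symmetric] using x(1) by (simp add: T_diff algebra_simps)
      also have "norm (y m - y n) < c * e" using M[OF that] by (simp add: dist_norm)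
      finally show ?thesis using c(1) by (simp add: dist_norm)
    qed
    then show "\<exists>M. \<forall>m\<ge>M. \<forall>n\<ge>M. dist (x m) (x n) < e" by blast
  qed
  then obtain u where u: "x \<longlonglongrightarrow> u" using Cauchy_convergent convergent_def by blast
  have "(\<lambda>n. T (x n) - t *\<^sub>R x n) \<longlonglongrightarrow> l" unfolding x(3) by (rule l)
  from shift_limit[OF x(1) u this] show "l \<in> (\<lambda>x. T x - t *\<^sub>R x) ` D" by blast
qed

lemma subspace_shift_range: "subspace ((\<lambda>x. T x - t *\<^sub>R x) ` D)"
  unfolding subspace_def
proof (intro conjI ballI allI)
  show "0 \<in> (\<lambda>x. T x - t *\<^sub>R x) ` D" using subspace_0[OF subD] T_0 by force
  show "u + v \<in> (\<lambda>x. T x - t *\<^sub>R x) ` D"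
    if u: "u \<in> (\<lambda>x. T x - t *\<^sub>R x) ` D" and v: "v \<in> (\<lambda>x. T x - t *\<^sub>R x) ` D" for u v
  proof -
    obtain x y where xy: "x \<in> D" "y \<in> D" "u = T x - t *\<^sub>R x" "v = T y - t *\<^sub>R y" using u v by blast
    have "x + y \<in> D" "u + v = T (x + y) - t *\<^sub>R (x + y)"
      unfolding xy(3,4) using subspace_add[OF subD xy(1,2)] by (simp_all add: T_add xy(1,2) algebra_simps)
    then show ?thesis by blast
  qed
  show "c *\<^sub>R u \<in> (\<lambda>x. T x - t *\<^sub>R x) ` D" if u: "u \<in> (\<lambda>x. T x - t *\<^sub>R x) ` D" for c u
  proof -
    obtain x where x: "x \<in> D" "u = T x - t *\<^sub>R x" using u by blast
    have "c *\<^sub>R x \<in> D" "c *\<^sub>R u = T (c *\<^sub>R x) - t *\<^sub>R (c *\<^sub>R x)"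
      unfolding x(2) using subspace_scale[OF subD x(1)] by (simp_all add: T_scale x(1) algebra_simps)
    then show ?thesis by blast
  qed
qed

text \<open>The orthogonal complement of the range of T - t is the kernel, which is trivial, and the
  range is closed.\<close>

lemma gap_imp_surj:
  assumes "gap_at t" "eigenspace t = {0}" shows "(\<lambda>x. T x - t *\<^sub>R x) ` D = UNIV"
proof (rule orth_comp_eq_0_imp_UNIV[OF subspace_shift_range gap_imp_closed_range[OF assms(1)]])
  fix z assume "\<And>y. y \<in> (\<lambda>x. T x - t *\<^sub>R x) ` D \<Longrightarrow> inner z y = 0"
  then have "z \<in> eigenspace t"
    by (intro orthogonal_range_imp_eigenspace) (metis imageI inner_commute)
  then show "z = 0" using assms(2) by blast
qed

end

section \<open>Dimensions of finite orthogonal sums\<close>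

lemma finite_dimensional_basis:
  assumes "finite_dimensional V"
  obtains B where "finite B" "independent B" "span B = V" "card B = dim V"
proof -
  obtain C where C: "finite C" "span C = V" using assms unfolding finite_dimensional_def by blast
  obtain B where B: "B \<subseteq> V" "independent B" "V \<subseteq> span B" "card B = dim V" using basis_exists by blast
  have "finite B" using independent_span_bound[OF C(1) B(2)] B(1) C(2) by simp
  moreover have "span B = V" using B C(2) by (metis span_minimal subspace_span subset_antisym)
  ultimately show ?thesis using that B by blast
qed

lemma dim_orthogonal_Un:
  fixes U V :: "'a::real_inner set"
  assumes U: "finite_dimensional U" and V: "finite_dimensional V"
    and orth: "\<And>u v. u \<in> U \<Longrightarrow> v \<in> V \<Longrightarrow> inner u v = 0"
  shows "finite_dimensional (span (U \<union> V))" "dim (span (U \<union> V)) = dim U + dim V"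
proof -
  obtain B where B: "finite B" "independent B" "span B = U" "card B = dim U"
    by (rule finite_dimensional_basis[OF U])
  obtain C where C: "finite C" "independent C" "span C = V" "card C = dim V"
    by (rule finite_dimensional_basis[OF V])
  have s: "span (B \<union> C) = span (U \<union> V)"
    using span_span[of B] span_span[of C] by (simp add: span_Un B(3) C(3) span_eq_iff[THEN iffD2])
  have disj: "B \<inter> C = {}"
  proof (rule ccontr)
    assume "B \<inter> C \<noteq> {}"
    then obtain v where v: "v \<in> B" "v \<in> C" by blast
    then have "inner v v = 0" using orth B(3) C(3) span_base by blast
    then show False using v(1) B(2) dependent_zero by auto
  qed
  have "independent (B \<union> C)"
  proof
    assume "dependent (B \<union> C)"
    then obtain f where f: "\<exists>v\<in>B \<union> C. f v \<noteq> 0" "(\<Sum>v\<in>B \<union> C. f v *\<^sub>R v) = 0"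
      using dependent_finite[of "B \<union> C"] B(1) C(1) by auto
    define u v where "u = (\<Sum>w\<in>B. f w *\<^sub>R w)" and "v = (\<Sum>w\<in>C. f w *\<^sub>R w)"
    have uv: "u + v = 0" using f(2) sum.union_disjoint[OF B(1) C(1) disj] unfolding u_def v_def by metis
    have "u \<in> U" unfolding u_def B(3)[symmetric] by (intro span_sum span_scale span_base)
    moreover have "v \<in> V" unfolding v_def C(3)[symmetric] by (intro span_sum span_scale span_base)
    ultimately have "inner u v = 0" by (rule orth)
    moreover have "v = - u" using uv by (simp add: eq_neg_iff_add_eq_0 add.commute)
    ultimately have "u = 0" "v = 0" by auto
    then have "\<forall>w\<in>B. f w = 0" "\<forall>w\<in>C. f w = 0"
      using B(1,2) C(1,2) unfolding u_def v_def by (auto simp: dependent_finite)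
    then show False using f(1) by blast
  qed
  then have "dim (span (B \<union> C)) = card (B \<union> C)" by (rule dim_span_eq_card_independent)
  then show "dim (span (U \<union> V)) = dim U + dim V"
    unfolding s using card_Un_disjoint[OF B(1) C(1) disj] B(4) C(4) by simp
  show "finite_dimensional (span (U \<union> V))"
    unfolding finite_dimensional_def s[symmetric] using B(1) C(1) by blast
qed

lemma dim_orthogonal_family:
  fixes V :: "'i \<Rightarrow> 'a::real_inner set"
  assumes "finite S" and "\<And>i. i \<in> S \<Longrightarrow> finite_dimensional (V i)"
    and orth: "\<And>i j u v. i \<in> S \<Longrightarrow> j \<in> S \<Longrightarrow> i \<noteq> j \<Longrightarrow> u \<in> V i \<Longrightarrow> v \<in> V j \<Longrightarrow> inner u v = 0"
  shows "finite_dimensional (span (\<Union>i\<in>S. V i)) \<and> dim (span (\<Union>i\<in>S. V i)) = (\<Sum>i\<in>S. dim (V i))"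
  using assms
proof (induction S rule: finite_induct)
  case empty
  have "dim {0::'a} = 0" using dim_span_eq_card_independent[OF independent_empty] by simp
  then show ?case by (auto simp: finite_dimensional_def intro: exI[of _ "{}"])
next
  case (insert i S)
  let ?W = "span (\<Union>i\<in>S. V i)"
  have "finite_dimensional ?W \<and> dim ?W = (\<Sum>i\<in>S. dim (V i))"
  proof (rule insert.IH)
    show "finite_dimensional (V j)" if "j \<in> S" for j using that by (intro insert.prems(1) insertI2)
    show "inner u v = 0" if "j \<in> S" "k \<in> S" "j \<noteq> k" "u \<in> V j" "v \<in> V k" for j k u v
      using that by (intro insert.prems(2)[of j k] insertI2)
  qed
  then have IH: "finite_dimensional ?W" "dim ?W = (\<Sum>i\<in>S. dim (V i))" by blast+
  have "inner u v = 0" if u: "u \<in> V i" and v: "v \<in> ?W" for u v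
  proof -
    have "(\<Union>j\<in>S. V j) \<subseteq> {v. inner u v = 0}"
      using insert.prems(2)[of i] insert.hyps(2) u by blast
    moreover have "subspace {v. inner u v = 0}" by (simp add: subspace_def inner_simps)
    ultimately show ?thesis using v span_minimal by blast
  qed
  from dim_orthogonal_Un[OF insert.prems(1)[OF insertI1] IH(1) this]
  have "finite_dimensional (span (V i \<union> ?W))" "dim (span (V i \<union> ?W)) = dim (V i) + dim ?W" by auto
  moreover have "span (V i \<union> ?W) = span (\<Union>j\<in>insert i S. V j)"
    by (simp add: span_Un span_span)
  ultimately show ?case using IH(2) insert.hyps by simp
qed

section \<open>Spectral windows without essential spectrum\<close>

context spectral_resolution
begin

text \<open>T acts as t on the components F s x and x - F s x as well, so the order bounds
  annihilate the component on the wrong side of s. The borderline s = t is settled by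
  right-continuity.\<close>

lemma eigenspace_F:
  assumes x: "x \<in> eigenspace t"
  shows "s < t \<Longrightarrow> F s x = 0" "t \<le> s \<Longrightarrow> F s x = x"
proof -
  have xD: "x \<in> D" and Tx: "T x = t *\<^sub>R x" using x by (auto simp: eigenspace_def)
  show "F s x = 0" if "s < t" for s
  proof -
    have "inner (T (F s x)) (F s x) \<le> s * (norm (F s x))\<^sup>2" by (rule F_upper[OF F_dom[OF xD] F_idem])
    then have "(t - s) * (norm (F s x))\<^sup>2 \<le> 0"
      by (simp add: F_T xD Tx F_lin power2_norm_eq_inner algebra_simps)
    then show ?thesis using that by (simp add: mult_le_0_iff)
  qed
  have gt: "F s x = x" if "t < s" for s
  proof -
    let ?v = "x - F s x"
    have "s * (norm ?v)\<^sup>2 \<le> inner (T ?v) ?v"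
      using F_dom xD subD by (intro F_lower) (auto simp: F_lin F_idem subspace_diff)
    moreover have "T ?v = t *\<^sub>R ?v" by (simp add: T_diff F_dom xD F_T Tx F_lin algebra_simps)
    ultimately have "(s - t) * (norm ?v)\<^sup>2 \<le> 0" by (simp add: power2_norm_eq_inner algebra_simps)
    then show ?thesis using that by (simp add: mult_le_0_iff)
  qed
  have "((\<lambda>s. F s x) \<longlongrightarrow> x) (at_right t)"
    by (rule tendsto_eventually) (auto simp: eventually_at_filter gt)
  then have "F t x = x" using F_right[of x t] tendsto_unique trivial_limit_at_right_real by blast
  then show "F s x = x" if "t \<le> s" for s using gt[of s] that by (cases "s = t") auto
qed

text \<open>The lower bound at each t acts twice: it prevents eigenvalues from accumulating, and it
  makes F locally constant on vectors orthogonal to all eigenspaces, so that nothing of the band is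
  left over.\<close>

lemma dim_band:
  assumes a: "0 < a" and gap: "\<And>t. - a \<le> t \<Longrightarrow> t \<le> a \<Longrightarrow> gap_at t"
    and fin: "\<And>t. 0 \<le> t \<Longrightarrow> t \<le> a \<Longrightarrow> finite_dimensional (eigenspace t)"
  defines "\<Theta> \<equiv> {t. 0 \<le> t \<and> t \<le> a \<and> eigenspace t \<noteq> {0}}"
  shows "finite \<Theta>" "dim (band 0 a) = (\<Sum>t\<in>\<Theta>. dim (eigenspace t))"
proof -
  show \<Theta>: "finite \<Theta>"
  proof (rule ccontr)
    assume "infinite \<Theta>"
    moreover have "\<Theta> \<subseteq> {0..a}" unfolding \<Theta>_def by auto
    \<comment> \<open>At an accumulation point t, eigenvectors for nearby s \<noteq> t are
      orthogonal to the eigenspace of t, yet T - t moves them only by |s - t|, less than the bound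
      c.\<close>
    ultimately obtain t where t: "t \<in> {0..a}" "t islimpt \<Theta>"
      using compact_Icc[of 0 a] unfolding compact_eq_Bolzano_Weierstrass by blast
    obtain c where c: "c > 0" "\<And>x. x \<in> D \<Longrightarrow> (\<And>k. k \<in> eigenspace t \<Longrightarrow> inner x k = 0) \<Longrightarrow> c * norm x \<le> norm (T x - t *\<^sub>R x)"
      using gap[of t] t a unfolding gap_at_def by auto
    obtain s where s: "s \<in> \<Theta>" "s \<noteq> t" "dist s t < c"
      using t(2) c(1) unfolding islimpt_approachable by blast
    obtain u where u: "u \<in> eigenspace s" "u \<noteq> 0"
      using s(1) subspace_0[OF subspace_eigenspace] unfolding \<Theta>_def by blast
    have "c * norm u \<le> norm (T u - t *\<^sub>R u)"
      using u eigenspace_orthogonal[OF u(1) _ s(2)] by (intro c(2)) (auto simp: eigenspace_def)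
    also have "T u - t *\<^sub>R u = (s - t) *\<^sub>R u" using u(1) by (simp add: eigenspace_def algebra_simps)
    finally show False using s(3) u(2) by (simp add: dist_real_def)
  qed
  have sub: "eigenspace t \<subseteq> band 0 a" if "0 \<le> t" "t \<le> a" for t
    using eigenspace_F that unfolding band_def by fastforce
  have zero: "v = 0" if v: "v \<in> band 0 a" and orth: "\<And>t k. t \<in> \<Theta> \<Longrightarrow> k \<in> eigenspace t \<Longrightarrow> inner v k = 0" for v
  proof -
    \<comment> \<open>Eigenvectors for negative t are orthogonal to the band automatically: F t
      fixes them and annihilates v.\<close>
    have orth': "inner v k = 0" if "k \<in> eigenspace t" "- a \<le> t" "t \<le> a" for t k
    proof (cases "0 \<le> t")
      case True
      then show ?thesis using orth[of t k] that \<Theta>_def by (cases "k = 0") auto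
    next
      case False
      then have "F t v = 0" using v unfolding band_def by simp
      then show ?thesis using eigenspace_F(2)[OF that(1), of t] F_lin(2)[of t v k] by simp
    qed
    \<comment> \<open>The interval starts at - a since band vectors are known to be annihilated by F
      s only for s < 0. Near t, the piece u = F \<beta> v - F \<alpha> v is orthogonal to the
      eigenspace and satisfies |(T - t) u| \<le> (\<beta> - \<alpha>) |u|, so it vanishes once
      \<beta> - \<alpha> < c.\<close>
    have "F (- a) v = F a v"
    proof (rule Bolzano[of "- a" a "\<lambda>\<alpha> \<beta>. F \<alpha> v = F \<beta> v"])
      show "- a \<le> a" using a by simp
      fix t assume t: "- a \<le> t" "t \<le> a"
      obtain c where c: "c > 0" "\<And>x. x \<in> D \<Longrightarrow> (\<And>k. k \<in> eigenspace t \<Longrightarrow> inner x k = 0) \<Longrightarrow> c * norm x \<le> norm (T x - t *\<^sub>R x)"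
        using gap[OF t] unfolding gap_at_def by auto
      have "F \<alpha> v = F \<beta> v" if ab: "\<alpha> \<le> t" "t \<le> \<beta>" "\<beta> - \<alpha> < c" for \<alpha> \<beta>
      proof (rule ccontr)
        assume ne: "F \<alpha> v \<noteq> F \<beta> v"
        define u where "u = F \<beta> v - F \<alpha> v"
        have "inner u k = 0" if k: "k \<in> eigenspace t" for k
        proof -
          have "F \<beta> k = k" "F \<alpha> k = k \<or> F \<alpha> k = 0"
            using eigenspace_F[OF k] ab by (auto simp: not_less[symmetric])
          then show ?thesis using orth'[OF k t] unfolding u_def by (auto simp: inner_simps F_lin(2))
        qed
        then have "c * norm u \<le> norm (T u - t *\<^sub>R u)"
          using spectral_interval(1)[of \<alpha> \<beta> v] ab unfolding u_def[symmetric] by (intro c(2)) auto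
        also have "\<dots> \<le> (\<beta> - \<alpha>) * norm u"
          unfolding u_def by (rule spectral_interval_shift) (use ab in auto)
        finally show False using ne ab(3) by (simp add: u_def)
      qed
      then show "\<exists>d>0. \<forall>\<alpha> \<beta>. \<alpha> \<le> t \<and> t \<le> \<beta> \<and> \<beta> - \<alpha> < d \<longrightarrow> F \<alpha> v = F \<beta> v" using c(1) by blast
    qed simp
    then show "v = 0" using v a unfolding band_def by (metis (mono_tags) mem_Collect_eq neg_less_0_iff_less)
  qed
  have "band 0 a = span (\<Union>t\<in>\<Theta>. eigenspace t)"
  proof
    show "span (\<Union>t\<in>\<Theta>. eigenspace t) \<subseteq> band 0 a"
      using sub unfolding \<Theta>_def by (intro span_minimal subspace_band) blast
    show "band 0 a \<subseteq> span (\<Union>t\<in>\<Theta>. eigenspace t)"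
    proof
      fix x assume x: "x \<in> band 0 a"
      define Q where "Q = (\<Sum>t\<in>\<Theta>. orth_proj (eigenspace t) x)"
      have P: "orth_proj (eigenspace t) x \<in> eigenspace t" for t
        by (rule orth_proj_in[OF subspace_eigenspace closed_eigenspace])
      have Q: "Q \<in> span (\<Union>t\<in>\<Theta>. eigenspace t)"
        unfolding Q_def using P by (intro span_sum span_base) blast
      have Qb: "Q \<in> band 0 a"
        unfolding Q_def using P sub \<Theta>_def by (intro subspace_sum subspace_band) blast
      have "x - Q = 0"
      proof (rule zero)
        show "x - Q \<in> band 0 a" by (rule subspace_diff[OF subspace_band x Qb])
        fix t k assume t: "t \<in> \<Theta>" and k: "k \<in> eigenspace t"
        have "inner Q k = (\<Sum>s\<in>\<Theta>. if s = t then inner (orth_proj (eigenspace t) x) k else 0)"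
          unfolding Q_def inner_sum_left
          by (rule sum.cong) (auto intro: eigenspace_orthogonal[OF P k])
        also have "\<dots> = inner (orth_proj (eigenspace t) x) k" using \<Theta> t by simp
        finally show "inner (x - Q) k = 0"
          using inner_orth_proj_diff[OF subspace_eigenspace closed_eigenspace k, of x]
          by (simp add: inner_simps)
      qed
      then show "x \<in> span (\<Union>t\<in>\<Theta>. eigenspace t)" using Q by simp
    qed
  qed
  then show "dim (band 0 a) = (\<Sum>t\<in>\<Theta>. dim (eigenspace t))"
    using dim_orthogonal_family[OF \<Theta>, of eigenspace] fin eigenspace_orthogonal unfolding \<Theta>_def by auto
qed

end

section \<open>Continuity of spectral projections\<close>

text \<open>
  With the symmetries \<open>W = 2 P - 1\<close>, the difference \<open>Z = W1 - W2\<close> solves the Sylvester equation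
  \<open>(C1 W1) Z + Z (C2 W2) = (C1 - C2) - W1 (C1 - C2) W2\<close>, whose left hand side is coercive in \<open>Z\<close>.
\<close>

lemma sign_projection_perturbation:
  fixes C1 C2 P1 P2 :: "'a::real_inner \<Rightarrow> 'a"
  assumes C1: "symmetric_op C1" and C2: "symmetric_op C2"
    and P1: "symmetric_op P1" "\<And>x. P1 (P1 x) = P1 x" and P2: "symmetric_op P2" "\<And>x. P2 (P2 x) = P2 x"
    and CP1: "\<And>x. C1 (P1 x) = P1 (C1 x)" and CP2: "\<And>x. C2 (P2 x) = P2 (C2 x)"
    and pos1: "\<And>x. 0 \<le> inner (C1 (2 *\<^sub>R P1 x - x)) x"
    and \<delta>: "\<delta> > 0" and pos2: "\<And>x. \<delta> * (norm x)\<^sup>2 \<le> inner (C2 (2 *\<^sub>R P2 x - x)) x"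
    and \<epsilon>: "\<And>x. norm (C1 x - C2 x) \<le> \<epsilon> * norm x"
  shows "norm (P1 x - P2 x) \<le> \<epsilon> / \<delta> * norm x"
proof (cases "x = 0")
  case True
  then show ?thesis by (simp add: symmetric_opD(6)[OF P1(1)] symmetric_opD(6)[OF P2(1)])
next
  case False
  define W1 W2 where "W1 = (\<lambda>x. 2 *\<^sub>R P1 x - x)" and "W2 = (\<lambda>x. 2 *\<^sub>R P2 x - x)"
  have W1: "symmetric_op W1" and W2: "symmetric_op W2"
    unfolding W1_def W2_def by (intro symmetric_op_diff symmetric_op_scale symmetric_op_ident P1(1) P2(1))+
  note lin = symmetric_opD(3-7)[OF C1] symmetric_opD(3-7)[OF C2] symmetric_opD(3-7)[OF P1(1)]
    symmetric_opD(3-7)[OF P2(1)] symmetric_opD(3-7)[OF W1] symmetric_opD(3-7)[OF W2]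
  have WW1: "W1 (W1 x) = x" and WW2: "W2 (W2 x) = x" for x
    unfolding W1_def W2_def by (simp_all add: lin P1(2) P2(2) algebra_simps scaleR_2)
  have norm_W1: "norm (W1 x) = norm x" and norm_W2: "norm (W2 x) = norm x" for x
    using symmetric_opD(2)[OF W1, of x "W1 x"] symmetric_opD(2)[OF W2, of x "W2 x"]
    by (simp_all add: WW1 WW2 norm_eq_sqrt_inner)
  have CW1: "C1 (W1 x) = W1 (C1 x)" and CW2: "C2 (W2 x) = W2 (C2 x)" for x
    unfolding W1_def W2_def by (simp_all add: lin CP1 CP2)
  define B1 B2 where "B1 = (\<lambda>x. C1 (W1 x))" and "B2 = (\<lambda>x. C2 (W2 x))"
  have B1: "symmetric_op B1" and B2: "symmetric_op B2"
    unfolding B1_def B2_def by (rule symmetric_op_compose[OF C1 W1 CW1] symmetric_op_compose[OF C2 W2 CW2])+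
  obtain M1 M2 where M12: "\<And>x. norm (C1 x) \<le> norm x * M1" "\<And>x. norm (C2 x) \<le> norm x * M2" "M1 > 0" "M2 > 0"
    using bounded_linear.pos_bounded[OF symmetric_opD(1)[OF C1]]
      bounded_linear.pos_bounded[OF symmetric_opD(1)[OF C2]] by blast
  define M where "M = max M1 M2"
  have M: "M > 0" using M12 by (simp add: M_def)
  have "norm (C1 x) \<le> norm x * M" "norm (C2 x) \<le> norm x * M" for x
    using M12(1,2)[of x] mult_left_mono[of M1 M "norm x"] mult_left_mono[of M2 M "norm x"]
    by (auto simp: M_def)
  then have "norm (B1 x) \<le> norm x * M" "norm (B2 x) \<le> norm x * M" for x
    unfolding B1_def B2_def by (metis norm_W1 norm_W2)+
  then have BM: "inner (B1 x) x \<le> M * (norm x)\<^sup>2" "inner (B2 x) x \<le> M * (norm x)\<^sup>2" for x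
    using norm_cauchy_schwarz[of "B1 x" x] norm_cauchy_schwarz[of "B2 x" x]
      mult_right_mono[of "norm (B1 x)" "norm x * M" "norm x"] mult_right_mono[of "norm (B2 x)" "norm x * M" "norm x"]
    by (simp_all add: power2_eq_square mult_ac)
  have pos1': "0 \<le> inner (B1 x) x" and pos2': "\<delta> * (norm x)\<^sup>2 \<le> inner (B2 x) x" for x
    using pos1 pos2 unfolding B1_def B2_def W1_def W2_def by auto
  have "\<delta> * (norm x)\<^sup>2 \<le> M * (norm x)\<^sup>2" using pos2'[of x] BM(2)[of x] by linarith
  then have \<delta>M: "\<delta> \<le> M" using False by simp
  \<comment> \<open>Normalises the positive operators B1 and B2 to \<tau> B \<le> 1/2. Then K1 = 1/2
    - \<tau> B1 has norm at most 1/2, and coercivity of B2 makes the norm of K2 at most 1/2 - \<tau>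
    \<delta>.\<close>
  define \<tau> where "\<tau> = 1 / (2 * M)"
  have \<tau>: "\<tau> > 0" "\<tau> * M = 1/2" unfolding \<tau>_def using M by simp_all
  have \<tau>\<delta>: "\<tau> * \<delta> \<le> 1/2" using mult_left_mono[OF \<delta>M less_imp_le[OF \<tau>(1)]] \<tau>(2) by linarith
  define K1 K2 where "K1 = (\<lambda>x. (1/2) *\<^sub>R x - \<tau> *\<^sub>R B1 x)" and "K2 = (\<lambda>x. (1/2) *\<^sub>R x - \<tau> *\<^sub>R B2 x)"
  have K1: "norm (K1 x) \<le> 1/2 * norm x" for x
  proof (rule symmetric_op_norm_le)
    show "symmetric_op K1" unfolding K1_def by (intro symmetric_op_diff symmetric_op_scale symmetric_op_ident B1)
    show "\<bar>inner (K1 x) x\<bar> \<le> 1/2 * (norm x)\<^sup>2" for x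
    proof -
      have "\<tau> * inner (B1 x) x \<le> 1/2 * (norm x)\<^sup>2"
        using mult_left_mono[OF BM(1)[of x], of \<tau>] \<tau> by (simp add: mult.assoc[symmetric])
      moreover have "0 \<le> \<tau> * inner (B1 x) x" using pos1' \<tau> by simp
      ultimately show ?thesis unfolding K1_def by (simp add: inner_simps power2_norm_eq_inner abs_le_iff)
    qed
  qed
  have K2: "norm (K2 x) \<le> (1/2 - \<tau> * \<delta>) * norm x" for x
  proof (rule symmetric_op_norm_le)
    show "symmetric_op K2" unfolding K2_def by (intro symmetric_op_diff symmetric_op_scale symmetric_op_ident B2)
    show "\<bar>inner (K2 x) x\<bar> \<le> (1/2 - \<tau> * \<delta>) * (norm x)\<^sup>2" for x
    proof -
      have "\<tau> * inner (B2 x) x \<le> 1/2 * (norm x)\<^sup>2"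
        using mult_left_mono[OF BM(2)[of x], of \<tau>] \<tau> by (simp add: mult.assoc[symmetric])
      moreover have "\<tau> * \<delta> * (norm x)\<^sup>2 \<le> \<tau> * inner (B2 x) x"
        using mult_left_mono[OF pos2'[of x], of \<tau>] \<tau> by (simp add: mult.assoc)
      moreover have "inner (K2 x) x = 1/2 * (norm x)\<^sup>2 - \<tau> * inner (B2 x) x"
        unfolding K2_def by (simp add: inner_simps power2_norm_eq_inner)
      moreover have "0 \<le> (1/2 - \<tau> * \<delta>) * (norm x)\<^sup>2"
        using \<tau>\<delta> by (intro mult_nonneg_nonneg) auto
      ultimately show ?thesis by (simp add: left_diff_distrib)
    qed
  qed
  define Z Y where "Z = (\<lambda>x. W1 x - W2 x)" and "Y = (\<lambda>x. (C1 x - C2 x) - W1 (C1 (W2 x) - C2 (W2 x)))"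
  have Z: "bounded_linear Z" unfolding Z_def by (intro bounded_linear_sub symmetric_opD(1)[OF W1] symmetric_opD(1)[OF W2])
  define N where "N = onorm Z"
  have N: "norm (Z x) \<le> N * norm x" for x unfolding N_def by (rule onorm[OF Z])
  have N0: "0 \<le> N" unfolding N_def by (rule onorm_pos_le[OF Z])
  have \<epsilon>0: "0 \<le> \<epsilon>"
  proof -
    have "0 \<le> \<epsilon> * norm x" using \<epsilon>[of x] by (meson norm_ge_zero order_trans)
    then show ?thesis using False by (simp add: zero_le_mult_iff)
  qed
  have Y: "norm (Y x) \<le> 2 * \<epsilon> * norm x" for x
    using norm_triangle_ineq4[of "C1 x - C2 x" "W1 (C1 (W2 x) - C2 (W2 x))"] \<epsilon>[of x] \<epsilon>[of "W2 x"]
    unfolding Y_def norm_W1 norm_W2 by linarith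
  \<comment> \<open>The Sylvester equation B1 Z + Z B2 = Y in fixed-point form, in which Z is
    multiplied by K1 and K2 with total norm at most 1 - \<tau> \<delta>.\<close>
  have eq: "Z x = K1 (Z x) + Z (K2 x) + \<tau> *\<^sub>R Y x" for x
  proof -
    have "B1 (Z x) + Z (B2 x) = Y x"
      unfolding B1_def B2_def Z_def Y_def by (simp add: lin WW1 WW2 CW1 CW2[symmetric] flip: CW2)
    then have "\<tau> *\<^sub>R Y x = \<tau> *\<^sub>R B1 (Z x) + \<tau> *\<^sub>R Z (B2 x)" by (simp flip: scaleR_add_right)
    moreover have "Z (K2 x) = (1/2) *\<^sub>R Z x - \<tau> *\<^sub>R Z (B2 x)"
      unfolding K2_def by (simp add: linear_simps[OF Z])
    ultimately show ?thesis unfolding K1_def by simp (simp flip: scaleR_add_left)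
  qed
  have "N \<le> N * (1 - \<tau> * \<delta>) + 2 * \<tau> * \<epsilon>"
    unfolding N_def
  proof (rule onorm_bound)
    have "0 \<le> 1 - \<tau> * \<delta>" using \<tau>\<delta> by simp
    then show "0 \<le> onorm Z * (1 - \<tau> * \<delta>) + 2 * \<tau> * \<epsilon>"
      using N0 \<tau>(1) \<epsilon>0 unfolding N_def by (intro add_nonneg_nonneg mult_nonneg_nonneg) auto
    fix x
    have "norm (Z x) \<le> norm (K1 (Z x)) + norm (Z (K2 x)) + norm (\<tau> *\<^sub>R Y x)"
      by (subst eq) (meson add_right_mono norm_triangle_ineq order_trans)
    also have "\<dots> \<le> 1/2 * (N * norm x) + N * ((1/2 - \<tau> * \<delta>) * norm x) + \<tau> * (2 * \<epsilon> * norm x)"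
    proof (intro add_mono)
      show "norm (K1 (Z x)) \<le> 1/2 * (N * norm x)" using K1[of "Z x"] N[of x] by simp
      show "norm (Z (K2 x)) \<le> N * ((1/2 - \<tau> * \<delta>) * norm x)"
        using N[of "K2 x"] mult_left_mono[OF K2[of x] N0] by linarith
      show "norm (\<tau> *\<^sub>R Y x) \<le> \<tau> * (2 * \<epsilon> * norm x)" using Y[of x] \<tau>(1) by simp
    qed
    also have "\<dots> = (onorm Z * (1 - \<tau> * \<delta>) + 2 * \<tau> * \<epsilon>) * norm x" unfolding N_def by (simp add: algebra_simps)
    finally show "norm (Z x) \<le> (onorm Z * (1 - \<tau> * \<delta>) + 2 * \<tau> * \<epsilon>) * norm x" .
  qed
  then have "\<tau> * (N * \<delta>) \<le> \<tau> * (2 * \<epsilon>)" by (simp add: algebra_simps)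
  then have "N \<le> 2 * \<epsilon> / \<delta>" using \<tau>(1) \<delta> by (simp add: field_simps)
  then have "norm (Z x) \<le> 2 * \<epsilon> / \<delta> * norm x"
    using N[of x] mult_right_mono[of N "2 * \<epsilon> / \<delta>" "norm x"] by simp
  moreover have "Z x = 2 *\<^sub>R (P1 x - P2 x)" unfolding Z_def W1_def W2_def by (simp add: algebra_simps)
  ultimately show ?thesis by simp
qed

context spectral_resolution
begin

text \<open>Up to the factor \<open>1 + T\<^sup>2\<close>, this bounded operator is \<open>a\<^sup>2 - T\<^sup>2\<close>.\<close>

definition window_op :: "real \<Rightarrow> 'a \<Rightarrow> 'a" where "window_op a x = (1 + a\<^sup>2) *\<^sub>R R x - x"

lemma symmetric_window_op: "symmetric_op (window_op a)"
proof -
  have "symmetric_op (\<lambda>x. (1 + a\<^sup>2) *\<^sub>R R x - x)"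
    by (intro symmetric_op_diff symmetric_op_scale symmetric_op_ident symmetric_R)
  then show ?thesis unfolding window_op_def .
qed

lemma band_proj_commute:
  assumes "a \<le> b"
  shows "band_proj a b (R x) = R (band_proj a b x)" "band_proj a b (S x) = S (band_proj a b x)"
  using commute_T_commute_RS[OF symmetric_opD(1)[OF band_proj_symmetric], of a b] band_proj_reduces[OF assms]
  by auto

text \<open>For z = R x the operator yields (a^2 - T^2) z, while x = (1 + T^2) z. The pairing
  expands into the form a^2 |v|^2 - |T v|^2 at v = z = R x and at v = T z = S x.\<close>

lemma inner_window_op:
  "inner (window_op a x) x = (a\<^sup>2 * (norm (R x))\<^sup>2 - (norm (T (R x)))\<^sup>2) + (a\<^sup>2 * (norm (S x))\<^sup>2 - (norm (T (S x)))\<^sup>2)"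
proof -
  define z where "z = R x"
  have Tz: "T z = S x" and TTz: "T (S x) = x - z" using RS unfolding z_def by auto
  have x: "x = z + T (S x)" using TTz by simp
  have "window_op a x = a\<^sup>2 *\<^sub>R z - T (S x)" unfolding window_op_def TTz z_def by (simp add: algebra_simps)
  then have "inner (window_op a x) x = inner (a\<^sup>2 *\<^sub>R z - T (S x)) (z + T (S x))" using x by simp
  moreover have "inner z (T (S x)) = (norm (S x))\<^sup>2"
    using T_sym[of z "S x"] RS by (simp add: z_def power2_norm_eq_inner)
  moreover have "inner (T (S x)) z = (norm (S x))\<^sup>2"
    using \<open>inner z (T (S x)) = (norm (S x))\<^sup>2\<close> by (simp add: inner_commute)
  ultimately show ?thesis
    using Tz unfolding z_def[symmetric] by (simp add: inner_simps power2_norm_eq_inner algebra_simps)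
qed

text \<open>R and S preserve the band and its complement, on which |T v| \<le> a |v| and |T v| \<ge>
  a |v| respectively; the symmetry 2 P - 1 reverses the sign on the complement.\<close>

lemma window_op_sign:
  assumes a: "0 \<le> a"
  shows "0 \<le> inner (window_op a (2 *\<^sub>R band_proj (- a) a x - x)) x"
proof -
  let ?P = "band_proj (- a) a" and ?C = "window_op a"
  have ab: "- a \<le> a" using a by simp
  note P = symmetric_opD[OF band_proj_symmetric, of "- a" a]
  note C = symmetric_opD[OF symmetric_window_op, of a]
  have CP: "?C (?P x) = ?P (?C x)" for x
    unfolding window_op_def by (simp add: P band_proj_commute[OF ab])
  have pos: "0 \<le> inner (?C x) x" if x: "?P x = x" for x
  proof -
    have "R x \<in> band (- a) a" "S x \<in> band (- a) a"
      using band_proj_in[of "- a" a "R x"] band_proj_in[of "- a" a "S x"] by (simp_all add: band_proj_commute[OF ab] x)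
    then have "norm (T (R x)) \<le> a * norm (R x)" "norm (T (S x)) \<le> a * norm (S x)"
      using norm_T_band_le[OF a] by auto
    then have "(norm (T (R x)))\<^sup>2 \<le> (a * norm (R x))\<^sup>2" "(norm (T (S x)))\<^sup>2 \<le> (a * norm (S x))\<^sup>2"
      by (intro power_mono; simp)+
    then show ?thesis unfolding inner_window_op by (simp add: power_mult_distrib)
  qed
  have neg: "inner (?C x) x \<le> 0" if x: "?P x = 0" for x
  proof -
    have "?P (R x) = 0" "?P (S x) = 0"
      by (simp_all add: band_proj_commute[OF ab] x symmetric_opD(6)[OF symmetric_R] symmetric_opD(6)[OF symmetric_S])
    then have "a * norm (R x) \<le> norm (T (R x))" "a * norm (S x) \<le> norm (T (S x))"
      using norm_T_compl_band_ge[OF a RS(1)] norm_T_compl_band_ge[OF a RS(3)] by blast+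
    then have "(a * norm (R x))\<^sup>2 \<le> (norm (T (R x)))\<^sup>2" "(a * norm (S x))\<^sup>2 \<le> (norm (T (S x)))\<^sup>2"
      using a by (intro power_mono; simp)+
    then show ?thesis unfolding inner_window_op by (simp add: power_mult_distrib)
  qed
  define u v where "u = ?P x" and "v = x - ?P x"
  have uv: "?P u = u" "?P v = 0" unfolding u_def v_def by (simp_all add: P band_proj_idem)
  have x: "x = u + v" and W: "2 *\<^sub>R ?P x - x = u - v" unfolding u_def v_def by (simp_all add: scaleR_2)
  have "inner (?C u) v = 0"
    using P(2)[of "?C u" v] CP[of u] uv by simp
  moreover have "inner (?C v) u = 0" using \<open>inner (?C u) v = 0\<close> C(2)[of u v] by (simp add: inner_commute)
  ultimately have "inner (?C (u - v)) (u + v) = inner (?C u) u - inner (?C v) v"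
    by (simp add: C inner_add_right inner_diff_left)
  then show ?thesis unfolding W using x pos[OF uv(1)] neg[OF uv(2)] by simp
qed

lemma gap_eigenspace_trivial:
  assumes "gap_at t" "eigenspace t = {0}"
  shows "\<exists>c>0. \<forall>x\<in>D. c * norm x \<le> norm (T x - t *\<^sub>R x)"
  using assms unfolding gap_at_def by auto

text \<open>Up to sign the window operator is (T - a) (T + a) R, so the lower bounds at a and - a
  combine to |C y| \<ge> c |y|. For a positive operator with upper bound M this yields a form
  bounded below by c^2 / M.\<close>

lemma window_op_coercive:
  assumes a: "0 \<le> a" and gap: "gap_at a" "gap_at (- a)" and triv: "eigenspace a = {0}" "eigenspace (- a) = {0}"
  shows "\<exists>\<delta>>0. \<forall>x. \<delta> * (norm x)\<^sup>2 \<le> inner (window_op a (2 *\<^sub>R band_proj (- a) a x - x)) x"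
proof -
  let ?P = "band_proj (- a) a" and ?C = "window_op a"
  have ab: "- a \<le> a" using a by simp
  obtain c1 where c1: "c1 > 0" "\<And>x. x \<in> D \<Longrightarrow> c1 * norm x \<le> norm (T x - a *\<^sub>R x)"
    using gap_eigenspace_trivial[OF gap(1) triv(1)] by blast
  obtain c2 where c2: "c2 > 0" "\<And>x. x \<in> D \<Longrightarrow> c2 * norm x \<le> norm (T x - (- a) *\<^sub>R x)"
    using gap_eigenspace_trivial[OF gap(2) triv(2)] by blast
  define c where "c = inverse ((1 + a\<^sup>2) / (c1 * c2) + 1)"
  have c: "c > 0" unfolding c_def using c1(1) c2(1) by (simp add: add_nonneg_pos)
  have C_below: "c * norm y \<le> norm (?C y)" for y
  proof -
    \<comment> \<open>w = (T + a) z, so that (T - a) w = - C y. The two lower bounds are applied to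
      w and then to z.\<close>
    define z w where "z = R y" and "w = S y + a *\<^sub>R z"
    have zD: "z \<in> D" "T z = S y" unfolding z_def using RS by auto
    have wD: "w \<in> D" unfolding w_def using zD RS subD by (intro subspace_add subspace_scale)
    have "T w - a *\<^sub>R w = y - z - a\<^sup>2 *\<^sub>R z"
      unfolding w_def using zD subD RS
      by (simp add: T_add T_scale subspace_scale power2_eq_square algebra_simps) (simp add: z_def)
    also have "\<dots> = - ?C y" unfolding window_op_def z_def by (simp add: algebra_simps)
    finally have "c1 * norm w \<le> norm (?C y)" using c1(2)[OF wD] by simp
    moreover have "c2 * norm z \<le> norm w" using c2(2)[OF zD(1)] zD(2) by (simp add: w_def)
    ultimately have "c1 * (c2 * norm z) \<le> norm (?C y)"
      using c1(1) by (meson less_imp_le mult_left_mono order_trans)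
    then have nz: "norm z \<le> norm (?C y) / (c1 * c2)" using c1(1) c2(1) by (simp add: field_simps)
    have "y = (1 + a\<^sup>2) *\<^sub>R z - ?C y" unfolding window_op_def z_def by simp
    then have "norm y \<le> norm ((1 + a\<^sup>2) *\<^sub>R z) + norm (?C y)" by (metis norm_triangle_ineq4)
    also have "norm ((1 + a\<^sup>2) *\<^sub>R z) = (1 + a\<^sup>2) * norm z" by (simp add: add_nonneg_nonneg)
    also have "\<dots> \<le> (1 + a\<^sup>2) * (norm (?C y) / (c1 * c2))" by (intro mult_left_mono nz) simp
    finally have "norm y \<le> ((1 + a\<^sup>2) / (c1 * c2) + 1) * norm (?C y)" by (simp add: algebra_simps)
    moreover have "(1 + a\<^sup>2) / (c1 * c2) + 1 > 0" using c1(1) c2(1) by (simp add: add_nonneg_pos)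
    ultimately show ?thesis unfolding c_def by (simp add: field_simps)
  qed
  note P = symmetric_opD[OF band_proj_symmetric, of "- a" a]
  define W where "W = (\<lambda>x. 2 *\<^sub>R ?P x - x)"
  have W: "symmetric_op W" unfolding W_def by (intro symmetric_op_diff symmetric_op_scale symmetric_op_ident band_proj_symmetric)
  have WW: "W (W x) = x" for x unfolding W_def by (simp add: P band_proj_idem algebra_simps scaleR_2)
  have norm_W: "norm (W x) = norm x" for x
    using symmetric_opD(2)[OF W, of x "W x"] by (simp add: WW norm_eq_sqrt_inner)
  have CW: "?C (W x) = W (?C x)" for x
    unfolding W_def window_op_def
    by (simp add: P band_proj_commute[OF ab] symmetric_opD[OF symmetric_R] algebra_simps)
  have B: "positive_op (\<lambda>x. ?C (W x))"
    unfolding positive_op_def using symmetric_op_compose[OF symmetric_window_op W CW] window_op_sign[OF a]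
    by (simp add: W_def)
  obtain M where M: "M > 0" "\<And>x. norm (?C x) \<le> norm x * M"
    using bounded_linear.pos_bounded[OF symmetric_opD(1)[OF symmetric_window_op[of a]]] by blast
  have le: "inner (?C (W x)) x \<le> M * (norm x)\<^sup>2" for x
    using norm_cauchy_schwarz[of "?C (W x)" x] mult_right_mono[OF M(2)[of "W x"] norm_ge_zero[of x]]
    by (simp add: norm_W power2_eq_square mult_ac)
  have "c\<^sup>2 / M * (norm x)\<^sup>2 \<le> inner (?C (W x)) x" for x
  proof -
    have "(c * norm x)\<^sup>2 \<le> (norm (?C (W x)))\<^sup>2" using C_below[of "W x"] c by (intro power_mono) (simp_all add: norm_W)
    also have "\<dots> \<le> M * inner (?C (W x)) x" by (rule positive_op_norm_le[OF B M(1) le])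
    finally show ?thesis using M(1) by (simp add: field_simps power_mult_distrib)
  qed
  then show ?thesis using c M(1) unfolding W_def by (intro exI[of _ "c\<^sup>2 / M"]) simp
qed

end

lemma gap_dist_resolvent:
  fixes T S :: "'h::complex_hilbert_space operator"
  assumes T: "selfadjoint T" and S: "selfadjoint S"
  shows "norm (sa_operator.R (op_dom T) (op_fun T) x - sa_operator.R (op_dom S) (op_fun S) x) \<le> gap_dist T S * norm x"
proof -
  interpret T: sa_operator "op_dom T" "op_fun T" by (rule selfadjoint_imp_sa_operator[OF T])
  interpret S: sa_operator "op_dom S" "op_fun S" by (rule selfadjoint_imp_sa_operator[OF S])
  let ?f = "\<lambda>z. orth_proj T.graph z - orth_proj S.graph z"
  have bl: "bounded_linear ?f"
    by (intro bounded_linear_sub bounded_linear_orth_proj T.subspace_graph T.closed_graph S.subspace_graph S.closed_graph)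
  have "norm (T.R x - S.R x) = norm (fst (?f (x, 0)))" unfolding T.R_def S.R_def by simp
  also have "\<dots> \<le> norm (?f (x, 0))" using norm_fst_le[of "fst (?f (x, 0))" "snd (?f (x, 0))"] by (simp only: prod.collapse)
  also have "\<dots> \<le> onorm ?f * norm (x, 0 :: 'h)" by (rule onorm[OF bl])
  finally show ?thesis
    unfolding gap_dist_def op_graph_conv_graph[OF T] op_graph_conv_graph[OF S] by (simp add: norm_prod_def)
qed

text \<open>Coercivity is established at the fixed parameter t; at the varying s, nonnegativity
  suffices. So \<delta> does not depend on s, and the bound is a constant multiple of the gap
  distance.\<close>

lemma spectral_proj_tendsto:
  fixes A :: "real \<Rightarrow> 'h::complex_hilbert_space operator"
  assumes sa: "\<And>s. s \<in> I \<Longrightarrow> selfadjoint (A s)" and t: "t \<in> I" and a: "0 \<le> a"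
    and lim: "((\<lambda>s. gap_dist (A s) (A t)) \<longlongrightarrow> 0) (at t within I)"
    and gap: "sa_operator.gap_at (op_dom (A t)) (op_fun (A t)) a" "sa_operator.gap_at (op_dom (A t)) (op_fun (A t)) (- a)"
    and triv: "sa_operator.eigenspace (op_dom (A t)) (op_fun (A t)) a = {0}"
      "sa_operator.eigenspace (op_dom (A t)) (op_fun (A t)) (- a) = {0}"
  shows "((\<lambda>s. onorm (\<lambda>x. spectral_proj {- a..a} (A s) x - spectral_proj {- a..a} (A t) x)) \<longlongrightarrow> 0) (at t within I)"
proof -
  have ab: "- a \<le> a" using a by simp
  interpret t: spectral_resolution "op_dom (A t)" "op_fun (A t)" "spectral_family_of (A t)"
    by (rule spectral_family_of[OF sa[OF t]])
  obtain \<delta> where \<delta>: "\<delta> > 0" "\<And>x. \<delta> * (norm x)\<^sup>2 \<le> inner (t.window_op a (2 *\<^sub>R t.band_proj (- a) a x - x)) x"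
    using t.window_op_coercive[OF a gap triv] by blast
  have bound: "onorm (\<lambda>x. spectral_proj {- a..a} (A s) x - spectral_proj {- a..a} (A t) x)
      \<le> (1 + a\<^sup>2) * gap_dist (A s) (A t) / \<delta>"
    and nonneg: "0 \<le> onorm (\<lambda>x. spectral_proj {- a..a} (A s) x - spectral_proj {- a..a} (A t) x)"
    if s: "s \<in> I" for s
  proof -
    interpret s: spectral_resolution "op_dom (A s)" "op_fun (A s)" "spectral_family_of (A s)"
      by (rule spectral_family_of[OF sa[OF s]])
    have eq: "spectral_proj {- a..a} (A s) = s.band_proj (- a) a" "spectral_proj {- a..a} (A t) = t.band_proj (- a) a"
      by (rule spectral_proj_Icc[OF sa ab], fact)+
    have Ps: "s.band_proj (- a) a (s.window_op a x) = s.window_op a (s.band_proj (- a) a x)" for x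
      unfolding s.window_op_def
      by (simp add: symmetric_opD[OF s.band_proj_symmetric] s.band_proj_commute[OF ab])
    have Pt: "t.band_proj (- a) a (t.window_op a x) = t.window_op a (t.band_proj (- a) a x)" for x
      unfolding t.window_op_def
      by (simp add: symmetric_opD[OF t.band_proj_symmetric] t.band_proj_commute[OF ab])
    have close: "norm (s.window_op a x - t.window_op a x) \<le> (1 + a\<^sup>2) * gap_dist (A s) (A t) * norm x" for x
    proof -
      have "s.window_op a x - t.window_op a x = (1 + a\<^sup>2) *\<^sub>R (s.R x - t.R x)"
        unfolding s.window_op_def t.window_op_def by (simp add: algebra_simps)
      then have "norm (s.window_op a x - t.window_op a x) = (1 + a\<^sup>2) * norm (s.R x - t.R x)"
        by (simp add: add_nonneg_nonneg)
      also have "\<dots> \<le> (1 + a\<^sup>2) * (gap_dist (A s) (A t) * norm x)"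
        by (intro mult_left_mono gap_dist_resolvent sa s t) simp
      finally show ?thesis by (simp add: mult.assoc)
    qed
    have "norm (s.band_proj (- a) a x - t.band_proj (- a) a x) \<le> (1 + a\<^sup>2) * gap_dist (A s) (A t) / \<delta> * norm x" for x
      by (rule sign_projection_perturbation[OF s.symmetric_window_op t.symmetric_window_op
            s.band_proj_symmetric s.band_proj_idem t.band_proj_symmetric t.band_proj_idem
            Ps[symmetric] Pt[symmetric] s.window_op_sign[OF a] \<delta> close])
    moreover have "0 \<le> gap_dist (A s) (A t)"
      unfolding gap_dist_def op_graph_conv_graph[OF sa[OF s]] op_graph_conv_graph[OF sa[OF t]]
      by (intro onorm_pos_le bounded_linear_sub bounded_linear_orth_proj
          s.subspace_graph s.closed_graph t.subspace_graph t.closed_graph)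
    ultimately show "onorm (\<lambda>x. spectral_proj {- a..a} (A s) x - spectral_proj {- a..a} (A t) x)
      \<le> (1 + a\<^sup>2) * gap_dist (A s) (A t) / \<delta>"
      unfolding eq using \<delta>(1) by (intro onorm_bound) auto
    show "0 \<le> onorm (\<lambda>x. spectral_proj {- a..a} (A s) x - spectral_proj {- a..a} (A t) x)"
      unfolding eq by (intro onorm_pos_le bounded_linear_sub symmetric_opD(1)[OF s.band_proj_symmetric]
          symmetric_opD(1)[OF t.band_proj_symmetric])
  qed
  have "((\<lambda>s. (1 + a\<^sup>2) * gap_dist (A s) (A t) / \<delta>) \<longlongrightarrow> (1 + a\<^sup>2) * 0 / \<delta>) (at t within I)"
    by (intro tendsto_intros lim) (use \<delta> in auto)
  then have "((\<lambda>s. (1 + a\<^sup>2) * gap_dist (A s) (A t) / \<delta>) \<longlongrightarrow> 0) (at t within I)" by simp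
  then show ?thesis
    by (rule tendsto_sandwich[OF _ _ tendsto_const, rotated 2])
      (use bound nonneg in \<open>auto simp: eventually_at_filter\<close>)
qed

text \<open>Closed range follows from finite codimension through the lower bound off the kernel. The
  right-hand side is then the condition that also characterises Fredholm pairs.\<close>

lemma fredholm_shift_iff:
  fixes T :: "'h::complex_hilbert_space operator"
  fixes t :: real
  assumes T: "selfadjoint T"
  defines "Rg \<equiv> (\<lambda>x. op_fun T x - t *\<^sub>R x) ` op_dom T"
  shows "fredholm (shift_operator T (complex_of_real t)) \<longleftrightarrow>
    finite_dimensional (sa_operator.eigenspace (op_dom T) (op_fun T) t) \<and> finite_codimensional Rg"
proof -
  interpret sa_operator "op_dom T" "op_fun T" by (rule selfadjoint_imp_sa_operator[OF T])
  let ?S = "shift_operator T (complex_of_real t)"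
  have S: "op_dom ?S = op_dom T" "op_fun ?S = (\<lambda>x. op_fun T x - t *\<^sub>R x)"
    by (auto simp: shift_operator_def scaleR_scaleC)
  have "linear_operator T" using T by (simp add: selfadjoint_def)
  moreover have "c *\<^sub>C (x - t *\<^sub>R y) = c *\<^sub>C x - t *\<^sub>R c *\<^sub>C y" for c and x y :: 'h
  proof -
    have "c *\<^sub>C t *\<^sub>R y = t *\<^sub>R c *\<^sub>C y" by (simp add: scaleR_scaleC scaleC_scaleC mult.commute)
    then show ?thesis using scaleC_add_right[of c "x - t *\<^sub>R y" "t *\<^sub>R y"] by (simp add: eq_diff_eq)
  qed
  ultimately have "linear_operator ?S"
    unfolding linear_operator_def S by (simp add: scaleR_add_right)
  moreover have "closed (op_graph ?S)"
  proof (rule closed_sequential_limits[THEN iffD2], intro allI impI, elim conjE)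
    fix z l assume z: "\<forall>n. z n \<in> op_graph ?S" and l: "z \<longlonglongrightarrow> l"
    have fz: "fst (z n) \<in> op_dom T" "snd (z n) = op_fun T (fst (z n)) - t *\<^sub>R fst (z n)" for n
      using z[rule_format, of n] unfolding op_graph_def S by auto
    have "fst l \<in> op_dom T" "op_fun T (fst l) - t *\<^sub>R fst l = snd l"
      using shift_limit[of "\<lambda>n. fst (z n)" "fst l" t "snd l"] fz tendsto_fst[OF l] tendsto_snd[OF l] by auto
    then show "l \<in> op_graph ?S" unfolding op_graph_def S by (metis (mono_tags, lifting) mem_Collect_eq prod.collapse)
  qed
  moreover have "{x \<in> op_dom ?S. op_fun ?S x = 0} = eigenspace t" unfolding S eigenspace_def by auto
  moreover have "closed Rg" if "finite_codimensional Rg"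
    using gap_imp_closed_range[OF finite_codimensional_imp_gap[of t]] that unfolding Rg_def by blast
  ultimately show ?thesis unfolding fredholm_def S Rg_def by auto
qed

lemma resolvent_set_imp_eigenspace_trivial:
  fixes T :: "'h::complex_hilbert_space operator"
  assumes T: "selfadjoint T" and t: "complex_of_real t \<notin> spectrum T"
  shows "sa_operator.eigenspace (op_dom T) (op_fun T) t = {0}"
proof -
  interpret sa_operator "op_dom T" "op_fun T" by (rule selfadjoint_imp_sa_operator[OF T])
  let ?S = "shift_operator T (complex_of_real t)"
  have S: "op_fun ?S = (\<lambda>x. op_fun T x - t *\<^sub>R x)" by (auto simp: shift_operator_def scaleR_scaleC)
  have "inj_on (op_fun ?S) (op_dom T)"
    using t unfolding spectrum_def resolvent_set_def by (auto intro: bij_betw_imp_inj_on)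
  moreover have "0 \<in> op_dom T" using subD by (rule subspace_0)
  ultimately show ?thesis
    unfolding inj_on_def S eigenspace_def by (auto simp: T_0)
qed

lemma gap_imp_resolvent_set:
  fixes T :: "'h::complex_hilbert_space operator"
  assumes T: "selfadjoint T"
    and gap: "sa_operator.gap_at (op_dom T) (op_fun T) t"
    and triv: "sa_operator.eigenspace (op_dom T) (op_fun T) t = {0}"
  shows "complex_of_real t \<notin> spectrum T"
proof -
  interpret sa_operator "op_dom T" "op_fun T" by (rule selfadjoint_imp_sa_operator[OF T])
  let ?D = "op_dom T" and ?f = "\<lambda>x. op_fun T x - t *\<^sub>R x"
  have S: "op_fun (shift_operator T (complex_of_real t)) = ?f" by (auto simp: shift_operator_def scaleR_scaleC)
  have add: "?f (x + y) = ?f x + ?f y" and diff: "?f (x - y) = ?f x - ?f y" if "x \<in> ?D" "y \<in> ?D" for x y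
    using that by (simp_all add: T_add T_diff algebra_simps)
  have inj: "inj_on ?f ?D"
  proof (rule inj_onI)
    fix x y assume xy: "x \<in> ?D" "y \<in> ?D" "?f x = ?f y"
    then have "x - y \<in> eigenspace t" using diff[of x y] subD unfolding eigenspace_def by (simp add: subspace_diff)
    then show "x = y" using triv by simp
  qed
  have surj: "?f ` ?D = UNIV" by (rule gap_imp_surj[OF gap triv])
  define g where "g = inv_into ?D ?f"
  have gD: "g y \<in> ?D" and fg: "?f (g y) = y" for y
    unfolding g_def using surj by (auto intro: inv_into_into f_inv_into_f)
  have gf: "g (?f x) = x" if "x \<in> ?D" for x unfolding g_def by (rule inv_into_f_f[OF inj that])
  obtain c where c: "c > 0" "\<And>x. x \<in> ?D \<Longrightarrow> c * norm x \<le> norm (?f x)"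
    using gap triv unfolding gap_at_def by auto
  have "bounded_linear g"
  proof (rule bounded_linear_intro[where K="inverse c"])
    show "g (x + y) = g x + g y" for x y
      using gf[of "g x + g y"] add[OF gD gD, of x y] subD gD by (simp add: fg subspace_add)
    show "g (r *\<^sub>R x) = r *\<^sub>R g x" for r x
    proof -
      have "?f (r *\<^sub>R g x) = r *\<^sub>R ?f (g x)" using gD[of x] by (simp add: T_scale algebra_simps)
      then show ?thesis using gf[of "r *\<^sub>R g x"] subD gD by (simp add: fg subspace_scale)
    qed
    show "norm (g x) \<le> norm x * inverse c" for x
      using c(2)[OF gD[of x]] c(1) by (simp add: fg field_simps)
  qed
  moreover have "g (\<i> *\<^sub>C x) = \<i> *\<^sub>C g x" for x
  proof -
    have "?f (\<i> *\<^sub>C g x) = \<i> *\<^sub>C ?f (g x)"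
      using selfadjoint_ii[OF T gD[of x]] by (simp add: ii_simps)
    then show ?thesis using gf[of "\<i> *\<^sub>C g x"] selfadjoint_ii[OF T gD[of x]] by (simp add: fg)
  qed
  ultimately have "bounded_clinear g" unfolding bounded_clinear_iff by blast
  moreover have "bij_betw ?f ?D UNIV" unfolding bij_betw_def using inj surj by blast
  ultimately show ?thesis unfolding spectrum_def resolvent_set_def g_def by (simp add: S)
qed

section \<open>Rotated graphs\<close>

text \<open>Euler's formula: as J^2 = - 1, the recursions of the cosine and sine coefficients match
  multiplication of the series by - \<theta> J.\<close>

lemma op_exp_complex_structure:
  fixes J :: "'e::{real_inner,complete_space} \<Rightarrow> 'e"
  assumes J: "bounded_linear J" and JJ: "\<And>u. J (J u) = - u"
  shows "op_exp (\<lambda>u. - \<theta> *\<^sub>R J u) u = cos \<theta> *\<^sub>R u - sin \<theta> *\<^sub>R J u"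
proof -
  define B where "B = (\<lambda>u. - \<theta> *\<^sub>R J u)"
  note lin = linear_simps[OF J]
  have summand: "(B ^^ n) u /\<^sub>R fact n = (cos_coeff n *\<^sub>R \<theta> ^ n) *\<^sub>R u - (sin_coeff n *\<^sub>R \<theta> ^ n) *\<^sub>R J u" for n
  proof (induction n)
    case 0
    show ?case by simp
  next
    case (Suc n)
    have "(B ^^ Suc n) u /\<^sub>R fact (Suc n) = B ((B ^^ n) u /\<^sub>R fact n) /\<^sub>R real (Suc n)"
      unfolding B_def by (simp add: lin mult_ac del: of_nat_Suc)
    also have "\<dots> = (cos_coeff (Suc n) *\<^sub>R \<theta> ^ Suc n) *\<^sub>R u - (sin_coeff (Suc n) *\<^sub>R \<theta> ^ Suc n) *\<^sub>R J u"
      unfolding Suc.IH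
      by (simp add: B_def lin JJ sin_coeff_Suc cos_coeff_Suc scaleR_diff_right scaleR_add_right divide_inverse mult_ac del: of_nat_Suc)
    finally show ?case .
  qed
  have "(\<lambda>n. (cos_coeff n *\<^sub>R \<theta> ^ n) *\<^sub>R u - (sin_coeff n *\<^sub>R \<theta> ^ n) *\<^sub>R J u) sums (cos \<theta> *\<^sub>R u - sin \<theta> *\<^sub>R J u)"
    by (intro sums_diff bounded_linear.sums[OF bounded_linear_scaleR_left] cos_converges sin_converges)
  then show ?thesis
    unfolding op_exp_def B_def[symmetric] summand[symmetric] by (rule sums_unique[symmetric])
qed

lemma symplectic_standard_J: "symplectic_structure (standard_J :: 'h::complex_hilbert_space \<times> 'h \<Rightarrow> _)"
  unfolding symplectic_structure_def
proof (intro conjI allI)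
  have "bounded_linear (\<lambda>u :: 'h \<times> 'h. (- snd u, fst u))"
    by (intro bounded_linear_Pair bounded_linear_minus bounded_linear_fst bounded_linear_snd)
  then show "bounded_linear (standard_J :: 'h \<times> 'h \<Rightarrow> _)" by (simp add: standard_J_def case_prod_unfold)
qed (auto simp: standard_J_def case_prod_unfold inner_prod_def prod_eq_iff)

lemma lagrangian_horizontal: "lagrangian standard_J (horizontal_lagrangian :: ('h::complex_hilbert_space \<times> 'h) set)"
  unfolding lagrangian_def
proof
  show "subspace (horizontal_lagrangian :: ('h \<times> 'h) set)"
    unfolding horizontal_lagrangian_def by (intro subspace_Times) (auto simp: subspace_0 subspace_def)
  have "(a, b) \<in> horizontal_lagrangian\<^sup>\<bottom> \<longleftrightarrow> a = 0" for a b :: 'h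
    unfolding orthogonal_comp_def orthogonal_def horizontal_lagrangian_def
    by (auto simp: inner_prod_def) (metis inner_eq_zero_iff)
  then show "(horizontal_lagrangian :: ('h \<times> 'h) set)\<^sup>\<bottom> = standard_J ` horizontal_lagrangian"
    unfolding horizontal_lagrangian_def standard_J_def by (force simp: image_iff)
qed

text \<open>Orthogonality of (a, b) to the graph says <T x, b> = <x, - a> for all x in the domain.
  By maximality b lies in the domain and T b = - a, that is, (a, b) = J (b, T b).\<close>

lemma lagrangian_op_graph:
  assumes T: "selfadjoint T" shows "lagrangian standard_J (op_graph T)"
  unfolding lagrangian_def
proof
  interpret sa_operator "op_dom T" "op_fun T" by (rule selfadjoint_imp_sa_operator[OF T])
  show "subspace (op_graph T)" unfolding op_graph_conv_graph[OF T] by (rule subspace_graph)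
  have "(a, b) \<in> (op_graph T)\<^sup>\<bottom> \<longleftrightarrow> (a, b) \<in> standard_J ` op_graph T" for a b
  proof
    assume "(a, b) \<in> (op_graph T)\<^sup>\<bottom>"
    then have "inner x a + inner (op_fun T x) b = 0" if "x \<in> op_dom T" for x
      using that unfolding orthogonal_comp_def orthogonal_def op_graph_def by fastforce
    then have "b \<in> op_dom T \<and> op_fun T b = - a"
      by (intro T_max) (simp add: eq_neg_iff_add_eq_0 add.commute)
    then have "(b, - a) \<in> op_graph T" by (auto simp: op_graph_def)
    then show "(a, b) \<in> standard_J ` op_graph T" by (force simp: standard_J_def image_iff)
  next
    assume "(a, b) \<in> standard_J ` op_graph T"
    then have "b \<in> op_dom T" "a = - op_fun T b" by (auto simp: standard_J_def op_graph_def)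
    then show "(a, b) \<in> (op_graph T)\<^sup>\<bottom>"
      unfolding orthogonal_comp_def orthogonal_def op_graph_def by (auto simp: T_sym)
  qed
  then show "(op_graph T)\<^sup>\<bottom> = standard_J ` op_graph T" by auto
qed

lemma finite_dimensional_image:
  assumes f: "linear f" and V: "finite_dimensional V" shows "finite_dimensional (f ` V)"
proof -
  obtain B where "finite B" "span B = V" using V unfolding finite_dimensional_def by blast
  then show ?thesis
    unfolding finite_dimensional_def using linear_span_image[OF f, of B] by (intro exI[of _ "f ` B"]) auto
qed

lemma dim_Times_0:
  fixes V :: "'a::real_vector set"
  assumes V: "finite_dimensional V"
  shows "dim ((\<lambda>x. (x, 0::'b::real_vector)) ` V) = dim V"
proof -
  let ?f = "\<lambda>x::'a. (x, 0::'b)"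
  have f: "linear ?f" by (intro linearI) auto
  obtain B where B: "independent B" "span B = V" "card B = dim V"
    by (rule finite_dimensional_basis[OF V])
  have "independent (?f ` B)"
    by (rule linear_independent_injective_image[OF f B(1)]) (auto simp: inj_on_def)
  then have "dim (span (?f ` B)) = card (?f ` B)" by (rule dim_span_eq_card_independent)
  also have "\<dots> = dim V" using B(3) by (simp add: card_image inj_on_def)
  also have "span (?f ` B) = ?f ` V" using linear_span_image[OF f] B(2) by simp
  finally show ?thesis .
qed

lemma finite_codimensional_UNIV_Times:
  fixes R :: "'a::real_vector set"
  assumes R: "0 \<in> R"
  shows "finite_codimensional ((UNIV :: 'b::real_vector set) \<times> R) \<longleftrightarrow> finite_codimensional R"
proof
  assume "finite_codimensional ((UNIV :: 'b set) \<times> R)"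
  then obtain B :: "('b \<times> 'a) set" where B: "finite B" "span (UNIV \<times> R \<union> B) = UNIV"
    unfolding finite_codimensional_def by blast
  have snd: "linear (snd :: 'b \<times> 'a \<Rightarrow> 'a)" by (intro linearI) auto
  have "span (snd ` (UNIV \<times> R \<union> B)) = UNIV"
    unfolding linear_span_image[OF snd] B(2) by (simp add: surj_def)
  moreover have "snd ` (UNIV \<times> R \<union> B) = R \<union> snd ` B" by (force simp: image_Un)
  ultimately show "finite_codimensional R"
    unfolding finite_codimensional_def using B(1) by (intro exI[of _ "snd ` B"]) auto
next
  assume "finite_codimensional R"
  then obtain B where B: "finite B" "span (R \<union> B) = UNIV"
    unfolding finite_codimensional_def by blast
  let ?\<iota> = "\<lambda>y::'a. (0::'b, y)"
  let ?U = "(UNIV :: 'b set) \<times> R \<union> ?\<iota> ` B"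
  have \<iota>: "linear ?\<iota>" by (intro linearI) auto
  have sub: "?\<iota> ` (R \<union> B) \<subseteq> ?U" by auto
  have "(x, y) \<in> span ?U" for x y
  proof -
    have "(0, y) \<in> ?\<iota> ` span (R \<union> B)" using B(2) by simp
    then have y: "(0, y) \<in> span ?U"
      unfolding linear_span_image[OF \<iota>, symmetric] using span_mono[OF sub] by blast
    have xr: "(x, 0) \<in> span ?U" using R by (intro span_base) simp
    from span_add[OF xr y] show ?thesis by simp
  qed
  then show "finite_codimensional ((UNIV :: 'b set) \<times> R)"
    unfolding finite_codimensional_def using B(1) by (intro exI[of _ "?\<iota> ` B"]) auto
qed

lemma rotate_op_graph:
  fixes T :: "'h::complex_hilbert_space operator"
  shows "rotate_subspace standard_J \<theta> (op_graph T) =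
    (\<lambda>x. (cos \<theta> *\<^sub>R x + sin \<theta> *\<^sub>R op_fun T x, cos \<theta> *\<^sub>R op_fun T x - sin \<theta> *\<^sub>R x)) ` op_dom T"
proof -
  have J: "bounded_linear (standard_J :: 'h \<times> 'h \<Rightarrow> _)" "\<And>u :: 'h \<times> 'h. standard_J (standard_J u) = - u"
    using symplectic_standard_J unfolding symplectic_structure_def by blast+
  show ?thesis
    unfolding rotate_subspace_def op_exp_complex_structure[OF J] op_graph_def
    by (force simp: standard_J_def image_iff)
qed

lemma
  fixes T :: "'h::complex_hilbert_space operator"
  assumes T: "selfadjoint T" and \<theta>: "\<bar>\<theta>\<bar> < pi / 2"
  defines "\<K> \<equiv> sa_operator.eigenspace (op_dom T) (op_fun T) (tan \<theta>)"
  shows rotate_Int_horizontal: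
      "rotate_subspace standard_J \<theta> (op_graph T) \<inter> horizontal_lagrangian = (\<lambda>x. (x, 0)) ` \<K>"
    and fredholm_pair_rotate_iff:
      "fredholm_pair (rotate_subspace standard_J \<theta> (op_graph T)) horizontal_lagrangian \<longleftrightarrow>
        finite_dimensional \<K> \<and> finite_codimensional ((\<lambda>x. op_fun T x - tan \<theta> *\<^sub>R x) ` op_dom T)"
proof -
  interpret sa_operator "op_dom T" "op_fun T" by (rule selfadjoint_imp_sa_operator[OF T])
  let ?G = "rotate_subspace standard_J \<theta> (op_graph T)"
  let ?L = "horizontal_lagrangian :: ('h \<times> 'h) set"
  let ?R = "(\<lambda>x. op_fun T x - tan \<theta> *\<^sub>R x) ` op_dom T"
  have c: "cos \<theta> > 0" using \<theta> by (intro cos_gt_zero_pi) auto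
  have s: "sin \<theta> = cos \<theta> * tan \<theta>" using c by (simp add: tan_def)
  have sc: "cos \<theta> * cos \<theta> + sin \<theta> * sin \<theta> = 1"
    using sin_cos_squared_add[of \<theta>] by (simp add: power2_eq_square)
  have comb: "(cos \<theta> * cos \<theta>) *\<^sub>R v + (sin \<theta> * sin \<theta>) *\<^sub>R v = v" for v :: 'h
    by (simp only: sc scaleR_one flip: scaleR_add_left)
  have second: "cos \<theta> *\<^sub>R op_fun T x - sin \<theta> *\<^sub>R x = cos \<theta> *\<^sub>R (op_fun T x - tan \<theta> *\<^sub>R x)" for x
    unfolding s by (simp add: algebra_simps)
  have K: "\<K> = {x \<in> op_dom T. op_fun T x = tan \<theta> *\<^sub>R x}" unfolding \<K>_def eigenspace_def ..
  have subK: "subspace \<K>" unfolding \<K>_def by (rule subspace_eigenspace)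
  show Int: "?G \<inter> ?L = (\<lambda>x. (x, 0)) ` \<K>"
  proof (intro equalityI subsetI)
    fix z assume "z \<in> ?G \<inter> ?L"
    then obtain x where x: "x \<in> op_dom T" "z = (cos \<theta> *\<^sub>R x + sin \<theta> *\<^sub>R op_fun T x, 0)"
      "cos \<theta> *\<^sub>R (op_fun T x - tan \<theta> *\<^sub>R x) = 0"
      unfolding rotate_op_graph second horizontal_lagrangian_def by auto
    then have xK: "x \<in> \<K>" using c unfolding K by simp
    then have "op_fun T x = tan \<theta> *\<^sub>R x" unfolding K by simp
    then have "cos \<theta> *\<^sub>R x + sin \<theta> *\<^sub>R op_fun T x \<in> \<K>"
      using xK subK by (simp add: subspace_add subspace_scale)
    then show "z \<in> (\<lambda>x. (x, 0)) ` \<K>" unfolding x(2) by blast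
  next
    fix z assume "z \<in> (\<lambda>x. (x, 0 :: 'h)) ` \<K>"
    then obtain y where y: "y \<in> \<K>" "z = (y, 0)" by blast
    \<comment> \<open>On an eigenvector x for tan \<theta> the first component of the rotation is x
      / cos \<theta>, which explains the factor.\<close>
    define x where "x = cos \<theta> *\<^sub>R y"
    have "x \<in> \<K>" unfolding x_def using subK y(1) by (rule subspace_scale)
    then have x: "x \<in> op_dom T" "op_fun T x = tan \<theta> *\<^sub>R x" unfolding K by auto
    have sT: "sin \<theta> *\<^sub>R op_fun T x = (sin \<theta> * sin \<theta>) *\<^sub>R y"
      unfolding x(2) unfolding x_def using s by (simp add: mult_ac)
    have "cos \<theta> *\<^sub>R x + sin \<theta> *\<^sub>R op_fun T x = y"
      unfolding sT by (simp only: x_def comb scaleR_scaleR)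
    then have "z = (cos \<theta> *\<^sub>R x + sin \<theta> *\<^sub>R op_fun T x, cos \<theta> *\<^sub>R op_fun T x - sin \<theta> *\<^sub>R x)"
      unfolding second y(2) using x(2) by simp
    then show "z \<in> ?G \<inter> ?L"
      unfolding rotate_op_graph using x(1) y(2) by (auto simp: horizontal_lagrangian_def)
  qed
  have subR: "subspace ?R" by (rule subspace_shift_range)
  \<comment> \<open>The horizontal subspace absorbs any first component, so the second component, a
    nonzero multiple of (T - tan \<theta>) x, decides membership.\<close>
  have sum: "{u + v | u v. u \<in> ?G \<and> v \<in> ?L} = UNIV \<times> ?R"
  proof (intro equalityI subsetI)
    fix z assume "z \<in> {u + v | u v. u \<in> ?G \<and> v \<in> ?L}"
    then obtain x where x: "x \<in> op_dom T" "snd z = cos \<theta> *\<^sub>R (op_fun T x - tan \<theta> *\<^sub>R x)"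
      unfolding rotate_op_graph second horizontal_lagrangian_def by auto
    have "snd z \<in> ?R" unfolding x(2) using x(1) by (intro subspace_scale[OF subR]) blast
    then show "z \<in> UNIV \<times> ?R" by (simp add: mem_Times_iff)
  next
    fix z :: "'h \<times> 'h" assume "z \<in> UNIV \<times> ?R"
    then have "inverse (cos \<theta>) *\<^sub>R snd z \<in> ?R" by (intro subspace_scale[OF subR]) (auto simp: mem_Times_iff)
    then obtain x where x: "x \<in> op_dom T" "inverse (cos \<theta>) *\<^sub>R snd z = op_fun T x - tan \<theta> *\<^sub>R x" by blast
    have "snd z = cos \<theta> *\<^sub>R (op_fun T x - tan \<theta> *\<^sub>R x)" unfolding x(2)[symmetric] using c by simp
    then have "z = (cos \<theta> *\<^sub>R x + sin \<theta> *\<^sub>R op_fun T x, cos \<theta> *\<^sub>R op_fun T x - sin \<theta> *\<^sub>R x)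
        + (fst z - (cos \<theta> *\<^sub>R x + sin \<theta> *\<^sub>R op_fun T x), 0)"
      unfolding second by (simp add: prod_eq_iff)
    then show "z \<in> {u + v | u v. u \<in> ?G \<and> v \<in> ?L}"
      unfolding rotate_op_graph horizontal_lagrangian_def using x(1) by blast
  qed
  \<comment> \<open>Writing the rotated graph as a preimage under the inverse rotation transfers
    closedness from the graph.\<close>
  have G_vimage: "?G = (\<lambda>z. (cos \<theta> *\<^sub>R fst z - sin \<theta> *\<^sub>R snd z, cos \<theta> *\<^sub>R snd z + sin \<theta> *\<^sub>R fst z)) -` op_graph T"
  proof (intro equalityI subsetI)
    fix z assume "z \<in> ?G"
    then obtain x where x: "x \<in> op_dom T" "z = (cos \<theta> *\<^sub>R x + sin \<theta> *\<^sub>R op_fun T x, cos \<theta> *\<^sub>R op_fun T x - sin \<theta> *\<^sub>R x)"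
      unfolding rotate_op_graph by blast
    have "cos \<theta> *\<^sub>R fst z - sin \<theta> *\<^sub>R snd z = x" "cos \<theta> *\<^sub>R snd z + sin \<theta> *\<^sub>R fst z = op_fun T x"
      unfolding x(2) using comb[of x] comb[of "op_fun T x"] by (simp_all add: algebra_simps)
    then show "z \<in> (\<lambda>z. (cos \<theta> *\<^sub>R fst z - sin \<theta> *\<^sub>R snd z, cos \<theta> *\<^sub>R snd z + sin \<theta> *\<^sub>R fst z)) -` op_graph T"
      using x(1) by (auto simp: op_graph_def)
  next
    fix z assume "z \<in> (\<lambda>z. (cos \<theta> *\<^sub>R fst z - sin \<theta> *\<^sub>R snd z, cos \<theta> *\<^sub>R snd z + sin \<theta> *\<^sub>R fst z)) -` op_graph T"
    then obtain x where x: "x \<in> op_dom T" "x = cos \<theta> *\<^sub>R fst z - sin \<theta> *\<^sub>R snd z"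
      "op_fun T x = cos \<theta> *\<^sub>R snd z + sin \<theta> *\<^sub>R fst z"
      by (auto simp: op_graph_def)
    have "cos \<theta> *\<^sub>R x + sin \<theta> *\<^sub>R op_fun T x = fst z" "cos \<theta> *\<^sub>R op_fun T x - sin \<theta> *\<^sub>R x = snd z"
      unfolding x(3) unfolding x(2) using comb[of "fst z"] comb[of "snd z"] by (simp_all add: algebra_simps)
    then have "z = (cos \<theta> *\<^sub>R x + sin \<theta> *\<^sub>R op_fun T x, cos \<theta> *\<^sub>R op_fun T x - sin \<theta> *\<^sub>R x)"
      by (simp add: prod_eq_iff)
    then show "z \<in> ?G" unfolding rotate_op_graph using x(1) by blast
  qed
  have rot: "bounded_linear (\<lambda>z :: 'h \<times> 'h. (cos \<theta> *\<^sub>R fst z - sin \<theta> *\<^sub>R snd z, cos \<theta> *\<^sub>R snd z + sin \<theta> *\<^sub>R fst z))"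
    by (intro bounded_linear_Pair bounded_linear_sub bounded_linear_add
        bounded_linear_compose[OF bounded_linear_scaleR_right] bounded_linear_fst bounded_linear_snd)
  have subG: "subspace ?G"
    unfolding G_vimage unfolding op_graph_conv_graph[OF T]
    by (rule linear_subspace_vimage[OF bounded_linear.linear[OF rot] subspace_graph])
  have clG: "closed ?G"
    unfolding G_vimage unfolding op_graph_conv_graph[OF T]
    using closed_graph by (rule closed_vimage) (intro continuous_intros)
  have subL: "subspace ?L" using lagrangian_horizontal by (auto simp: lagrangian_def)
  have clL: "closed ?L" unfolding horizontal_lagrangian_def by (intro closed_Times) auto
  have "finite_dimensional ((\<lambda>x. (x, 0 :: 'h)) ` \<K>) \<longleftrightarrow> finite_dimensional \<K>"
  proof
    assume "finite_dimensional ((\<lambda>x. (x, 0 :: 'h)) ` \<K>)"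
    then have "finite_dimensional (fst ` (\<lambda>x. (x, 0 :: 'h)) ` \<K>)"
      by (rule finite_dimensional_image[OF bounded_linear.linear[OF bounded_linear_fst]])
    then show "finite_dimensional \<K>" by (simp add: image_image)
  next
    have "linear (\<lambda>x. (x, 0 :: 'h))" by (intro linearI) auto
    then show "finite_dimensional ((\<lambda>x. (x, 0 :: 'h)) ` \<K>)" if "finite_dimensional \<K>"
      using that by (rule finite_dimensional_image)
  qed
  then show "fredholm_pair ?G ?L \<longleftrightarrow> finite_dimensional \<K> \<and> finite_codimensional ?R"
    unfolding fredholm_pair_def Int sum
    using subG clG subL clL finite_codimensional_UNIV_Times[where 'b='h, OF subspace_0[OF subR]] by simp
qed

text \<open>
  The common meaning of the conditions imposed on \<open>a\<close> in the spectral flow and on \<open>\<alpha> = arctan a\<close> in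
  the Maslov index.
\<close>

definition window_regular :: "'h::complex_hilbert_space operator \<Rightarrow> real \<Rightarrow> bool"
  where "window_regular T a \<longleftrightarrow>
    (\<forall>t. \<bar>t\<bar> \<le> a \<longrightarrow> finite_dimensional (sa_operator.eigenspace (op_dom T) (op_fun T) t) \<and>
      finite_codimensional ((\<lambda>x. op_fun T x - t *\<^sub>R x) ` op_dom T)) \<and>
    sa_operator.eigenspace (op_dom T) (op_fun T) a = {0} \<and>
    sa_operator.eigenspace (op_dom T) (op_fun T) (- a) = {0}"

lemma window_regular_gap:
  assumes "selfadjoint T" "window_regular T a" "\<bar>t\<bar> \<le> a"
  shows "sa_operator.gap_at (op_dom T) (op_fun T) t"
proof (rule sa_operator.finite_codimensional_imp_gap[OF selfadjoint_imp_sa_operator[OF assms(1)]])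
  show "finite_codimensional ((\<lambda>x. op_fun T x - t *\<^sub>R x) ` op_dom T)"
    using assms(2,3) unfolding window_regular_def by simp
qed

text \<open>At \<plusminus>a, finite codimension yields a lower bound off the kernel; with trivial
  kernel this makes T - t bijective with bounded inverse. Conversely, resolvent points have trivial
  kernel.\<close>

lemma window_regular_spectrum_iff:
  assumes T: "selfadjoint T" and a: "0 < a"
  shows "window_regular T a \<longleftrightarrow>
    complex_of_real a \<notin> spectrum T \<and> complex_of_real (- a) \<notin> spectrum T \<and>
    complex_of_real ` {- a..a} \<inter> ess_spectrum T = {}"
proof -
  have ess: "complex_of_real ` {- a..a} \<inter> ess_spectrum T = {} \<longleftrightarrow>
    (\<forall>t. \<bar>t\<bar> \<le> a \<longrightarrow> finite_dimensional (sa_operator.eigenspace (op_dom T) (op_fun T) t) \<and>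
      finite_codimensional ((\<lambda>x. op_fun T x - t *\<^sub>R x) ` op_dom T))"
  proof -
    have "complex_of_real ` {- a..a} \<inter> ess_spectrum T = {} \<longleftrightarrow> (\<forall>t\<in>{- a..a}. complex_of_real t \<notin> ess_spectrum T)"
      by blast
    then show ?thesis
      unfolding fredholm_shift_iff[OF T, symmetric] by (auto simp: ess_spectrum_def abs_le_iff)
  qed
  show ?thesis
  proof
    assume reg: "window_regular T a"
    have triv: "sa_operator.eigenspace (op_dom T) (op_fun T) a = {0}"
      "sa_operator.eigenspace (op_dom T) (op_fun T) (- a) = {0}"
      using reg by (simp_all only: window_regular_def)
    show "complex_of_real a \<notin> spectrum T \<and> complex_of_real (- a) \<notin> spectrum T \<and>
      complex_of_real ` {- a..a} \<inter> ess_spectrum T = {}"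
    proof (intro conjI)
      show "complex_of_real a \<notin> spectrum T"
        using a by (intro gap_imp_resolvent_set[OF T] window_regular_gap[OF T reg] triv) simp
      show "complex_of_real (- a) \<notin> spectrum T"
        using a by (intro gap_imp_resolvent_set[OF T] window_regular_gap[OF T reg] triv) simp
      show "complex_of_real ` {- a..a} \<inter> ess_spectrum T = {}"
        using reg unfolding ess window_regular_def by (rule conjunct1)
    qed
  next
    assume *: "complex_of_real a \<notin> spectrum T \<and> complex_of_real (- a) \<notin> spectrum T \<and>
      complex_of_real ` {- a..a} \<inter> ess_spectrum T = {}"
    show "window_regular T a"
      unfolding window_regular_def ess[symmetric]
      by (intro conjI resolvent_set_imp_eigenspace_trivial[OF T]) (use * in simp_all)
  qed
qed

text \<open>tan maps [-\<alpha>, \<alpha>] bijectively onto [- tan \<alpha>, tan \<alpha>], and the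
  two ends correspond.\<close>

lemma window_regular_rotate_iff:
  assumes T: "selfadjoint T" and \<alpha>: "0 < \<alpha>" "\<alpha> < pi / 2"
  shows "window_regular T (tan \<alpha>) \<longleftrightarrow>
    (\<forall>\<theta>. \<bar>\<theta>\<bar> \<le> \<alpha> \<longrightarrow> fredholm_pair (rotate_subspace standard_J \<theta> (op_graph T)) horizontal_lagrangian) \<and>
    rotate_subspace standard_J \<alpha> (op_graph T) \<inter> horizontal_lagrangian = {0} \<and>
    rotate_subspace standard_J (- \<alpha>) (op_graph T) \<inter> horizontal_lagrangian = {0}"
proof -
  interpret sa_operator "op_dom T" "op_fun T" by (rule selfadjoint_imp_sa_operator[OF T])
  have inj: "(\<lambda>x :: 'a. (x, 0 :: 'a)) ` V = {0} \<longleftrightarrow> V = {0}" for V :: "'a set"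
    by (auto simp: zero_prod_def)
  have fred: "(\<forall>\<theta>. \<bar>\<theta>\<bar> \<le> \<alpha> \<longrightarrow> fredholm_pair (rotate_subspace standard_J \<theta> (op_graph T)) horizontal_lagrangian) \<longleftrightarrow>
    (\<forall>t. \<bar>t\<bar> \<le> tan \<alpha> \<longrightarrow> finite_dimensional (eigenspace t) \<and>
      finite_codimensional ((\<lambda>x. op_fun T x - t *\<^sub>R x) ` op_dom T))" (is "?L \<longleftrightarrow> ?R")
  proof
    assume L: ?L
    show ?R
    proof (intro allI impI)
      fix t assume t: "\<bar>t\<bar> \<le> tan \<alpha>"
      have at: "arctan (tan \<alpha>) = \<alpha>" using \<alpha> by (intro arctan_tan) auto
      have "arctan t \<le> arctan (tan \<alpha>)" "arctan (- tan \<alpha>) \<le> arctan t" using t by (auto simp: arctan_le_iff)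
      then have "\<bar>arctan t\<bar> \<le> \<alpha>" by (simp add: at arctan_minus abs_le_iff)
      then have "fredholm_pair (rotate_subspace standard_J (arctan t) (op_graph T)) horizontal_lagrangian"
        using L by blast
      moreover have "\<bar>arctan t\<bar> < pi / 2" using arctan_bounded[of t] by linarith
      ultimately show "finite_dimensional (eigenspace t) \<and>
          finite_codimensional ((\<lambda>x. op_fun T x - t *\<^sub>R x) ` op_dom T)"
        using fredholm_pair_rotate_iff[OF T, of "arctan t"] by (simp add: tan_arctan)
    qed
  next
    assume R: ?R
    show ?L
    proof (intro allI impI)
      fix \<theta> assume \<theta>: "\<bar>\<theta>\<bar> \<le> \<alpha>"
      have "tan \<theta> \<le> tan \<alpha>" "tan (- \<alpha>) \<le> tan \<theta>"
        using \<theta> \<alpha> by (intro tan_mono_le; linarith)+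
      then have "\<bar>tan \<theta>\<bar> \<le> tan \<alpha>" by (simp add: abs_le_iff)
      then show "fredholm_pair (rotate_subspace standard_J \<theta> (op_graph T)) horizontal_lagrangian"
        using R \<theta> \<alpha> by (subst fredholm_pair_rotate_iff[OF T]) auto
    qed
  qed
  have "\<bar>\<alpha>\<bar> < pi / 2" "\<bar>- \<alpha>\<bar> < pi / 2" using \<alpha> by auto
  note Int = rotate_Int_horizontal[OF T this(1)] rotate_Int_horizontal[OF T this(2)]
  show ?thesis unfolding fred Int inj window_regular_def tan_minus ..
qed

text \<open>The sum over angles becomes a sum over eigenvalues t = tan \<theta>, and the eigenspaces
  fill the band over [0, tan \<alpha>]. Both sides count real dimensions.\<close>

lemma rotation_count_eq_dim:
  assumes T: "selfadjoint T" and \<alpha>: "0 < \<alpha>" "\<alpha> < pi / 2" and reg: "window_regular T (tan \<alpha>)"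
  shows "rotation_count standard_J horizontal_lagrangian (op_graph T) \<alpha> =
    dim (range (spectral_proj {0..tan \<alpha>} T))"
proof -
  interpret spectral_resolution "op_dom T" "op_fun T" "spectral_family_of T"
    by (rule spectral_family_of[OF T])
  let ?E = "{t. 0 \<le> t \<and> t \<le> tan \<alpha> \<and> eigenspace t \<noteq> {0}}"
  let ?rot = "\<lambda>\<theta>. rotate_subspace standard_J \<theta> (op_graph T) \<inter> horizontal_lagrangian"
  let ?\<Theta> = "{\<theta>. 0 \<le> \<theta> \<and> \<theta> \<le> \<alpha> \<and> ?rot \<theta> \<noteq> {0}}"
  have tan_pos: "0 < tan \<alpha>" using \<alpha> by (intro tan_gt_zero)
  have fin: "finite_dimensional (eigenspace t)" if "\<bar>t\<bar> \<le> tan \<alpha>" for t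
    using reg that unfolding window_regular_def by simp
  have inj: "(\<lambda>x :: 'a. (x, 0 :: 'a)) ` V = {0} \<longleftrightarrow> V = {0}" for V :: "'a set"
    by (auto simp: zero_prod_def)
  have rot: "?rot \<theta> = (\<lambda>x. (x, 0)) ` eigenspace (tan \<theta>)" if "0 \<le> \<theta>" "\<theta> \<le> \<alpha>" for \<theta>
    using that \<alpha> by (intro rotate_Int_horizontal[OF T]) auto
  have le_iff: "tan \<theta> \<le> tan \<alpha>" "0 \<le> tan \<theta>" if "0 \<le> \<theta>" "\<theta> \<le> \<alpha>" for \<theta>
    using that \<alpha> tan_mono_le[of \<theta> \<alpha>] tan_mono_le[of 0 \<theta>] by auto
  have at: "arctan (tan \<theta>) = \<theta>" if "0 \<le> \<theta>" "\<theta> \<le> \<alpha>" for \<theta>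
    using that \<alpha> by (intro arctan_tan) auto
  have "rotation_count standard_J horizontal_lagrangian (op_graph T) \<alpha> = (\<Sum>\<theta>\<in>?\<Theta>. dim (?rot \<theta>))"
    unfolding rotation_count_def ..
  also have "\<dots> = (\<Sum>t\<in>?E. dim (eigenspace t))"
  proof (rule sum.reindex_bij_witness[where i=arctan and j=tan])
    fix \<theta> assume "\<theta> \<in> ?\<Theta>"
    then have \<theta>: "0 \<le> \<theta>" "\<theta> \<le> \<alpha>" "?rot \<theta> \<noteq> {0}" by auto
    show "arctan (tan \<theta>) = \<theta>" by (rule at[OF \<theta>(1,2)])
    show "tan \<theta> \<in> ?E" using \<theta>(3) le_iff[OF \<theta>(1,2)] unfolding rot[OF \<theta>(1,2)] inj by blast
    have "finite_dimensional (eigenspace (tan \<theta>))" using le_iff[OF \<theta>(1,2)] by (intro fin) simp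
    then show "dim (eigenspace (tan \<theta>)) = dim (?rot \<theta>)"
      unfolding rot[OF \<theta>(1,2)] by (rule dim_Times_0[symmetric])
  next
    fix t assume "t \<in> ?E"
    then have t: "0 \<le> t" "t \<le> tan \<alpha>" "eigenspace t \<noteq> {0}" by auto
    show tt: "tan (arctan t) = t" by (rule tan_arctan)
    have "arctan 0 \<le> arctan t" "arctan t \<le> arctan (tan \<alpha>)" using t by (auto simp: arctan_le_iff)
    then have "0 \<le> arctan t" "arctan t \<le> \<alpha>" using at[of \<alpha>] \<alpha> by auto
    moreover have "?rot (arctan t) \<noteq> {0}"
      unfolding rot[OF \<open>0 \<le> arctan t\<close> \<open>arctan t \<le> \<alpha>\<close>] inj tt by (rule t(3))
    ultimately show "arctan t \<in> ?\<Theta>" by blast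
  qed
  also have "\<dots> = dim (band 0 (tan \<alpha>))"
  proof (rule dim_band(2)[OF tan_pos, symmetric])
    show "gap_at t" if "- tan \<alpha> \<le> t" "t \<le> tan \<alpha>" for t
      using that by (intro window_regular_gap[OF T reg]) (simp add: abs_le_iff)
    show "finite_dimensional (eigenspace t)" if "0 \<le> t" "t \<le> tan \<alpha>" for t using that by (intro fin) simp
  qed
  also have "band 0 (tan \<alpha>) = range (spectral_proj {0..tan \<alpha>} T)"
    using spectral_proj_Icc[OF T, of 0 "tan \<alpha>"] tan_pos range_band_proj by simp
  finally show ?thesis .
qed

text \<open>Fredholmness of the pair is the case \<theta> = 0 of the rotated statement, and the
  Lagrangian distance of two graphs is by definition the gap distance.\<close>

lemma fredholm_lagrangian_path_op_graph:
  fixes A :: "real \<Rightarrow> 'h::complex_hilbert_space operator"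
  assumes A: "\<forall>t\<in>{0..1}. A t \<in> CF_sa" and cont: "gap_continuous_on {0..1} A"
  shows "fredholm_lagrangian_path standard_J (\<lambda>t. op_graph (A t)) horizontal_lagrangian"
proof -
  have "op_graph (A t) \<in> fredholm_lagrangians standard_J horizontal_lagrangian" if "t \<in> {0..1}" for t
  proof -
    have T: "selfadjoint (A t)" and f: "fredholm (A t)" using A that by (auto simp: CF_sa_def)
    interpret sa_operator "op_dom (A t)" "op_fun (A t)" by (rule selfadjoint_imp_sa_operator[OF T])
    have "rotate_subspace standard_J 0 (op_graph (A t)) = op_graph (A t)"
      unfolding rotate_op_graph by (auto simp: op_graph_def)
    moreover have "finite_dimensional (eigenspace 0)" "finite_codimensional ((\<lambda>x. op_fun (A t) x - 0 *\<^sub>R x) ` op_dom (A t))"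
      using f by (auto simp: fredholm_def eigenspace_def)
    ultimately have "fredholm_pair (op_graph (A t)) horizontal_lagrangian"
      using fredholm_pair_rotate_iff[OF T, of 0] by simp
    then show ?thesis using lagrangian_op_graph[OF T] by (simp add: fredholm_lagrangians_def)
  qed
  moreover have "lagrangian_dist (op_graph (A s)) (op_graph (A t)) = gap_dist (A s) (A t)" for s t
    by (simp add: lagrangian_dist_def gap_dist_def)
  ultimately show ?thesis
    using cont symplectic_standard_J lagrangian_horizontal
    unfolding fredholm_lagrangian_path_def gap_continuous_on_def by simp
qed

lemma partition_interval_subset:
  fixes l :: "nat \<Rightarrow> real"
  assumes l: "l 0 = 0" "l N = 1" "\<forall>i\<in>{1..N}. l (i - 1) < l i" and i: "i \<in> {1..N}"
  shows "{l (i - 1)..l i} \<subseteq> {0..1}"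
proof -
  have mono: "l j \<le> l k" if "j \<le> k" "k \<le> N" for j k
    using that
  proof (induction k rule: dec_induct)
    case (step n)
    then have "l n < l (Suc n)" using l(3)[rule_format, of "Suc n"] by simp
    then show ?case using step by simp
  qed simp
  show ?thesis using mono[of 0 "i - 1"] mono[of i N] i l(1,2) by auto
qed

theorem theorem4p7:
  fixes A :: "real \<Rightarrow> 'h::complex_hilbert_space operator"
  assumes "separable_space (euclidean :: 'h topology)"
    and "\<forall>t\<in>{0..1}. A t \<in> CF_sa"
    and "gap_continuous_on {0..1} A"
  shows "spectral_flow A =
    maslov_index standard_J (\<lambda>t. op_graph (A t)) horizontal_lagrangian"
proof -
  have sa: "selfadjoint (A t)" if "t \<in> {0..1}" for t using assms(2) that by (simp add: CF_sa_def)
  define sf where "sf l a i \<longleftrightarrow> (\<forall>t\<in>{l (i - 1)..l i}.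
          complex_of_real (a i) \<notin> spectrum (A t) \<and> complex_of_real (- a i) \<notin> spectrum (A t) \<and>
          complex_of_real ` {- a i..a i} \<inter> ess_spectrum (A t) = {} \<and>
          ((\<lambda>s. onorm (\<lambda>x. spectral_proj {- a i..a i} (A s) x - spectral_proj {- a i..a i} (A t) x))
            \<longlongrightarrow> 0) (at t within {l (i - 1)..l i}))" for l a :: "nat \<Rightarrow> real" and i
  define mas where "mas l \<alpha> i \<longleftrightarrow> (\<forall>t\<in>{l (i - 1)..l i}.
          (\<forall>\<theta>. \<bar>\<theta>\<bar> \<le> \<alpha> i \<longrightarrow> fredholm_pair (rotate_subspace standard_J \<theta> (op_graph (A t))) horizontal_lagrangian) \<and>
          rotate_subspace standard_J (\<alpha> i) (op_graph (A t)) \<inter> horizontal_lagrangian = {0} \<and>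
          rotate_subspace standard_J (- \<alpha> i) (op_graph (A t)) \<inter> horizontal_lagrangian = {0})"
    for l \<alpha> :: "nat \<Rightarrow> real" and i
  \<comment> \<open>The pivot between the two admissibility conditions \<open>sf\<close> and
    \<open>mas\<close>, on one subinterval of the partition.\<close>
  define regular where "regular l a i \<longleftrightarrow> (\<forall>t\<in>{l (i - 1)..l i}. window_regular (A t) (a i))"
    for l a :: "nat \<Rightarrow> real" and i
  define sf_sum where "sf_sum N l a = (\<Sum>i=1..N. int (dim (range (spectral_proj {0..a i} (A (l i)))))
                   - int (dim (range (spectral_proj {0..a i} (A (l (i - 1)))))))"
    for N and l a :: "nat \<Rightarrow> real"
  define mas_sum where "mas_sum N l \<alpha> =
      (\<Sum>i=1..N. int (rotation_count standard_J horizontal_lagrangian (op_graph (A (l i))) (\<alpha> i))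
                   - int (rotation_count standard_J horizontal_lagrangian (op_graph (A (l (i - 1)))) (\<alpha> i)))"
    for N and l \<alpha> :: "nat \<Rightarrow> real"
  have sf_iff: "sf l a i \<longleftrightarrow> regular l a i"
    if a: "0 < a i" and sub: "{l (i - 1)..l i} \<subseteq> {0..1}" for l a i
  proof -
    have "complex_of_real (a i) \<notin> spectrum (A t) \<and> complex_of_real (- a i) \<notin> spectrum (A t) \<and>
          complex_of_real ` {- a i..a i} \<inter> ess_spectrum (A t) = {} \<and>
          ((\<lambda>s. onorm (\<lambda>x. spectral_proj {- a i..a i} (A s) x - spectral_proj {- a i..a i} (A t) x))
            \<longlongrightarrow> 0) (at t within {l (i - 1)..l i}) \<longleftrightarrow> window_regular (A t) (a i)"
      if t: "t \<in> {l (i - 1)..l i}" for t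
    proof -
      \<comment> \<open>Coming from the Maslov side, the continuity clause of the spectral flow has
        to be supplied; it follows from gap continuity and regularity at t.\<close>
      have T: "selfadjoint (A t)" using sub t by (intro sa) blast
      have "((\<lambda>s. onorm (\<lambda>x. spectral_proj {- a i..a i} (A s) x - spectral_proj {- a i..a i} (A t) x))
            \<longlongrightarrow> 0) (at t within {l (i - 1)..l i})" if reg: "window_regular (A t) (a i)"
      proof (rule spectral_proj_tendsto[OF _ t])
        show "((\<lambda>s. gap_dist (A s) (A t)) \<longlongrightarrow> 0) (at t within {l (i - 1)..l i})"
          using assms(3) t sub unfolding gap_continuous_on_def by (meson subsetD tendsto_within_subset)
        show "selfadjoint (A s)" if "s \<in> {l (i - 1)..l i}" for s using that sub by (intro sa) blast
        show "sa_operator.gap_at (op_dom (A t)) (op_fun (A t)) (a i)"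
          "sa_operator.gap_at (op_dom (A t)) (op_fun (A t)) (- a i)"
          using a by (auto intro!: window_regular_gap[OF T reg])
      qed (use a reg in \<open>simp_all add: window_regular_def\<close>)
      then show ?thesis unfolding window_regular_spectrum_iff[OF T a] by argo
    qed
    then show ?thesis unfolding sf_def regular_def by (rule ball_cong[OF refl])
  qed
  have mas_iff: "mas l \<alpha> i \<longleftrightarrow> regular l (\<lambda>i. tan (\<alpha> i)) i"
    if \<alpha>: "0 < \<alpha> i" "\<alpha> i < pi / 2" and sub: "{l (i - 1)..l i} \<subseteq> {0..1}" for l \<alpha> i
    unfolding mas_def regular_def
    by (intro ball_cong refl window_regular_rotate_iff[OF sa \<alpha>, symmetric]) (use sub in blast)
  have regular_cong: "regular l a i \<longleftrightarrow> regular l b i" if "a i = b i" for l a b i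
    unfolding regular_def that ..
  have sum_eq: "sf_sum N l a = mas_sum N l \<alpha>"
    if l: "l 0 = 0" "l N = 1" "\<forall>i\<in>{1..N}. l (i - 1) < l i"
      and \<alpha>: "\<And>i. i \<in> {1..N} \<Longrightarrow> 0 < \<alpha> i \<and> \<alpha> i < pi / 2 \<and> tan (\<alpha> i) = a i"
      and reg: "\<And>i. i \<in> {1..N} \<Longrightarrow> regular l a i" for N l a \<alpha>
    unfolding sf_sum_def mas_sum_def
  proof (rule sum.cong[OF refl])
    fix i assume i: "i \<in> {1..N}"
    have "dim (range (spectral_proj {0..a i} (A t))) = rotation_count standard_J horizontal_lagrangian (op_graph (A t)) (\<alpha> i)"
      if "t \<in> {l (i - 1)..l i}" for t
    proof -
      have "selfadjoint (A t)" using that partition_interval_subset[OF l i] by (intro sa) blast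
      moreover have "window_regular (A t) (tan (\<alpha> i))" using that reg[OF i] \<alpha>[OF i] unfolding regular_def by simp
      ultimately show ?thesis using \<alpha>[OF i] rotation_count_eq_dim[of "A t" "\<alpha> i"] by simp
    qed
    moreover have "l i \<in> {l (i - 1)..l i}" "l (i - 1) \<in> {l (i - 1)..l i}" using less_imp_le[OF l(3)[rule_format, OF i]] by simp_all
    ultimately show "int (dim (range (spectral_proj {0..a i} (A (l i))))) - int (dim (range (spectral_proj {0..a i} (A (l (i - 1))))))
        = int (rotation_count standard_J horizontal_lagrangian (op_graph (A (l i))) (\<alpha> i))
           - int (rotation_count standard_J horizontal_lagrangian (op_graph (A (l (i - 1)))) (\<alpha> i))"
      by simp
  qed
  have sf_char: "is_spectral_flow A m \<longleftrightarrow> (\<exists>N l a. l 0 = 0 \<and> l N = 1 \<and> (\<forall>i\<in>{1..N}. l (i - 1) < l i) \<and>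
      (\<forall>i\<in>{1..N}. 0 < a i \<and> sf l a i) \<and> m = sf_sum N l a)" for m
    unfolding is_spectral_flow_def sf_def sf_sum_def ..
  have mas_char: "is_maslov_index standard_J (\<lambda>t. op_graph (A t)) horizontal_lagrangian m \<longleftrightarrow>
    (\<exists>N l \<alpha>. l 0 = 0 \<and> l N = 1 \<and> (\<forall>i\<in>{1..N}. l (i - 1) < l i) \<and>
      (\<forall>i\<in>{1..N}. 0 < \<alpha> i \<and> \<alpha> i < pi / 2 \<and> mas l \<alpha> i) \<and> m = mas_sum N l \<alpha>)" for m
    unfolding is_maslov_index_def mas_def mas_sum_def
    using fredholm_lagrangian_path_op_graph[OF assms(2,3)] by (simp only: simp_thms)
  have "is_spectral_flow A m \<longleftrightarrow> is_maslov_index standard_J (\<lambda>t. op_graph (A t)) horizontal_lagrangian m" for m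
  proof
    assume "is_spectral_flow A m"
    then obtain N l a where l: "l 0 = 0" "l N = 1" "\<forall>i\<in>{1..N}. l (i - 1) < l i"
      and a: "\<And>i. i \<in> {1..N} \<Longrightarrow> 0 < a i" "\<And>i. i \<in> {1..N} \<Longrightarrow> sf l a i" and m: "m = sf_sum N l a"
      unfolding sf_char by blast
    \<comment> \<open>The partition is kept and only the window sizes are exchanged, by arctan here
      and by tan in the converse direction.\<close>
    define \<alpha> where "\<alpha> = (\<lambda>i. arctan (a i))"
    have \<alpha>: "0 < \<alpha> i \<and> \<alpha> i < pi / 2 \<and> tan (\<alpha> i) = a i" if "i \<in> {1..N}" for i
      using a(1)[OF that] arctan_ubound[of "a i"] by (simp add: \<alpha>_def tan_arctan)
    have reg: "regular l a i" if i: "i \<in> {1..N}" for i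
      using a(2)[OF i] sf_iff[of a i l, OF a(1)[OF i] partition_interval_subset[OF l i]] by blast
    have "mas l \<alpha> i" if i: "i \<in> {1..N}" for i
      using reg[OF i] mas_iff[of \<alpha> i l] \<alpha>[OF i] partition_interval_subset[OF l i]
        regular_cong[of a i "\<lambda>i. tan (\<alpha> i)" l] by simp
    moreover have "m = mas_sum N l \<alpha>" unfolding m by (rule sum_eq[OF l \<alpha> reg])
    ultimately show "is_maslov_index standard_J (\<lambda>t. op_graph (A t)) horizontal_lagrangian m"
      unfolding mas_char using l \<alpha> by blast
  next
    assume "is_maslov_index standard_J (\<lambda>t. op_graph (A t)) horizontal_lagrangian m"
    then obtain N l \<alpha> where l: "l 0 = 0" "l N = 1" "\<forall>i\<in>{1..N}. l (i - 1) < l i"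
      and \<alpha>: "\<And>i. i \<in> {1..N} \<Longrightarrow> 0 < \<alpha> i" "\<And>i. i \<in> {1..N} \<Longrightarrow> \<alpha> i < pi / 2"
        "\<And>i. i \<in> {1..N} \<Longrightarrow> mas l \<alpha> i" and m: "m = mas_sum N l \<alpha>"
      unfolding mas_char by blast
    define a where "a = (\<lambda>i. tan (\<alpha> i))"
    have a: "0 < a i" if "i \<in> {1..N}" for i
      unfolding a_def using \<alpha>(1,2)[OF that] by (rule tan_gt_zero)
    have reg: "regular l a i" if i: "i \<in> {1..N}" for i
      using \<alpha>(3)[OF i] mas_iff[of \<alpha> i l, OF \<alpha>(1,2)[OF i] partition_interval_subset[OF l i]]
      unfolding a_def by blast
    have "sf l a i" if i: "i \<in> {1..N}" for i
      using reg[OF i] sf_iff[of a i l, OF a[OF i] partition_interval_subset[OF l i]] by blast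
    moreover have "m = sf_sum N l a"
      unfolding m by (rule sum_eq[symmetric, OF l _ reg]) (use \<alpha>(1,2) in \<open>simp_all add: a_def\<close>)
    ultimately show "is_spectral_flow A m" unfolding sf_char using l a by blast
  qed
  \<comment> \<open>Equal predicates have equal definite descriptions.\<close>
  then have "is_spectral_flow A = is_maslov_index standard_J (\<lambda>t. op_graph (A t)) horizontal_lagrangian"
    by (rule ext)
  then show ?thesis by (simp add: spectral_flow_def maslov_index_def)
qed

end
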